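(* For every integer $n\geq 2$ there exists a compact complex manifold $X_n$ of complex dimension $4n-2$ such that the Frölicher spectral sequence of $X_n$ does not degenerate at the $E_n$ term, i.e., the $n$-th differential satisfies $d_n\neq 0$.
   Context: For a compact complex manifold $X$ let $\mathcal{A}^{p,q}(X)$ be the space of smooth complex-valued differential forms of type $(p,q)$, and let $d=\partial+\bar\partial$ be the decomposition of the exterior differential into its components of type $(1,0)$ and $(0,1)$. The Frölicher spectral sequence of $X$ is the spectral sequence of the double complex $(\mathcal{A}^{p,q}(X),\partial,\bar\partial)$ with $E_0^{p,q}=\mathcal{A}^{p,q}(X)$, $d_0=\bar\partial$, $E_1^{p,q}=H^{p,q}(X)=H^q(X,\Omega_X^p)$ (Dolbeault cohomology), $d_1=[\partial]$, and converging to de Rham cohomology: $E_r^{*,*}\Rightarrow H^*_{dR}(X,\mathbb{C})$. The $r$-th differential is $d_r:E_r^{p,q}\to E_r^{p+r,q-r+1}$; $d_n\neq 0$ means that $d_n:E_n^{p,q}\to E_n^{p+n,q-n+1}$ is non-zero for some $(p,q)$. *)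

theory Defs
  imports "HOL-Analysis.Analysis" "HOL-Library.Function_Algebras"
begin

section \<open>Smooth functions\<close>

text \<open>For open \<open>S\<close> in a Euclidean space, \<open>Ck_on k S f\<close> says that \<open>f\<close> is real \<open>C\<^sup>k\<close> on \<open>S\<close>;
  the recursion runs through all directional derivatives.\<close>

primrec Ck_on :: "nat \<Rightarrow> 'a::euclidean_space set \<Rightarrow> ('a \<Rightarrow> 'b::real_normed_vector) \<Rightarrow> bool" where
  "Ck_on 0 S f \<longleftrightarrow> continuous_on S f"
| "Ck_on (Suc k) S f \<longleftrightarrow>
     (\<forall>x\<in>S. f differentiable (at x)) \<and> (\<forall>v. Ck_on k S (\<lambda>x. frechet_derivative f (at x) v))"

definition smooth_on :: "'a::euclidean_space set \<Rightarrow> ('a \<Rightarrow> 'b::real_normed_vector) \<Rightarrow> bool" where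
  "smooth_on S f \<longleftrightarrow> (\<forall>k. Ck_on k S f)"


section \<open>Complex manifolds\<close>

text \<open>A chart is a pair \<open>(U, \<phi>)\<close>; the values of \<open>\<phi>\<close> outside \<open>U\<close> are irrelevant.
  The complex dimension is \<open>CARD('m)\<close>.\<close>

type_synonym ('a, 'm) chart = "'a set \<times> ('a \<Rightarrow> complex ^ 'm)"

definition chart_image :: "('a, 'm::finite) chart \<Rightarrow> (complex ^ 'm) set" where
  "chart_image c = snd c ` fst c"

definition transition ::
  "('a, 'm::finite) chart \<Rightarrow> ('a, 'm) chart \<Rightarrow> complex ^ 'm \<Rightarrow> complex ^ 'm" where
  "transition c c' = snd c' \<circ> inv_into (fst c) (snd c)"

definition transition_domain ::
  "('a, 'm::finite) chart \<Rightarrow> ('a, 'm) chart \<Rightarrow> (complex ^ 'm) set" where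
  "transition_domain c c' = snd c ` (fst c \<inter> fst c')"

definition holomorphic_map_on ::
  "(complex ^ 'm::finite) set \<Rightarrow> (complex ^ 'm \<Rightarrow> complex ^ 'k::finite) \<Rightarrow> bool" where
  "holomorphic_map_on S f \<longleftrightarrow>
     (\<forall>x\<in>S. \<exists>D. (f has_derivative D) (at x) \<and> (\<forall>c v. D (c *s v) = c *s D v))"

text \<open>The atlas need not be maximal. Connectedness is not part of the definition.\<close>

definition complex_manifold :: "'a topology \<Rightarrow> ('a, 'm::finite) chart set \<Rightarrow> bool" where
  "complex_manifold X \<A> \<longleftrightarrow>
     Hausdorff_space X \<and> second_countable X \<and>
     topspace X = (\<Union>c\<in>\<A>. fst c) \<and>
     (\<forall>c\<in>\<A>. openin X (fst c) \<and> open (chart_image c) \<and>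
        homeomorphic_map (subtopology X (fst c)) (top_of_set (chart_image c)) (snd c)) \<and>
     (\<forall>c\<in>\<A>. \<forall>c'\<in>\<A>. holomorphic_map_on (transition_domain c c') (transition c c'))"

definition compact_complex_manifold :: "'a topology \<Rightarrow> ('a, 'm::finite) chart set \<Rightarrow> bool" where
  "compact_complex_manifold X \<A> \<longleftrightarrow> complex_manifold X \<A> \<and> compact_space X"


section \<open>Differential forms of type \<open>(p,q)\<close>\<close>

text \<open>A \<open>k\<close>-covector on \<open>\<complex>\<^sup>m\<close> (real alternating \<open>k\<close>-form with complex values) is a function on
  lists of tangent vectors that vanishes on lists of length other than \<open>k\<close>. The wedge product
  of 1-covectors uses the determinant convention, without a factor \<open>1/k!\<close>.\<close>

type_synonym 'm covector = "(complex ^ 'm) list \<Rightarrow> complex"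

definition wedge :: "(complex ^ 'm::finite \<Rightarrow> complex) list \<Rightarrow> 'm covector" where
  "wedge \<phi>s vs =
     (if length vs = length \<phi>s
      then \<Sum>\<sigma> | \<sigma> permutes {..<length \<phi>s}.
             of_int (sign \<sigma>) * (\<Prod>i<length \<phi>s. (\<phi>s ! i) (vs ! \<sigma> i))
      else 0)"

definition dz :: "'m::finite \<Rightarrow> complex ^ 'm \<Rightarrow> complex" where
  "dz i v = v $ i"

definition dzbar :: "'m::finite \<Rightarrow> complex ^ 'm \<Rightarrow> complex" where
  "dzbar i v = cnj (v $ i)"

text \<open>The span of all \<open>dz\<^sub>I \<and> d\<bar>z\<^sub>J\<close> with \<open>|I| = p\<close>, \<open>|J| = q\<close>. The multi-indices are arbitrary
  rather than increasing, which does not change the span.\<close>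

definition pq_covectors :: "nat \<Rightarrow> nat \<Rightarrow> 'm::finite covector set" where
  "pq_covectors p q =
     {\<alpha>. \<exists>a. \<alpha> = (\<lambda>vs. \<Sum>I | length I = p. \<Sum>J | length J = q.
                      a I J * wedge (map dz I @ map dzbar J) vs)}"

text \<open>A form on a manifold is a family of local forms on the chart images that is compatible with
  pull-back along the transition maps. Local forms vanish outside the chart image, and the family
  vanishes outside the atlas, so that equality of forms is equality of functions.\<close>

type_synonym ('a, 'm) form = "('a, 'm) chart \<Rightarrow> complex ^ 'm \<Rightarrow> 'm covector"

definition pq_forms :: "('a, 'm::finite) chart set \<Rightarrow> nat \<Rightarrow> nat \<Rightarrow> ('a, 'm) form set" where
  "pq_forms \<A> p q =
     {\<omega>. (\<forall>c x. c \<notin> \<A> \<or> x \<notin> chart_image c \<longrightarrow> \<omega> c x = (\<lambda>vs. 0)) \<and>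
         (\<forall>c\<in>\<A>. (\<forall>x\<in>chart_image c. \<omega> c x \<in> pq_covectors p q) \<and>
                 (\<forall>vs. smooth_on (chart_image c) (\<lambda>x. \<omega> c x vs))) \<and>
         (\<forall>c\<in>\<A>. \<forall>c'\<in>\<A>. \<forall>x\<in>transition_domain c c'. \<forall>vs.
            \<omega> c x vs =
            \<omega> c' (transition c c' x) (map (frechet_derivative (transition c c') (at x)) vs))}"

definition forms :: "('a, 'm::finite) chart set \<Rightarrow> int \<Rightarrow> int \<Rightarrow> ('a, 'm) form set" where
  "forms \<A> p q = (if p \<ge> 0 \<and> q \<ge> 0 then pq_forms \<A> (nat p) (nat q) else {0})"

text \<open>The \<open>\<complex>\<close>-linear and \<open>\<complex>\<close>-antilinear parts of the real derivative, i.e.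
  \<open>\<Sum>\<^sub>i (\<partial>f/\<partial>z\<^sub>i) dz\<^sub>i(v)\<close> and \<open>\<Sum>\<^sub>i (\<partial>f/\<partial>\<bar>z\<^sub>i) d\<bar>z\<^sub>i(v)\<close>.\<close>

definition deriv10 :: "(complex ^ 'm::finite \<Rightarrow> complex) \<Rightarrow> complex ^ 'm \<Rightarrow> complex ^ 'm \<Rightarrow> complex"
  where "deriv10 f x v =
    (frechet_derivative f (at x) v - \<i> * frechet_derivative f (at x) (\<i> *s v)) / 2"

definition deriv01 :: "(complex ^ 'm::finite \<Rightarrow> complex) \<Rightarrow> complex ^ 'm \<Rightarrow> complex ^ 'm \<Rightarrow> complex"
  where "deriv01 f x v =
    (frechet_derivative f (at x) v + \<i> * frechet_derivative f (at x) (\<i> *s v)) / 2"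

text \<open>For \<open>\<omega> = \<Sum> f\<^sub>I\<^sub>J dz\<^sub>I \<and> d\<bar>z\<^sub>J\<close> and \<open>\<delta>\<close> the full, the \<open>(1,0)\<close>- or the \<open>(0,1)\<close>-derivative of
  functions, \<open>alt_deriv \<delta> \<omega>\<close> is \<open>\<Sum> \<delta>f\<^sub>I\<^sub>J \<and> dz\<^sub>I \<and> d\<bar>z\<^sub>J\<close>.\<close>

definition alt_deriv ::
  "((complex ^ 'm::finite \<Rightarrow> complex) \<Rightarrow> complex ^ 'm \<Rightarrow> complex ^ 'm \<Rightarrow> complex) \<Rightarrow>
   ('a, 'm) form \<Rightarrow> ('a, 'm) form" where
  "alt_deriv \<delta> \<omega> c x vs =
     (if x \<in> chart_image c
      then \<Sum>i<length vs.
             (-1) ^ i * \<delta> (\<lambda>y. \<omega> c y (take i vs @ drop (Suc i) vs)) x (vs ! i)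
      else 0)"

definition ext_d :: "('a, 'm::finite) form \<Rightarrow> ('a, 'm) form" where
  "ext_d = alt_deriv (\<lambda>f x. frechet_derivative f (at x))"

definition del :: "('a, 'm::finite) form \<Rightarrow> ('a, 'm) form" where
  "del = alt_deriv deriv10"

definition delbar :: "('a, 'm::finite) form \<Rightarrow> ('a, 'm) form" where
  "delbar = alt_deriv deriv01"

lemma ext_d_eq_del_plus_delbar: "ext_d \<omega> = del \<omega> + delbar \<omega>"
proof -
  have "frechet_derivative f (at x) v = deriv10 f x v + deriv01 f x v"
    for f :: "complex ^ 'b \<Rightarrow> complex" and x v
    by (simp add: deriv10_def deriv01_def field_simps)
  then show ?thesis
    by (auto simp: fun_eq_iff ext_d_def del_def delbar_def alt_deriv_def
        sum.distrib[symmetric] distrib_left)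
qed

lemma deriv10_linear_deriv01_antilinear:
  assumes "f differentiable (at x)"
  shows "deriv10 f x (c *s v) = c * deriv10 f x v"
    and "deriv01 f x (c *s v) = cnj c * deriv01 f x v"
proof -
  let ?D = "frechet_derivative f (at x)"
  have lin: "linear ?D"
    using assms by (rule linear_frechet_derivative)
  have split: "a *s w = Re a *\<^sub>R w + Im a *\<^sub>R (\<i> *s w)" for a and w :: "complex ^ 'a"
    by (simp add: vec_eq_iff complex_eq_iff)
  have D: "?D (a *s w) = of_real (Re a) * ?D w + of_real (Im a) * ?D (\<i> *s w)" for a w
    by (subst split)
      (simp only: linear_add[OF lin] linear_scale[OF lin] scaleR_conv_of_real[where 'a = complex])
  have Di: "?D (\<i> *s (c *s v)) = - of_real (Im c) * ?D v + of_real (Re c) * ?D (\<i> *s v)"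
    using D[of "\<i> * c" v] by (simp add: vector_smult_assoc)
  show "deriv10 f x (c *s v) = c * deriv10 f x v"
    unfolding deriv10_def Di D[of c v]
    by (simp add: complex_eq_iff algebra_simps add_divide_distrib diff_divide_distrib)
  show "deriv01 f x (c *s v) = cnj c * deriv01 f x v"
    unfolding deriv01_def Di D[of c v]
    by (simp add: complex_eq_iff algebra_simps add_divide_distrib diff_divide_distrib)
qed


section \<open>The spectral sequence of a double complex\<close>

text \<open>A double complex is given by groups \<open>A p q\<close> and anticommuting differentials \<open>d'\<close> of bidegree
  \<open>(1,0)\<close> and \<open>d''\<close> of bidegree \<open>(0,1)\<close>. An element of the total complex is the family of its
  components, indexed by the first degree. The total differential is \<open>d' + d''\<close>, and the complex
  is filtered by the first degree.\<close>

definition Tot :: "(int \<Rightarrow> int \<Rightarrow> 'v::ab_group_add set) \<Rightarrow> int \<Rightarrow> (int \<Rightarrow> 'v) set" where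
  "Tot A k = {a. (\<forall>i. a i \<in> A i (k - i)) \<and> finite {i. a i \<noteq> 0}}"

definition Tot_diff :: "('v::ab_group_add \<Rightarrow> 'v) \<Rightarrow> ('v \<Rightarrow> 'v) \<Rightarrow> (int \<Rightarrow> 'v) \<Rightarrow> int \<Rightarrow> 'v" where
  "Tot_diff d' d'' a i = d' (a (i - 1)) + d'' (a i)"

definition Tot_filt :: "(int \<Rightarrow> int \<Rightarrow> 'v::ab_group_add set) \<Rightarrow> int \<Rightarrow> int \<Rightarrow> (int \<Rightarrow> 'v) set" where
  "Tot_filt A p k = {a \<in> Tot A k. \<forall>i<p. a i = 0}"

text \<open>With \<open>D\<close> the total differential and \<open>F\<close> the filtration,
  \<open>Z\<^sub>r\<^sup>p\<^sup>q = {a \<in> F\<^sup>p Tot\<^sup>p\<^sup>+\<^sup>q. D a \<in> F\<^sup>p\<^sup>+\<^sup>r Tot\<^sup>p\<^sup>+\<^sup>q\<^sup>+\<^sup>1}\<close> and \<open>E\<^sub>r\<^sup>p\<^sup>q\<close> is the quotient of \<open>Z\<^sub>r\<^sup>p\<^sup>q\<close> by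
  \<open>B\<^sub>r\<^sup>p\<^sup>q = Z\<^sub>r\<^sub>-\<^sub>1\<close> in bidegree \<open>(p + 1, q - 1)\<close> plus \<open>D Z\<^sub>r\<^sub>-\<^sub>1\<close> with \<open>Z\<^sub>r\<^sub>-\<^sub>1\<close> in bidegree
  \<open>(p - r + 1, q + r - 2)\<close>. For \<open>r = 0\<close> this gives \<open>E\<^sub>0 = F\<^sup>p/F\<^sup>p\<^sup>+\<^sup>1 = A p q\<close>.\<close>

definition ss_Z :: "(int \<Rightarrow> int \<Rightarrow> 'v::ab_group_add set) \<Rightarrow> ('v \<Rightarrow> 'v) \<Rightarrow> ('v \<Rightarrow> 'v) \<Rightarrow>
    int \<Rightarrow> int \<Rightarrow> int \<Rightarrow> (int \<Rightarrow> 'v) set" where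
  "ss_Z A d' d'' r p q =
     {a \<in> Tot_filt A p (p + q). Tot_diff d' d'' a \<in> Tot_filt A (p + r) (p + q + 1)}"

definition ss_B :: "(int \<Rightarrow> int \<Rightarrow> 'v::ab_group_add set) \<Rightarrow> ('v \<Rightarrow> 'v) \<Rightarrow> ('v \<Rightarrow> 'v) \<Rightarrow>
    int \<Rightarrow> int \<Rightarrow> int \<Rightarrow> (int \<Rightarrow> 'v) set" where
  "ss_B A d' d'' r p q =
     {x + Tot_diff d' d'' y | x y.
        x \<in> ss_Z A d' d'' (r - 1) (p + 1) (q - 1) \<and>
        y \<in> ss_Z A d' d'' (r - 1) (p - r + 1) (q + r - 2)}"

text \<open>Elements of \<open>ss_E A d' d'' r p q\<close> are cosets; its zero is the coset \<open>ss_B A d' d'' r p q\<close>.\<close>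

definition ss_E :: "(int \<Rightarrow> int \<Rightarrow> 'v::ab_group_add set) \<Rightarrow> ('v \<Rightarrow> 'v) \<Rightarrow> ('v \<Rightarrow> 'v) \<Rightarrow>
    int \<Rightarrow> int \<Rightarrow> int \<Rightarrow> (int \<Rightarrow> 'v) set set" where
  "ss_E A d' d'' r p q = {(\<lambda>b. z + b) ` ss_B A d' d'' r p q | z. z \<in> ss_Z A d' d'' r p q}"

text \<open>The map \<open>[z] \<mapsto> [D z]\<close> from \<open>E\<^sub>r\<close> in bidegree \<open>(p, q)\<close> to \<open>E\<^sub>r\<close> in bidegree
  \<open>(p + r, q - r + 1)\<close>.\<close>

definition ss_diff :: "(int \<Rightarrow> int \<Rightarrow> 'v::ab_group_add set) \<Rightarrow> ('v \<Rightarrow> 'v) \<Rightarrow> ('v \<Rightarrow> 'v) \<Rightarrow>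
    int \<Rightarrow> int \<Rightarrow> int \<Rightarrow> (int \<Rightarrow> 'v) set \<Rightarrow> (int \<Rightarrow> 'v) set" where
  "ss_diff A d' d'' r p q \<xi> =
     {Tot_diff d' d'' z + b | z b. z \<in> \<xi> \<and> b \<in> ss_B A d' d'' r (p + r) (q - r + 1)}"


section \<open>The Froelicher spectral sequence\<close>

definition froelicher_E ::
  "('a, 'm::finite) chart set \<Rightarrow> int \<Rightarrow> int \<Rightarrow> int \<Rightarrow> (int \<Rightarrow> ('a, 'm) form) set set" where
  "froelicher_E \<A> = ss_E (forms \<A>) del delbar"

definition froelicher_d :: "('a, 'm::finite) chart set \<Rightarrow> int \<Rightarrow> int \<Rightarrow> int \<Rightarrow>
    (int \<Rightarrow> ('a, 'm) form) set \<Rightarrow> (int \<Rightarrow> ('a, 'm) form) set" where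
  "froelicher_d \<A> = ss_diff (forms \<A>) del delbar"

definition froelicher_zero ::
  "('a, 'm::finite) chart set \<Rightarrow> int \<Rightarrow> int \<Rightarrow> int \<Rightarrow> (int \<Rightarrow> ('a, 'm) form) set" where
  "froelicher_zero \<A> = ss_B (forms \<A>) del delbar"

definition froelicher_d_nonzero :: "('a, 'm::finite) chart set \<Rightarrow> int \<Rightarrow> bool" where
  "froelicher_d_nonzero \<A> r \<longleftrightarrow>
     (\<exists>p q. \<exists>\<xi>\<in>froelicher_E \<A> r p q.
        froelicher_d \<A> r p q \<xi> \<noteq> froelicher_zero \<A> r (p + r) (q - r + 1))"

end

theory Submission
  imports Defs
begin

text \<open>
  The manifold is a compact quotient of \<open>\<complex>\<^sup>4\<^sup>n\<^sup>-\<^sup>2\<close> with coordinates \<open>x\<^sub>k, z\<^sub>k\<close> (\<open>k < n - 1\<close>) and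
  \<open>y\<^sub>k, w\<^sub>k\<close> (\<open>k < n\<close>) by a lattice in a two-step nilpotent group whose left translations are holomorphic.
  Its left-invariant \<open>(1,0)\<close>-forms are spanned by the closed forms \<open>dx\<^sub>k, dy\<^sub>k, dz\<^sub>k\<close> and by \<open>\<omega>\<^sub>k\<close> with
  \<open>d\<omega>\<^sub>0 = d\<bar>y\<^sub>0 \<and> dz\<^sub>0\<close> and \<open>d\<omega>\<^sub>k\<^sub>+\<^sub>1 = dy\<^sub>k \<and> d\<bar>z\<^sub>k + dx\<^sub>k \<and> dy\<^sub>k\<^sub>+\<^sub>1\<close>. Up to signs, the forms
  \<open>\<beta>\<^sub>0 = \<bar>\<omega>\<^sub>0 \<and> d\<bar>z\<^sub>1 \<and> \<dots> \<and> d\<bar>z\<^sub>n\<^sub>-\<^sub>2\<close> and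
  \<open>\<beta>\<^sub>j = \<omega>\<^sub>j \<and> dx\<^sub>0 \<and> \<dots> \<and> dx\<^sub>j\<^sub>-\<^sub>2 \<and> d\<bar>z\<^sub>j \<and> \<dots> \<and> d\<bar>z\<^sub>n\<^sub>-\<^sub>2\<close>
  form a zigzag \<open>\<partial>\<beta>\<^sub>j + \<partial>\<bar>\<beta>\<^sub>j\<^sub>+\<^sub>1 = 0\<close> starting with \<open>\<partial>\<bar>\<beta>\<^sub>0 = 0\<close>, so that
  \<open>d\<^sub>n[\<beta>\<^sub>0] = [dy\<^sub>n\<^sub>-\<^sub>1 \<and> dx\<^sub>0 \<and> \<dots> \<and> dx\<^sub>n\<^sub>-\<^sub>2]\<close>.

  This class is non-zero by a dual zigzag. If a total form without component of type \<open>(0,n-1)\<close> had this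
  form as its differential, averaging over the manifold would turn its components into left-invariant ones,
  because left-invariant derivatives have mean zero. Evaluating the equation in each bidegree on
  \<open>Y\<^sub>j, X\<^sub>0, \<dots>, X\<^sub>j\<^sub>-\<^sub>1, \<bar>Z\<^sub>j, \<dots>, \<bar>Z\<^sub>n\<^sub>-\<^sub>2\<close> only sees one bracket for \<open>\<partial>\<close> and one for \<open>\<partial>\<bar>\<close>; the values
  cancel successively, starting from \<open>0\<close> for \<open>j = 0\<close>, whereas the last one would have to be \<open>\<plusminus>1\<close>.
\<close>

section \<open>Two-step nilmanifolds\<close>

definition gauss_lattice :: "(complex ^ 'm::finite) set" where
  "gauss_lattice = {v. \<forall>i. Re (v $ i) \<in> \<int> \<and> Im (v $ i) \<in> \<int>}"

lemma gauss_lattice_zero: "0 \<in> gauss_lattice"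
  and gauss_lattice_add: "u \<in> gauss_lattice \<Longrightarrow> v \<in> gauss_lattice \<Longrightarrow> u + v \<in> gauss_lattice"
  and gauss_lattice_minus: "u \<in> gauss_lattice \<Longrightarrow> - u \<in> gauss_lattice"
  by (auto simp: gauss_lattice_def)

lemma closed_gauss_lattice: "closed (gauss_lattice :: (complex ^ 'm::finite) set)"
proof -
  have "gauss_lattice = (\<Inter>i. {v::complex ^ 'm. Re (v $ i) \<in> \<int>} \<inter> {v. Im (v $ i) \<in> \<int>})"
    by (auto simp: gauss_lattice_def)
  moreover have "closed {v::complex ^ 'm. Re (v $ i) \<in> \<int>}" for i
    using closed_vimage[OF closed_Ints, of "\<lambda>v::complex ^ 'm. Re (v $ i)"]
    by (simp add: vimage_def continuous_intros)
  moreover have "closed {v::complex ^ 'm. Im (v $ i) \<in> \<int>}" for i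
    using closed_vimage[OF closed_Ints, of "\<lambda>v::complex ^ 'm. Im (v $ i)"]
    by (simp add: vimage_def continuous_intros)
  ultimately show ?thesis by (metis (mono_tags, lifting) closed_INT closed_Int)
qed

text \<open>An integer of absolute value below 1 is 0. This discreteness later makes the quotient
  map injective on small balls.\<close>

lemma gauss_lattice_norm_less_1:
  assumes "v \<in> gauss_lattice" "norm v < 1"
  shows "v = 0"
proof -
  have "v $ i = 0" for i
  proof -
    have "norm (v $ i) < 1" using component_le_norm_cart assms(2)
      by (metis Finite_Cartesian_Product.norm_nth_le order_le_less_trans)
    then have "\<bar>Re (v $ i)\<bar> < 1" "\<bar>Im (v $ i)\<bar> < 1"
      using abs_Re_le_cmod abs_Im_le_cmod order_le_less_trans by blast+
    then show ?thesis
      using assms(1) by (simp add: gauss_lattice_def complex_eq_iff Ints_nonzero_abs_less1)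
  qed
  then show ?thesis by (simp add: vec_eq_iff)
qed

text \<open>The group law on \<open>\<complex>\<^sup>m\<close> is \<open>g \<cdot> v = g + v + B g v\<close>. The coordinates in \<open>C\<close> span the central
  direction. Complex linearity of \<open>B\<close> in the second argument makes left translations holomorphic.\<close>

locale two_step =
  fixes B :: "complex ^ 'm::finite \<Rightarrow> complex ^ 'm \<Rightarrow> complex ^ 'm" and C :: "'m set"
  assumes bil: "bounded_bilinear B"
    and B_clinear: "B v (c *s u) = c *s B v u"
    and B_range: "i \<notin> C \<Longrightarrow> B v u $ i = 0"
    and B_central_left: "(\<And>i. i \<notin> C \<Longrightarrow> v $ i = 0) \<Longrightarrow> B v u = 0"
    and B_central_right: "(\<And>i. i \<notin> C \<Longrightarrow> v $ i = 0) \<Longrightarrow> B u v = 0"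
    and B_lattice: "v \<in> gauss_lattice \<Longrightarrow> u \<in> gauss_lattice \<Longrightarrow> B v u \<in> gauss_lattice"
begin

sublocale B: bounded_bilinear B by (rule bil)

text \<open>Two-step nilpotency: values of \<open>B\<close> are central, and \<open>B\<close>
  vanishes as soon as one argument is central. Associativity and the inversion formulas below rest
  on it.\<close>

lemma B_B [simp]: "B (B u v) w = 0" "B w (B u v) = 0"
  by (auto intro: B_central_left B_central_right B_range)

definition act :: "complex ^ 'm \<Rightarrow> complex ^ 'm \<Rightarrow> complex ^ 'm" where
  "act g v = g + v + B g v"

text \<open>The derivative of left translation by \<open>g\<close>, the same at every point because
  \<open>act g\<close> is affine.\<close>

definition dact :: "complex ^ 'm \<Rightarrow> complex ^ 'm \<Rightarrow> complex ^ 'm" where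
  "dact g u = u + B g u"

lemma act_act: "act g (act h v) = act (act g h) v"
  by (simp add: act_def B.add_left B.add_right algebra_simps)

lemma act_0 [simp]: "act 0 v = v"
  by (simp add: act_def B.zero_left)

text \<open>The group inverse; the term \<open>B g g\<close> compensates the correction
  \<open>B (- g) g\<close> in the product with \<open>g\<close>.\<close>

definition ainv :: "complex ^ 'm \<Rightarrow> complex ^ 'm" where
  "ainv g = - g + B g g"

lemma act_ainv [simp]: "act (ainv g) (act g v) = v" "act g (act (ainv g) v) = v"
  by (simp_all add: act_def ainv_def B.add_left B.add_right B.diff_left B.diff_right)

lemma ainv_lattice: "g \<in> gauss_lattice \<Longrightarrow> ainv g \<in> gauss_lattice"
  unfolding ainv_def by (intro gauss_lattice_add gauss_lattice_minus B_lattice)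

lemma act_lattice: "g \<in> gauss_lattice \<Longrightarrow> h \<in> gauss_lattice \<Longrightarrow> act g h \<in> gauss_lattice"
  by (simp add: act_def gauss_lattice_add B_lattice)

text \<open>\<open>quot a b = b \<cdot> a\<^sup>-\<^sup>1\<close>\<close>

definition quot :: "complex ^ 'm \<Rightarrow> complex ^ 'm \<Rightarrow> complex ^ 'm" where
  "quot a b = b - a - B (b - a) a"

lemma act_quot [simp]: "act (quot a b) a = b"
  by (simp add: act_def quot_def B.diff_left)

lemma quot_act [simp]: "quot a (act g a) = g"
  by (simp add: act_def quot_def B.diff_left B.add_left)

lemma continuous_quot: "continuous_on UNIV (\<lambda>(a, b). quot a b)"
  unfolding quot_def split_beta by (intro continuous_intros B.continuous_on)

lemma has_derivative_act: "(act g has_derivative dact g) (at v within S)"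
proof -
  have "((\<lambda>v. g + v + B g v) has_derivative (\<lambda>u. 0 + u + B g u)) (at v within S)"
    by (intro has_derivative_add has_derivative_const has_derivative_ident
        bounded_linear_imp_has_derivative B.bounded_linear_right)
  then show ?thesis by (simp add: act_def[abs_def] dact_def[abs_def])
qed

lemma continuous_act [continuous_intros]:
  "continuous_on S f \<Longrightarrow> continuous_on S (\<lambda>x. act g (f x))"
  unfolding act_def by (intro continuous_intros B.continuous_on)

section \<open>The quotient by the lattice and its topology\<close>

definition orb :: "complex ^ 'm \<Rightarrow> (complex ^ 'm) set" where
  "orb v = (\<lambda>g. act g v) ` gauss_lattice"

lemma orb_act: assumes "g \<in> gauss_lattice" shows "orb (act g v) = orb v"
proof -
  have "orb (act g v) \<subseteq> orb v" if "g \<in> gauss_lattice" for g v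
    using that by (auto simp: orb_def act_act intro!: imageI act_lattice)
  from this[OF assms, of v] this[OF ainv_lattice[OF assms], of "act g v"]
  show ?thesis by auto
qed

lemma orb_eq_iff: "orb v = orb w \<longleftrightarrow> quot v w \<in> gauss_lattice"
proof
  assume "orb v = orb w"
  moreover have "w \<in> orb w" unfolding orb_def
    by (metis act_0 gauss_lattice_zero image_eqI)
  ultimately have "w \<in> orb v" by simp
  then show "quot v w \<in> gauss_lattice" by (auto simp: orb_def)
next
  assume "quot v w \<in> gauss_lattice"
  from orb_act[OF this, of v] show "orb v = orb w" by simp
qed

definition quot_top :: "(complex ^ 'm) set topology" where
  "quot_top = topology (\<lambda>U. U \<subseteq> range orb \<and> open (orb -` U))"

lemma openin_quot_top: "openin quot_top U \<longleftrightarrow> U \<subseteq> range orb \<and> open (orb -` U)"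
proof -
  have "istopology (\<lambda>U. U \<subseteq> range orb \<and> open (orb -` U))"
    unfolding istopology_def by (auto simp: vimage_Union)
  then show ?thesis by (simp add: quot_top_def topology_inverse')
qed

lemma topspace_quot_top: "topspace quot_top = range orb"
proof -
  have "openin quot_top (range orb)" by (simp add: openin_quot_top vimage_def)
  moreover have "topspace quot_top \<subseteq> range orb"
    using openin_topspace[of quot_top] unfolding openin_quot_top by blast
  ultimately show ?thesis by (meson openin_subset subset_antisym)
qed

text \<open>Makes \<open>orb\<close> an open map: the saturation of an open set is a union of open
  preimages under lattice translations.\<close>

lemma orb_vimage_image: "orb -` (orb ` S) = (\<Union>g\<in>gauss_lattice. act g -` S)"
proof (intro equalityI subsetI)
  fix x assume "x \<in> orb -` (orb ` S)"
  then obtain y where "y \<in> S" "orb x = orb y" by auto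
  then have "quot x y \<in> gauss_lattice" "act (quot x y) x \<in> S" by (simp_all add: orb_eq_iff)
  then show "x \<in> (\<Union>g\<in>gauss_lattice. act g -` S)" by blast
next
  fix x assume "x \<in> (\<Union>g\<in>gauss_lattice. act g -` S)"
  then obtain g where "g \<in> gauss_lattice" "act g x \<in> S" by auto
  then show "x \<in> orb -` (orb ` S)" using orb_act[of g x] by (metis imageI vimageI)
qed

lemma open_orb_image: assumes "open S" shows "openin quot_top (orb ` S)"
  unfolding openin_quot_top orb_vimage_image
  using assms by (auto intro!: open_UN open_vimage continuous_intros)

lemma open_map_orb: "open_map euclidean quot_top orb"
  by (simp add: open_map_def open_orb_image)

lemma continuous_map_orb: "continuous_map euclidean quot_top orb"
  by (auto simp: continuous_map_def topspace_quot_top openin_quot_top vimage_def)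

lemma second_countable_quot_top: "second_countable quot_top"
proof -
  have "second_countable (euclidean :: (complex ^ 'm) topology)"
  proof -
    obtain D :: "(complex ^ 'm) set set" where D: "countable D" "topological_basis D"
      using ex_countable_basis by blast
    show ?thesis
      unfolding second_countable_def
    proof (intro exI conjI allI impI ballI)
      show "openin euclidean V" if "V \<in> D" for V
        using topological_basis_open[OF D(2) that] by simp
      show "\<exists>V\<in>D. x \<in> V \<and> V \<subseteq> U" if "openin euclidean U \<and> x \<in> U" for U x
        using that topological_basisE[OF D(2), of U x] by (metis open_openin)
    qed (rule D)
  qed
  from second_countable_open_map_image[OF continuous_map_orb open_map_orb _ this]
  show ?thesis by (simp add: topspace_quot_top)
qed

text \<open>The relation \<open>orb a = orb b\<close> is closed, being the preimage of the closed
  lattice under the continuous map \<open>quot\<close>. The factors of an open box avoiding it have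
  disjoint open images under \<open>orb\<close>.\<close>

lemma Hausdorff_quot_top: "Hausdorff_space quot_top"
  unfolding Hausdorff_space_def
proof (intro allI impI)
  fix x y assume "x \<in> topspace quot_top \<and> y \<in> topspace quot_top \<and> x \<noteq> y"
  then obtain a b where ab: "x = orb a" "y = orb b" "orb a \<noteq> orb b"
    by (auto simp: topspace_quot_top)
  let ?R = "(\<lambda>(a, b). quot a b) -` (- gauss_lattice)"
  have "open ?R"
    by (intro open_vimage continuous_quot) (simp add: open_Compl closed_gauss_lattice)
  moreover have "(a, b) \<in> ?R" using ab by (simp add: orb_eq_iff)
  ultimately obtain S T where ST: "open S" "open T" "a \<in> S" "b \<in> T" "S \<times> T \<subseteq> ?R"
    by (rule open_prod_elim) auto
  have "disjnt (orb ` S) (orb ` T)"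
    using ST(5) by (fastforce simp: disjnt_def orb_eq_iff)
  then show "\<exists>U V. openin quot_top U \<and> openin quot_top V \<and> x \<in> U \<and> y \<in> V \<and> disjnt U V"
    using ST ab open_orb_image by blast
qed

lemma compact_quot_top: "compact_space quot_top"
proof -
  \<comment> \<open>The closed unit cube in the real and imaginary parts of all coordinates; every
    orbit will be shown to meet it.\<close>
  define K where "K = {v::complex ^ 'm. \<forall>i. Re (v $ i) \<in> {0..1} \<and> Im (v $ i) \<in> {0..1}}"
  have "closed K"
    unfolding K_def atLeastAtMost_iff
    by (intro closed_Collect_all closed_Collect_conj closed_Collect_le continuous_intros)
  moreover have "norm v \<le> (\<Sum>i\<in>(UNIV::'m set). 2)" if "v \<in> K" for v
  proof -
    have "norm (v $ i) \<le> 2" for i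
    proof -
      have "0 \<le> Re (v $ i)" "Re (v $ i) \<le> 1" "0 \<le> Im (v $ i)" "Im (v $ i) \<le> 1"
        using that by (auto simp: K_def)
      then show ?thesis using cmod_le[of "v $ i"] by linarith
    qed
    then show ?thesis
      unfolding norm_vec_def by (intro order_trans[OF L2_set_le_sum] sum_mono) auto
  qed
  ultimately have "compact K"
    using boundedI compact_eq_bounded_closed by metis
  have "orb v \<in> orb ` K" for v
  proof -
    define fl where "fl z = Complex (- of_int \<lfloor>Re z\<rfloor>) (- of_int \<lfloor>Im z\<rfloor>)" for z
    \<comment> \<open>The non-central coordinates are moved into the cube first, since translation
      by \<open>g\<close> also shifts the central ones through \<open>B g v\<close>. The central
      shift \<open>h\<close> is then read off from \<open>act g v\<close> and leaves the other
      coordinates alone.\<close>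
    define g where "g = (\<chi> i. if i \<in> C then 0 else fl (v $ i))"
    define h where "h = (\<chi> i. if i \<in> C then fl (act g v $ i) else 0)"
    have gh: "g \<in> gauss_lattice" "h \<in> gauss_lattice"
      by (auto simp: g_def h_def gauss_lattice_def fl_def)
    have "B h w = 0" for w
      by (rule B_central_left) (simp add: h_def)
    then have *: "act h (act g v) = h + act g v" by (simp add: act_def)
    have "act h (act g v) \<in> K"
      unfolding K_def *
    proof (intro CollectI allI)
      fix i
      have fl: "Re (fl z + z) \<in> {0..1} \<and> Im (fl z + z) \<in> {0..1}" for z
        by (simp add: fl_def) linarith
      show "Re ((h + act g v) $ i) \<in> {0..1} \<and> Im ((h + act g v) $ i) \<in> {0..1}"
      proof (cases "i \<in> C")
        case True then show ?thesis using fl[of "act g v $ i"] by (simp add: h_def)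
      next
        case False
        then show ?thesis using fl[of "v $ i"] by (simp add: h_def act_def g_def B_range)
      qed
    qed
    moreover have "orb (act h (act g v)) = orb v" using gh by (simp add: orb_act)
    ultimately show ?thesis by (metis imageI)
  qed
  then have "range orb = orb ` K" by blast
  moreover have "compactin quot_top (orb ` K)"
    using image_compactin[OF _ continuous_map_orb] \<open>compact K\<close> by simp
  ultimately show ?thesis by (simp add: compact_space_def topspace_quot_top)
qed

section \<open>Charts given by local inverses of the quotient map\<close>

lemma small_ball_ex: "\<exists>r>0. \<forall>a\<in>ball p r. \<forall>b\<in>ball p r. norm (quot a b) < 1"
proof -
  let ?R = "(\<lambda>(a, b). quot a b) -` ball 0 1"
  have "open ?R" by (intro open_vimage continuous_quot) simp
  moreover have "(p, p) \<in> ?R" by (simp add: quot_def B.zero_left)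
  ultimately obtain S T where ST: "open S" "open T" "p \<in> S" "p \<in> T" "S \<times> T \<subseteq> ?R"
    by (rule open_prod_elim) auto
  then obtain r where "r > 0" "ball p r \<subseteq> S \<inter> T"
    using open_contains_ball by (metis IntI open_Int)
  then show ?thesis using ST(5) by (intro exI[of _ r]) fastforce
qed

text \<open>A ball on which any two points differ by a group element of norm below 1. The only such
  lattice vector is 0, so distinct points of the ball lie in distinct orbits.\<close>

definition nbh :: "complex ^ 'm \<Rightarrow> (complex ^ 'm) set" where
  "nbh p = ball p (SOME r. r > 0 \<and> (\<forall>a\<in>ball p r. \<forall>b\<in>ball p r. norm (quot a b) < 1))"

lemma nbh: "open (nbh p)" "p \<in> nbh p" "a \<in> nbh p \<Longrightarrow> b \<in> nbh p \<Longrightarrow> norm (quot a b) < 1"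
  using someI_ex[OF small_ball_ex[of p, unfolded Bex_def]] unfolding nbh_def by auto

lemma inj_on_orb: "inj_on orb (nbh p)"
proof (rule inj_onI)
  fix a b assume ab: "a \<in> nbh p" "b \<in> nbh p" "orb a = orb b"
  then have "quot a b = 0"
    by (intro gauss_lattice_norm_less_1) (auto simp: orb_eq_iff nbh(3))
  then show "a = b" using act_quot[of a b] by simp
qed

definition chart_at :: "complex ^ 'm \<Rightarrow> ((complex ^ 'm) set, 'm) chart" where
  "chart_at p = (orb ` nbh p, inv_into (nbh p) orb)"

definition atlas :: "((complex ^ 'm) set, 'm) chart set" where
  "atlas = range chart_at"

lemma chart_at_atlas [simp]: "chart_at p \<in> atlas" by (simp add: atlas_def)

lemma snd_chart_at: "x \<in> nbh p \<Longrightarrow> snd (chart_at p) (orb x) = x"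
  by (simp add: chart_at_def inj_on_orb)

lemma chart_image_chart_at [simp]: "chart_image (chart_at p) = nbh p"
  by (force simp: chart_image_def chart_at_def inj_on_orb image_image)

lemma inv_into_chart_at: "x \<in> nbh p \<Longrightarrow> inv_into (fst (chart_at p)) (snd (chart_at p)) x = orb x"
proof -
  assume x: "x \<in> nbh p"
  have "inj_on (snd (chart_at p)) (fst (chart_at p))"
    by (simp add: chart_at_def inj_on_inv_into)
  then show ?thesis
    by (rule inv_into_f_eq) (use x snd_chart_at in \<open>auto simp: chart_at_def\<close>)
qed

text \<open>Two coordinates of the same orbit differ by a lattice element, which is how lattice
  translations enter the changes of charts.\<close>

lemma transition_at:
  assumes "x \<in> transition_domain (chart_at p) (chart_at q)"
  shows "\<exists>g\<in>gauss_lattice. x \<in> nbh p \<and> act g x \<in> nbh q"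
proof -
  from assms obtain y where y: "y \<in> orb ` nbh p" "y \<in> orb ` nbh q" "x = snd (chart_at p) y"
    by (auto simp: transition_domain_def chart_at_def)
  then obtain b where b: "b \<in> nbh q" "y = orb b" by auto
  have x: "x \<in> nbh p" "orb x = y" using y snd_chart_at by auto
  then show ?thesis using b by (intro bexI[of _ "quot x b"]) (auto simp: orb_eq_iff)
qed

lemma transition_eq:
  assumes "x \<in> nbh p" "act g x \<in> nbh q" "g \<in> gauss_lattice"
  shows "transition (chart_at p) (chart_at q) x = act g x"
  using assms snd_chart_at[of "act g x" q] by (simp add: transition_def inv_into_chart_at orb_act)

lemma transition_has_derivative:
  assumes "x \<in> nbh p" "act g x \<in> nbh q" "g \<in> gauss_lattice"
  shows "(transition (chart_at p) (chart_at q) has_derivative dact g) (at x)"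
proof (rule has_derivative_transform_within_open[OF has_derivative_act])
  \<comment> \<open>The same \<open>g\<close> describes the transition on an open neighbourhood of
    \<open>x\<close>, so the derivative is that of \<open>act g\<close>.\<close>
  show "open (nbh p \<inter> act g -` nbh q)"
    by (intro open_Int open_vimage nbh continuous_intros)
qed (use assms transition_eq in auto)

lemma dact_clinear: "dact g (c *s v) = c *s dact g v"
  by (simp add: dact_def B_clinear vector_add_ldistrib)

theorem compact_complex_manifold_atlas: "compact_complex_manifold quot_top atlas"
  unfolding compact_complex_manifold_def complex_manifold_def
proof (intro conjI ballI compact_quot_top Hausdorff_quot_top second_countable_quot_top)
  show "topspace quot_top = (\<Union>c\<in>atlas. fst c)"
    using nbh(2) by (fastforce simp: topspace_quot_top atlas_def chart_at_def)
next
  fix c assume "c \<in> atlas"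
  then obtain p where c: "c = chart_at p" by (auto simp: atlas_def)
  show "openin quot_top (fst c)" using nbh(1) by (simp add: c chart_at_def open_orb_image)
  show "open (chart_image c)" by (simp add: c nbh)
  have top: "topspace (subtopology quot_top (orb ` nbh p)) = orb ` nbh p"
    by (auto simp: topspace_quot_top)
  \<comment> \<open>The restriction of \<open>orb\<close> is shown to be open, continuous and
    injective; the chart is then its inverse homeomorphism.\<close>
  have "open_map (top_of_set (nbh p)) (subtopology quot_top (orb ` nbh p)) orb"
    unfolding open_map_def
  proof (intro allI impI)
    fix U assume "openin (top_of_set (nbh p)) U"
    then have "open U" "U \<subseteq> nbh p" using nbh(1) by (auto simp: openin_open_eq)
    then show "openin (subtopology quot_top (orb ` nbh p)) (orb ` U)"
      using open_orb_image by (auto simp: openin_subtopology intro!: exI[of _ "orb ` U"])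
  qed
  moreover have "continuous_map (top_of_set (nbh p)) (subtopology quot_top (orb ` nbh p)) orb"
    by (simp add: continuous_map_in_subtopology continuous_map_from_subtopology continuous_map_orb)
  ultimately have "homeomorphic_map (top_of_set (nbh p)) (subtopology quot_top (orb ` nbh p)) orb"
    using inj_on_orb by (intro bijective_open_imp_homeomorphic_map) (simp_all only: top topspace_euclidean_subtopology)
  then obtain g where g: "homeomorphic_maps (top_of_set (nbh p)) (subtopology quot_top (orb ` nbh p)) orb g"
    by (auto simp: homeomorphic_map_maps)
  then have "g y = inv_into (nbh p) orb y" if y: "y \<in> orb ` nbh p" for y
  proof -
    obtain x where "x \<in> nbh p" "y = orb x" using y by blast
    then show ?thesis using g inj_on_orb by (simp add: homeomorphic_maps_map)
  qed
  with g have "homeomorphic_maps (top_of_set (nbh p)) (subtopology quot_top (orb ` nbh p)) orb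
      (inv_into (nbh p) orb)"
    by (intro homeomorphic_maps_eq[OF g]) (simp_all only: top)
  then show "homeomorphic_map (subtopology quot_top (fst c)) (top_of_set (chart_image c)) (snd c)"
    unfolding c chart_image_chart_at by (simp add: chart_at_def homeomorphic_maps_map)
next
  fix c c' assume "c \<in> atlas" "c' \<in> atlas"
  then obtain p q where c: "c = chart_at p" "c' = chart_at q" by (auto simp: atlas_def)
  show "holomorphic_map_on (transition_domain c c') (transition c c')"
    unfolding holomorphic_map_on_def c
  proof
    fix x assume "x \<in> transition_domain (chart_at p) (chart_at q)"
    then obtain g where "g \<in> gauss_lattice" "x \<in> nbh p" "act g x \<in> nbh q"
      using transition_at by blast
    then show "\<exists>D. (transition (chart_at p) (chart_at q) has_derivative D) (at x) \<and>
        (\<forall>c v. D (c *s v) = c *s D v)"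
      using transition_has_derivative dact_clinear by blast
  qed
qed

end

section \<open>An invariant mean\<close>

text \<open>The derivative is a continuous map into bounded linear functions, the form in which
  differentiation under the integral sign applies.\<close>

definition C1 :: "('a::euclidean_space \<Rightarrow> complex) \<Rightarrow> bool" where
  "C1 f \<longleftrightarrow> (\<exists>f'. (\<forall>v. (f has_derivative blinfun_apply (f' v)) (at v)) \<and> continuous_on UNIV f')"

definition const_along :: "('a::real_vector \<Rightarrow> 'b) \<Rightarrow> 'a \<Rightarrow> bool" where
  "const_along f w \<longleftrightarrow> (\<forall>v. \<forall>s::real. f (v + s *\<^sub>R w) = f v)"

definition avg :: "'a::euclidean_space \<Rightarrow> ('a \<Rightarrow> 'b::banach) \<Rightarrow> 'a \<Rightarrow> 'b" where
  "avg b f v = integral (cbox 0 1) (\<lambda>t::real. f (v + t *\<^sub>R b))"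

lemma C1_continuous: "C1 f \<Longrightarrow> continuous_on S f"
  unfolding C1_def by (meson continuous_at_imp_continuous_on has_derivative_continuous)

lemma avg_integrable:
  "continuous_on UNIV f \<Longrightarrow> (\<lambda>t::real. f (v + t *\<^sub>R b)) integrable_on cbox 0 1"
  for f :: "'a::euclidean_space \<Rightarrow> 'b::banach"
  by (rule integrable_continuous, erule continuous_on_compose2) (auto intro!: continuous_intros)

lemma avg_continuous:
  fixes f :: "'a::euclidean_space \<Rightarrow> 'b::banach"
  assumes "continuous_on UNIV f"
  shows "continuous_on UNIV (avg b f)"
  unfolding avg_def[abs_def]
  by (rule integral_continuous_on_param)
     (auto simp: split_beta intro!: continuous_on_compose2[OF assms] continuous_intros)

lemma avg_add:
  assumes "continuous_on UNIV f" "continuous_on UNIV g"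
  shows "avg b (\<lambda>v. f v + g v) = (\<lambda>v. avg b f v + avg b g v)"
  unfolding avg_def
  by (intro ext Henstock_Kurzweil_Integration.integral_add avg_integrable assms)

lemma avg_cmult: "avg b (\<lambda>v. c * f v) = (\<lambda>v. c * avg b f v :: complex)"
  by (simp add: avg_def fun_eq_iff)

lemma avg_const: "avg b (\<lambda>v. c) = (\<lambda>v. c)"
  by (simp add: avg_def fun_eq_iff)

lemma avg_has_derivative:
  fixes f :: "'a::euclidean_space \<Rightarrow> complex"
  assumes f': "\<And>v. (f has_derivative blinfun_apply (f' v)) (at v)" and cont: "continuous_on UNIV f'"
  shows "(avg b f has_derivative blinfun_apply (avg b f' v)) (at v)"
proof -
  have "((\<lambda>v. integral (cbox 0 1) (\<lambda>t::real. f (v + t *\<^sub>R b))) has_derivative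
      blinfun_apply (integral (cbox 0 1) (\<lambda>t::real. f' (v + t *\<^sub>R b)))) (at v within UNIV)"
  proof (rule leibniz_rule)
    fix x :: 'a and t :: real
    show "((\<lambda>x. f (x + t *\<^sub>R b)) has_derivative blinfun_apply (f' (x + t *\<^sub>R b))) (at x within UNIV)"
    proof -
      have "((\<lambda>x. x + t *\<^sub>R b) has_derivative (\<lambda>x. x)) (at x within UNIV)"
        by (auto intro!: derivative_eq_intros)
      from has_derivative_compose[OF this f'] show ?thesis by simp
    qed
    show "(\<lambda>t. f (x + t *\<^sub>R b)) integrable_on cbox 0 1"
      by (intro avg_integrable C1_continuous) (use assms in \<open>auto simp: C1_def\<close>)
  qed (auto simp: split_beta intro!: continuous_on_compose2[OF cont] continuous_intros)
  then show ?thesis by (simp add: avg_def[abs_def])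
qed

lemma avg_blinfun_apply:
  fixes f' :: "'a::euclidean_space \<Rightarrow> 'a \<Rightarrow>\<^sub>L complex"
  assumes "continuous_on UNIV f'"
  shows "blinfun_apply (avg b f' v) h = integral (cbox 0 1) (\<lambda>t::real. f' (v + t *\<^sub>R b) h)"
  unfolding avg_def
  by (subst integral_linear[OF avg_integrable[OF assms] blinfun.bounded_linear_left[of h], symmetric])
     (simp add: o_def)

lemma const_along_blinfun_zero:
  assumes "(f has_derivative blinfun_apply (f' v)) (at v)" "const_along f w"
  shows "blinfun_apply (f' v) w = 0"
proof -
  have "((\<lambda>s::real. f (v + s *\<^sub>R w)) has_derivative (\<lambda>s. f' v (s *\<^sub>R w))) (at 0)"
  proof -
    have "((\<lambda>s. v + s *\<^sub>R w) has_derivative (\<lambda>s. s *\<^sub>R w)) (at 0)"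
      by (auto intro!: derivative_eq_intros)
    from has_derivative_compose[OF this, of f] assms(1) show ?thesis by simp
  qed
  moreover have "(\<lambda>s::real. f (v + s *\<^sub>R w)) = (\<lambda>s. f v)"
    using assms(2) by (simp add: const_along_def)
  ultimately have "(\<lambda>s. f' v (s *\<^sub>R w)) = (\<lambda>s. 0)"
    by (metis has_derivative_const has_derivative_unique)
  from fun_cong[OF this, of 1] show ?thesis by simp
qed

text \<open>The derivative of the average along \<open>b\<close> is the integral of the derivative
  of \<open>f\<close> over one period, which vanishes by the fundamental theorem of
  calculus.\<close>

lemma avg_const_along:
  assumes "C1 f" and per: "\<And>v. f (v + b) = f v"
  shows "const_along (avg b f) b"
  unfolding const_along_def
proof (intro allI)
  fix v and s :: real
  obtain f' where f': "\<And>v. (f has_derivative blinfun_apply (f' v)) (at v)" "continuous_on UNIV f'"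
    using assms(1) by (auto simp: C1_def)
  have zero: "blinfun_apply (avg b f' x) b = 0" for x
  proof -
    have "((\<lambda>t. f (x + t *\<^sub>R b)) has_vector_derivative f' (x + t *\<^sub>R b) b) (at t within {0..1})" for t
    proof -
      have "((\<lambda>t. x + t *\<^sub>R b) has_derivative (\<lambda>t. t *\<^sub>R b)) (at t within {0..1})"
        by (auto intro!: derivative_eq_intros)
      from has_derivative_compose[OF this f'(1)] show ?thesis
        by (simp add: blinfun.scaleR_right has_vector_derivative_def)
    qed
    then have "((\<lambda>t. f' (x + t *\<^sub>R b) b) has_integral f (x + 1 *\<^sub>R b) - f (x + 0 *\<^sub>R b)) {0..1}"
      by (intro fundamental_theorem_of_calculus) auto
    then show ?thesis
      by (simp add: avg_blinfun_apply[OF f'(2)] per integral_unique)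
  qed
  have "((\<lambda>s. avg b f (v + s *\<^sub>R b)) has_derivative (\<lambda>h. 0)) (at s within UNIV)" for s
  proof -
    have "((\<lambda>s. v + s *\<^sub>R b) has_derivative (\<lambda>s. s *\<^sub>R b)) (at s within UNIV)"
      by (auto intro!: derivative_eq_intros)
    from has_derivative_compose[OF this avg_has_derivative[where b = b, OF f']]
    show ?thesis by (simp add: blinfun.scaleR_right zero)
  qed
  from has_derivative_zero_unique[OF convex_UNIV this, of 0 s]
  show "avg b f (v + s *\<^sub>R b) = avg b f v" by simp
qed

lemma const_along_span:
  assumes "\<And>w. w \<in> K \<Longrightarrow> const_along f w" "w \<in> span K"
  shows "const_along f w"
  using assms(2)
proof (induction rule: span_induct_alt)
  case base
  then show ?case by (simp add: const_along_def)
next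
  case (step c x y)
  have "f (v + s *\<^sub>R (c *\<^sub>R x + y)) = f v" for v and s :: real
  proof -
    have "f (v + s *\<^sub>R (c *\<^sub>R x + y)) = f (v + (s * c) *\<^sub>R x + s *\<^sub>R y)"
      by (simp add: algebra_simps)
    also have "\<dots> = f v" using step assms(1) by (simp add: const_along_def)
    finally show ?thesis .
  qed
  then show ?case by (simp add: const_along_def)
qed

fun avgs :: "'a::euclidean_space list \<Rightarrow> ('a \<Rightarrow> complex) \<Rightarrow> 'a \<Rightarrow> complex" where
  "avgs [] f = f"
| "avgs (b # bs) f = avgs bs (avg b f)"

lemma avgs_append: "avgs (bs @ cs) f = avgs cs (avgs bs f)"
  by (induction bs arbitrary: f) auto

lemma avgs_add:
  "continuous_on UNIV f \<Longrightarrow> continuous_on UNIV g \<Longrightarrow>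
    avgs bs (\<lambda>v. f v + g v) = (\<lambda>v. avgs bs f v + avgs bs g v)"
  by (induction bs arbitrary: f g) (simp_all add: avg_add avg_continuous)

lemma avgs_cmult: "avgs bs (\<lambda>v. c * f v) = (\<lambda>v. c * avgs bs f v)"
  by (induction bs arbitrary: f) (simp_all add: avg_cmult)

lemma avgs_const: "avgs bs (\<lambda>v. c) = (\<lambda>v. c)"
  by (induction bs) (simp_all add: avg_const)

section \<open>Averages of left-invariant derivatives\<close>

context two_step
begin

text \<open>The left-invariant vector field with value \<open>h\<close> at the origin;
  \<open>lderiv\<close> differentiates along it.\<close>

definition frame :: "complex ^ 'm \<Rightarrow> complex ^ 'm \<Rightarrow> complex ^ 'm" where
  "frame v h = h + B v h"

definition lderiv :: "complex ^ 'm \<Rightarrow> (complex ^ 'm \<Rightarrow> complex) \<Rightarrow> complex ^ 'm \<Rightarrow> complex" where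
  "lderiv h f v = frechet_derivative f (at v) (frame v h)"

definition linvariant :: "(complex ^ 'm \<Rightarrow> 'b) \<Rightarrow> bool" where
  "linvariant f \<longleftrightarrow> (\<forall>g\<in>gauss_lattice. \<forall>v. f (act g v) = f v)"

text \<open>The assumptions \<open>along\<close> hold when \<open>b\<close> is central, or when \<open>f\<close> has already been averaged over all
  central directions. This is why the averages over the central coordinates are taken first.\<close>

lemma avg_step:
  assumes f: "C1 f" "linvariant f" and b: "b \<in> gauss_lattice"
    and along: "\<And>x. const_along f (B x b)" "\<And>x. const_along f (B b x)"
  shows "C1 (avg b f)" "linvariant (avg b f)" "const_along (avg b f) b"
    "const_along f w \<Longrightarrow> const_along (avg b f) w"
    "avg b (lderiv h f) = lderiv h (avg b f)"
proof -
  obtain f' where f': "\<And>v. (f has_derivative blinfun_apply (f' v)) (at v)" "continuous_on UNIV f'"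
    using f(1) by (auto simp: C1_def)
  note d = avg_has_derivative[of f f', OF f']
  show "C1 (avg b f)"
    unfolding C1_def using d avg_continuous[OF f'(2)] by blast
  show "linvariant (avg b f)"
    unfolding linvariant_def
  proof (intro ballI allI)
    fix g v :: "complex ^ 'm" assume g: "g \<in> gauss_lattice"
    have "f (act g v + t *\<^sub>R b) = f (v + t *\<^sub>R b)" for t :: real
    proof -
      \<comment> \<open>Shifting along \<open>b\<close> commutes with translation by
        \<open>g\<close> up to a multiple of \<open>B g b\<close>, a direction in which
        \<open>f\<close> is constant.\<close>
      have "act g (v + t *\<^sub>R b) = (act g v + t *\<^sub>R b) + t *\<^sub>R B g b"
        by (simp add: act_def B.add_right B.scaleR_right)
      then have "f (act g (v + t *\<^sub>R b)) = f (act g v + t *\<^sub>R b)"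
        using along(1) by (simp add: const_along_def)
      then show ?thesis using f(2) g by (simp add: linvariant_def)
    qed
    then show "avg b f (act g v) = avg b f v" by (simp add: avg_def)
  qed
  \<comment> \<open>Constancy along \<open>B b v\<close> turns invariance under the lattice element
    \<open>b\<close> into periodicity with period \<open>b\<close>.\<close>
  have "f (v + b) = f v" for v
  proof -
    have "f (v + b) = f (v + b + 1 *\<^sub>R B b v)"
      using along(2) by (simp only: const_along_def)
    also have "v + b + 1 *\<^sub>R B b v = act b v" by (simp add: act_def)
    finally show ?thesis using f(2) b by (simp add: linvariant_def)
  qed
  then show "const_along (avg b f) b" by (rule avg_const_along[OF f(1)])
  show "const_along (avg b f) w" if "const_along f w"
  proof -
    have "f (v + s *\<^sub>R w + t *\<^sub>R b) = f (v + t *\<^sub>R b)" for v and s t :: real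
      using that unfolding const_along_def by (metis add.assoc add.commute)
    then show ?thesis by (simp add: const_along_def avg_def)
  qed
  show "avg b (lderiv h f) = lderiv h (avg b f)"
  proof
    fix v
    \<comment> \<open>The frame vector at the shifted point differs from \<open>frame v h\<close> by
      a multiple of \<open>B b h\<close>, a direction in which the derivative vanishes. So the
      integrand is evaluated on a vector independent of \<open>t\<close>.\<close>
    have "lderiv h f (v + t *\<^sub>R b) = f' (v + t *\<^sub>R b) (frame v h)" for t :: real
    proof -
      have "frame (v + t *\<^sub>R b) h = frame v h + t *\<^sub>R B b h"
        by (simp add: frame_def B.add_left B.scaleR_left)
      moreover have "f' (v + t *\<^sub>R b) (B b h) = 0"
        by (rule const_along_blinfun_zero[OF f'(1) along(2)])
      ultimately show ?thesis
        using frechet_derivative_at[OF f'(1), symmetric]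
        by (simp add: lderiv_def blinfun.add_right blinfun.scaleR_right)
    qed
    then show "avg b (lderiv h f) v = lderiv h (avg b f) v"
      unfolding avg_def[of b "lderiv h f"] lderiv_def[of h "avg b f"]
      using frechet_derivative_at[OF d, symmetric] by (simp add: avg_blinfun_apply[OF f'(2)])
  qed
qed

text \<open>\<open>K\<close> holds directions in which the function is already constant. Each
  averaged \<open>b\<close> joins \<open>K\<close>, so the span conditions on \<open>B\<close>
  persist and supply what \<open>avg_step\<close> requires.\<close>

lemma avgs_step:
  assumes "C1 f" "linvariant f" "\<And>w. w \<in> K \<Longrightarrow> const_along f w"
    and "\<And>b. b \<in> set bs \<Longrightarrow> b \<in> gauss_lattice"
    and "\<And>b x. b \<in> set bs \<Longrightarrow> B x b \<in> span K" "\<And>b x. b \<in> set bs \<Longrightarrow> B b x \<in> span K"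
  shows "C1 (avgs bs f) \<and> linvariant (avgs bs f) \<and>
    (\<forall>w \<in> K \<union> set bs. const_along (avgs bs f) w) \<and> (\<forall>h. avgs bs (lderiv h f) = lderiv h (avgs bs f))"
  using assms
proof (induction bs arbitrary: f K)
  case Nil
  then show ?case by auto
next
  case (Cons b bs)
  have *: "const_along f (B x b)" "const_along f (B b x)" for x
    using Cons.prems(3,5,6) by (auto intro: const_along_span[of K])
  note st = avg_step[OF Cons.prems(1,2) _ *]
  have b: "b \<in> gauss_lattice" using Cons.prems(4) by simp
  have "C1 (avgs bs (avg b f)) \<and> linvariant (avgs bs (avg b f)) \<and>
    (\<forall>w \<in> insert b K \<union> set bs. const_along (avgs bs (avg b f)) w) \<and>
    (\<forall>h. avgs bs (lderiv h (avg b f)) = lderiv h (avgs bs (avg b f)))"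
  proof (rule Cons.IH)
    have "span K \<subseteq> span (insert b K)" by (rule span_mono) auto
    then show "B x c \<in> span (insert b K)" "B c x \<in> span (insert b K)" if "c \<in> set bs" for c x
      using Cons.prems(5,6) that by auto
  qed (use Cons.prems(3,4) st[OF b] in auto)
  then show ?case using st(5)[OF b] by simp
qed

text \<open>The functional averages over all real coordinate directions and evaluates at 0.
  Averaging makes an invariant \<open>f\<close> constant and commutes with \<open>lderiv h\<close>,
  so the mean of \<open>lderiv h f\<close> is the derivative of a constant.\<close>

lemma lderiv_mean_zero:
  obtains \<mu> where
    "\<And>f g. continuous_on UNIV f \<Longrightarrow> continuous_on UNIV g \<Longrightarrow> \<mu> (\<lambda>v. f v + g v) = \<mu> f + \<mu> g"
    "\<And>c f. \<mu> (\<lambda>v. c * f v) = c * \<mu> f"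
    "\<And>c. \<mu> (\<lambda>v. c) = c"
    "\<And>f h. C1 f \<Longrightarrow> linvariant f \<Longrightarrow> \<mu> (lderiv h f) = 0"
proof -
  \<comment> \<open>\<open>S I\<close> is the real basis of the coordinates in \<open>I\<close>; its
    vectors lie in the lattice.\<close>
  define S :: "'m set \<Rightarrow> (complex ^ 'm) set" where "S I = (\<lambda>(i, u). axis i u) ` (I \<times> {1, \<i>})" for I
  have "finite (S I)" for I by (simp add: S_def)
  then obtain cs ds where cs: "set cs = S C" and ds: "set ds = S (- C)"
    using finite_list by metis
  have lat: "b \<in> gauss_lattice" if "b \<in> S I" for b I
    using that by (auto simp: S_def gauss_lattice_def axis_def)
  have un: "S C \<union> S (- C) = Basis"
    by (auto simp: S_def Basis_vec_def Basis_complex_def)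
  have central: "B x b = 0" "B b x = 0" if "b \<in> S C" for b x
  proof -
    have "b $ i = 0" if "i \<notin> C" for i
      using \<open>b \<in> S C\<close> that by (auto simp: S_def axis_def)
    then show "B x b = 0" "B b x = 0" by (auto intro: B_central_left B_central_right)
  qed
  have span: "v \<in> span (S C)" if "\<And>i. i \<notin> C \<Longrightarrow> v $ i = 0" for v
  proof -
    have "(v \<bullet> b) *\<^sub>R b \<in> span (S C)" if "b \<in> Basis" for b
    proof (cases "b \<in> S C")
      case True then show ?thesis by (simp add: span_base span_mul)
    next
      case False
      then have "b \<in> S (- C)" using that un by blast
      then obtain i u where "b = axis i u" "i \<notin> C" by (auto simp: S_def)
      then have "v \<bullet> b = 0" using \<open>\<And>i. i \<notin> C \<Longrightarrow> v $ i = 0\<close> by (simp add: inner_axis)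
      then show ?thesis by (simp add: span_zero)
    qed
    then have "(\<Sum>b\<in>Basis. (v \<bullet> b) *\<^sub>R b) \<in> span (S C)" by (intro span_sum)
    then show ?thesis by (simp add: euclidean_representation)
  qed
  show thesis
  proof (rule that[of "\<lambda>f. avgs (cs @ ds) f 0"])
    fix f h assume f: "C1 f" "linvariant f"
    let ?f1 = "avgs cs f" and ?f2 = "avgs ds (avgs cs f)"
    \<comment> \<open>In the first round \<open>K\<close> is empty and \<open>B\<close> vanishes on
      the central directions. In the second round \<open>K\<close> is \<open>S C\<close>, whose span
      contains all values of \<open>B\<close>.\<close>
    have 1: "C1 ?f1 \<and> linvariant ?f1 \<and> (\<forall>w \<in> {} \<union> set cs. const_along ?f1 w) \<and>
        (\<forall>h. avgs cs (lderiv h f) = lderiv h ?f1)"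
      by (rule avgs_step) (use f cs lat central in auto)
    have "C1 ?f2 \<and> linvariant ?f2 \<and> (\<forall>w \<in> S C \<union> set ds. const_along ?f2 w) \<and>
        (\<forall>h. avgs ds (lderiv h ?f1) = lderiv h ?f2)"
      by (rule avgs_step) (use 1 cs ds lat span B_range in auto)
    then have 2: "C1 ?f2" "\<And>w. w \<in> Basis \<Longrightarrow> const_along ?f2 w"
      "avgs ds (lderiv h ?f1) = lderiv h ?f2"
      using un ds by auto
    have along: "const_along ?f2 w" for w
      by (rule const_along_span[of Basis]) (use 2 in auto)
    obtain f' where f': "\<And>v. (?f2 has_derivative blinfun_apply (f' v)) (at v)"
      using 2(1) by (auto simp: C1_def)
    have "lderiv h ?f2 v = 0" for v
      unfolding lderiv_def frechet_derivative_at[OF f', symmetric]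
      by (rule const_along_blinfun_zero[OF f' along])
    then show "avgs (cs @ ds) (lderiv h f) 0 = 0"
      using 1 2(3) by (simp add: avgs_append)
  qed (simp_all add: avgs_add avgs_cmult avgs_const)
qed

end

section \<open>Covectors\<close>

definition remove_at :: "nat \<Rightarrow> 'a list \<Rightarrow> 'a list" where
  "remove_at i vs = take i vs @ drop (Suc i) vs"

lemma length_remove_at [simp]: "i < length vs \<Longrightarrow> length (remove_at i vs) = length vs - 1"
  by (simp add: remove_at_def)

lemma remove_at_Cons [simp]: "remove_at 0 (v # vs) = vs" "remove_at (Suc i) (v # vs) = v # remove_at i vs"
  by (simp_all add: remove_at_def)

lemma set_remove_at: "set (remove_at i l) \<subseteq> set l"
  by (auto simp: remove_at_def dest: in_set_takeD in_set_dropD)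

lemma nth_remove_at:
  "i < length vs \<Longrightarrow> m < length vs - 1 \<Longrightarrow> remove_at i vs ! m = vs ! (if m < i then m else Suc m)"
  by (auto simp: remove_at_def nth_append min_def)

lemma map_remove_at: "map f (remove_at i vs) = remove_at i (map f vs)"
  by (simp add: remove_at_def take_map drop_map)

lemma prod_permute: "t permutes S \<Longrightarrow> (\<Prod>i\<in>S. g (t i)) = (\<Prod>i\<in>S. g i :: complex)"
  using prod.reindex_bij_betw[OF permutes_imp_bij] by blast

text \<open>Reindexing the product by the adjacent transposition \<open>t\<close> and then the sum
  by composition with \<open>t\<close> restores the summands up to the sign of
  \<open>t\<close>.\<close>

lemma wedge_swap: "wedge (as @ x # y # bs) vs = - wedge (as @ y # x # bs) vs"
proof (cases "length vs = length (as @ x # y # bs)")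
  case True
  define L where "L = as @ x # y # bs"
  define L' where "L' = as @ y # x # bs"
  define j where "j = length as"
  define t where "t = Transposition.transpose j (Suc j)"
  define k where "k = length L"
  have k': "length L' = k" "length vs = k" using True by (simp_all add: L_def L'_def k_def)
  have tp: "t permutes {..<k}"
    unfolding t_def by (rule permutes_swap_id) (auto simp: k_def L_def j_def)
  have tt: "t (t i) = i" for i by (simp add: t_def)
  have nth: "L ! i = L' ! t i" for i
  proof -
    consider "i < j" | "i = j" | "i = Suc j" | m where "i = Suc (Suc (j + m))"
      by (metis add_Suc_right less_imp_Suc_add linorder_neqE_nat Suc_lessI)
    then show ?thesis
      by cases (simp_all add: L_def L'_def t_def j_def nth_append transpose_def)
  qed
  have "wedge L vs = (\<Sum>\<sigma> | \<sigma> permutes {..<k}. of_int (sign \<sigma>) * (\<Prod>i<k. (L' ! t i) (vs ! \<sigma> (t (t i)))))"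
    by (simp add: wedge_def k_def[symmetric] k' nth tt)
  also have "\<dots> = (\<Sum>\<sigma> | \<sigma> permutes {..<k}. of_int (sign \<sigma>) * (\<Prod>i<k. (L' ! i) (vs ! \<sigma> (t i))))"
    by (subst prod_permute[OF tp, where g = "\<lambda>i. (L' ! i) (vs ! _ (t i))"]) simp
  also have "\<dots> = (\<Sum>\<sigma> | \<sigma> permutes {..<k}. of_int (sign (\<sigma> \<circ> t)) * (\<Prod>i<k. (L' ! i) (vs ! (\<sigma> \<circ> t) (t i))))"
    by (rule sum_permutations_compose_right[OF tp])
  also have "\<dots> = (\<Sum>\<sigma> | \<sigma> permutes {..<k}. - (of_int (sign \<sigma>) * (\<Prod>i<k. (L' ! i) (vs ! \<sigma> i))))"
  proof (rule sum.cong)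
    fix \<sigma> assume "\<sigma> \<in> {\<sigma>. \<sigma> permutes {..<k}}"
    then have "sign (\<sigma> \<circ> t) = sign \<sigma> * sign t"
      using tp by (intro sign_compose permutes_imp_permutation[of "{..<k}"]) auto
    then have "sign (\<sigma> \<circ> t) = - sign \<sigma>" by (simp add: t_def sign_swap_id)
    then show "of_int (sign (\<sigma> \<circ> t)) * (\<Prod>i<k. (L' ! i) (vs ! (\<sigma> \<circ> t) (t i))) =
        - (of_int (sign \<sigma>) * (\<Prod>i<k. (L' ! i) (vs ! \<sigma> i)))"
      by (simp add: tt)
  qed simp
  also have "\<dots> = - wedge L' vs"
    by (simp add: wedge_def k' sum_negf)
  finally show ?thesis by (simp add: L_def L'_def)
qed (simp add: wedge_def)

lemma wedge_move:
  "wedge (ps @ a # as @ bs) vs = (-1) ^ length as * wedge (ps @ as @ a # bs) vs"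
proof (induction as arbitrary: ps)
  case (Cons x as)
  have "wedge (ps @ a # (x # as) @ bs) vs = - wedge ((ps @ [x]) @ a # as @ bs) vs"
    using wedge_swap[of ps a x "as @ bs" vs] by simp
  then show ?case using Cons.IH[of "ps @ [x]"] by simp
qed simp

text \<open>The permutation sends the last index to \<open>b\<close> and lists the others in order,
  matching \<open>remove_at b\<close>. It is built downwards from \<open>b = k\<close> by one
  adjacent transposition per step.\<close>

lemma cycle_ex:
  assumes "b \<le> k"
  shows "\<exists>c. c permutes {..k} \<and> sign c = (-1) ^ (k + b) \<and> c k = b \<and>
    (\<forall>m<k. c m = (if m < b then m else Suc m))"
  using assms
proof (induction rule: inc_induct)
  case base
  then show ?case by (intro exI[of _ id] conjI permutes_id) (auto simp: sign_id)
next
  case (step b)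
  then obtain c where c: "c permutes {..k}" "sign c = (-1) ^ (k + Suc b)" "c k = Suc b"
    "\<And>m. m < k \<Longrightarrow> c m = (if m < Suc b then m else Suc m)"
    by auto
  let ?t = "Transposition.transpose b (Suc b)"
  have t: "?t permutes {..k}" using step by (intro permutes_swap_id) auto
  have "sign (?t \<circ> c) = sign ?t * sign c"
    using t c(1) by (intro sign_compose permutes_imp_permutation[of "{..k}"]) auto
  then have "sign (?t \<circ> c) = (-1) ^ (k + b)" by (simp add: sign_swap_id c(2))
  moreover have "(?t \<circ> c) m = (if m < b then m else Suc m)" if "m < k" for m
    using c(4)[OF that] by (cases "m = b") (auto simp: transpose_def)
  moreover have "(?t \<circ> c) k = b" by (simp add: c(3))
  ultimately show ?case
    using permutes_compose[OF c(1) t] by (intro exI[of _ "?t \<circ> c"] conjI allI impI)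
qed

text \<open>Laplace expansion along the last covector: the permutations are sorted by the image
  \<open>b\<close> of the last index.\<close>

lemma wedge_snoc:
  assumes len: "length vs = Suc (length \<phi>s)"
  shows "wedge (\<phi>s @ [\<phi>]) vs =
    (\<Sum>b<length vs. (-1) ^ (length \<phi>s + b) * \<phi> (vs ! b) * wedge \<phi>s (remove_at b vs))"
proof -
  define k where "k = length \<phi>s"
  have len': "length vs = Suc k" by (simp add: len k_def)
  define f where "f \<sigma> = of_int (sign \<sigma>) * (\<Prod>i<Suc k. ((\<phi>s @ [\<phi>]) ! i) (vs ! \<sigma> i))" for \<sigma> :: "nat \<Rightarrow> nat"
  have inner: "(\<Sum>q | q permutes {..<k}. f (Transposition.transpose k b \<circ> q)) =
      (-1) ^ (k + b) * \<phi> (vs ! b) * wedge \<phi>s (remove_at b vs)" if b: "b \<le> k" for b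
  proof -
    obtain c where c: "c permutes {..k}" "sign c = (-1) ^ (k + b)" "c k = b"
      "\<And>m. m < k \<Longrightarrow> c m = (if m < b then m else Suc m)"
      using cycle_ex[OF b] by blast
    \<comment> \<open>Splitting the permutations produces the transposition of \<open>k\<close> and
      \<open>b\<close> instead of the cycle \<open>c\<close>. The two differ by \<open>r\<close>,
      which fixes \<open>k\<close>, so reindexing by \<open>r\<close> replaces one with the
      other.\<close>
    define r where "r = Transposition.transpose k b \<circ> c"
    have "r permutes {..k}"
      unfolding r_def using b by (intro permutes_compose[OF c(1)] permutes_swap_id) auto
    moreover have "r k = k" by (simp add: r_def c(3))
    ultimately have r: "r permutes {..<k}"
      by (rule_tac permutes_superset[of r "{..k}"]) (auto simp: le_less)
    have "(\<Sum>q | q permutes {..<k}. f (Transposition.transpose k b \<circ> q)) = (\<Sum>q | q permutes {..<k}. f (Transposition.transpose k b \<circ> (r \<circ> q)))"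
      by (rule setum_permutations_compose_left[OF r])
    also have "\<dots> = (\<Sum>q | q permutes {..<k}. f (c \<circ> q))"
      by (simp add: r_def comp_def)
    also have "\<dots> = (\<Sum>q | q permutes {..<k}. ((-1) ^ (k + b) * \<phi> (vs ! b)) *
        (of_int (sign q) * (\<Prod>i<k. (\<phi>s ! i) (remove_at b vs ! q i))))"
    proof (rule sum.cong)
      fix q assume "q \<in> {q. q permutes {..<k}}"
      then have q: "q permutes {..<k}" by simp
      have "sign (c \<circ> q) = sign c * sign q"
        using q c(1) by (intro sign_compose permutes_imp_permutation[of "{..k}"]
          permutes_imp_permutation[of "{..<k}"]) auto
      moreover have "(\<Prod>i<k. ((\<phi>s @ [\<phi>]) ! i) (vs ! (c \<circ> q) i)) = (\<Prod>i<k. (\<phi>s ! i) (remove_at b vs ! q i))"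
      proof (rule prod.cong)
        fix i assume i: "i \<in> {..<k}"
        then have "q i < k" using permutes_in_image[OF q, of i] by simp
        then show "((\<phi>s @ [\<phi>]) ! i) (vs ! (c \<circ> q) i) = (\<phi>s ! i) (remove_at b vs ! q i)"
          using i b c(4) len' by (simp add: nth_append k_def[symmetric] nth_remove_at)
      qed simp
      moreover have "q k = k" using q by (simp add: permutes_def)
      ultimately show "f (c \<circ> q) = ((-1) ^ (k + b) * \<phi> (vs ! b)) *
        (of_int (sign q) * (\<Prod>i<k. (\<phi>s ! i) (remove_at b vs ! q i)))"
        using c(2,3) by (simp add: f_def k_def[symmetric] nth_append)
    qed simp
    also have "\<dots> = (-1) ^ (k + b) * \<phi> (vs ! b) * wedge \<phi>s (remove_at b vs)"
      using b by (simp add: wedge_def len' k_def[symmetric] sum_distrib_left)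
    finally show ?thesis .
  qed
  have "wedge (\<phi>s @ [\<phi>]) vs = sum f {\<sigma>. \<sigma> permutes (insert k {..<k})}"
    by (simp add: wedge_def len' k_def[symmetric] f_def[abs_def] lessThan_Suc)
  also have "\<dots> = (\<Sum>b\<in>insert k {..<k}. \<Sum>q | q permutes {..<k}. f (Transposition.transpose k b \<circ> q))"
    by (rule sum_over_permutations_insert) auto
  also have "\<dots> = (\<Sum>b\<in>insert k {..<k}. (-1) ^ (k + b) * \<phi> (vs ! b) * wedge \<phi>s (remove_at b vs))"
    by (intro sum.cong inner) auto
  finally show ?thesis by (simp only: len' k_def[symmetric] lessThan_Suc)
qed

text \<open>The alternating sum shared by the expansion of wedges, \<open>alt_deriv\<close> and the
  Chevalley-Eilenberg differential.\<close>

definition alt :: "('a \<Rightarrow> 'a list \<Rightarrow> complex) \<Rightarrow> 'a list \<Rightarrow> complex" where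
  "alt G vs = (\<Sum>i<length vs. (-1) ^ i * G (vs ! i) (remove_at i vs))"

lemma alt_Cons: "alt G (u # r) = G u r - alt (\<lambda>w r. G w (u # r)) r"
  by (simp add: alt_def sum.lessThan_Suc_shift sum_negf del: sum.lessThan_Suc)

lemma wedge_Cons: "wedge (\<phi> # \<phi>s) = alt (\<lambda>u r. \<phi> u * wedge \<phi>s r)"
proof
  fix vs
  show "wedge (\<phi> # \<phi>s) vs = alt (\<lambda>u r. \<phi> u * wedge \<phi>s r) vs"
  proof (cases "length vs = Suc (length \<phi>s)")
    case True
    \<comment> \<open>Moving the first covector to the end costs a sign that cancels the power of
      \<open>length \<phi>s\<close> in \<open>wedge_snoc\<close>.\<close>
    have "wedge (\<phi> # \<phi>s) vs = (-1) ^ length \<phi>s * wedge (\<phi>s @ [\<phi>]) vs"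
      using wedge_move[of "[]" \<phi> \<phi>s "[]" vs] by simp
    then show ?thesis
      by (simp add: wedge_snoc True alt_def sum_distrib_left power_add mult.assoc[symmetric]
          power_mult_distrib[symmetric] del: sum.lessThan_Suc)
  next
    case False
    then have "wedge \<phi>s (remove_at i vs) = 0" if "i < length vs" for i
      using that by (auto simp: wedge_def)
    with False show ?thesis by (simp add: alt_def wedge_def)
  qed
qed

definition multilinear :: "('a::real_vector list \<Rightarrow> complex) \<Rightarrow> bool" where
  "multilinear F \<longleftrightarrow> (\<forall>as bs. linear (\<lambda>u. F (as @ u # bs)))"

lemma multilinear_Cons: "multilinear F \<Longrightarrow> multilinear (\<lambda>r. F (u # r))"
  unfolding multilinear_def
proof (intro allI)
  fix as bs :: "'a list" assume "\<forall>as bs. linear (\<lambda>u. F (as @ u # bs))"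
  from this[rule_format, of "u # as" bs] show "linear (\<lambda>w. F (u # as @ w # bs))" by simp
qed

lemma multilinear_linear: "multilinear F \<Longrightarrow> linear (\<lambda>u. F (u # r))"
  unfolding multilinear_def
proof -
  assume "\<forall>as bs. linear (\<lambda>u. F (as @ u # bs))"
  from this[rule_format, of "[]" r] show ?thesis by simp
qed

lemma multilinear_wedge:
  assumes "\<And>\<phi>. \<phi> \<in> set \<phi>s \<Longrightarrow> linear \<phi>"
  shows "multilinear (wedge \<phi>s)"
  unfolding multilinear_def
proof (intro allI)
  fix as bs :: "(complex ^ 'a) list"
  let ?k = "length \<phi>s"
  let ?m = "length as"
  show "linear (\<lambda>u. wedge \<phi>s (as @ u # bs))"
  proof (cases "Suc (length as + length bs) = ?k")
    case False
    then show ?thesis by (simp add: wedge_def linear_zero)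
  next
    case True
    have "linear (\<lambda>u. of_int (sign \<sigma>) * (\<Prod>i<?k. (\<phi>s ! i) ((as @ u # bs) ! \<sigma> i)))"
      if \<sigma>: "\<sigma> permutes {..<?k}" for \<sigma>
    proof -
      have "?m \<in> {..<?k}" using True by simp
      then obtain i0 where i0: "i0 < ?k" "\<sigma> i0 = ?m"
        using permutes_image[OF \<sigma>] by (metis (no_types, lifting) imageE lessThan_iff)
      have inj: "\<sigma> i = ?m \<longleftrightarrow> i = i0" for i
        using permutes_inj[OF \<sigma>] i0 by (metis injD)
      \<comment> \<open>Only the factor \<open>i0\<close> sees the varying slot; \<open>c\<close>
        collects the sign and the other factors, with \<open>0\<close> as a placeholder in that
        slot.\<close>
      define c where "c = of_int (sign \<sigma>) * (\<Prod>i\<in>{..<?k} - {i0}. (\<phi>s ! i) ((as @ 0 # bs) ! \<sigma> i))"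
      have "(\<Prod>i\<in>{..<?k} - {i0}. (\<phi>s ! i) ((as @ u # bs) ! \<sigma> i)) =
          (\<Prod>i\<in>{..<?k} - {i0}. (\<phi>s ! i) ((as @ 0 # bs) ! \<sigma> i))" for u
        using inj by (intro prod.cong) (auto simp: nth_append nth_Cons' )
      then have "of_int (sign \<sigma>) * (\<Prod>i<?k. (\<phi>s ! i) ((as @ u # bs) ! \<sigma> i)) = c * (\<phi>s ! i0) u" for u
        using i0 by (subst prod.remove[of _ i0]) (auto simp: c_def)
      moreover have "linear (\<lambda>u. c * (\<phi>s ! i0) u)"
        using linear_compose[OF assms[OF nth_mem[OF i0(1)]], of "\<lambda>x. c * x"]
        by (simp add: o_def linear_conv_bounded_linear bounded_linear_mult_right)
      ultimately show ?thesis by simp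
    qed
    then show ?thesis using True by (simp add: wedge_def linear_compose_sum)
  qed
qed

lemma linear_dz: "linear (dz i)" and linear_dzbar: "linear (dzbar i)"
  by (auto intro!: linearI simp: dz_def dzbar_def)

lemma multilinear_pq:
  assumes "\<alpha> \<in> pq_covectors p q"
  shows "multilinear \<alpha>"
proof -
  obtain a where \<alpha>: "\<alpha> = (\<lambda>vs. \<Sum>I | length I = p. \<Sum>J | length J = q.
      a I J * wedge (map dz I @ map dzbar J) vs)"
    using assms by (auto simp: pq_covectors_def)
  have "linear (\<lambda>u. a I J * wedge (map dz I @ map dzbar J) (as @ u # bs))" for as bs I J
  proof -
    have "multilinear (wedge (map dz I @ map dzbar J))"
      by (rule multilinear_wedge) (auto intro: linear_dz linear_dzbar)
    then have "linear (\<lambda>u. wedge (map dz I @ map dzbar J) (as @ u # bs))"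
      by (simp add: multilinear_def)
    from linear_compose[OF this, of "\<lambda>x. a I J * x"] show ?thesis
      by (simp add: o_def linear_conv_bounded_linear bounded_linear_mult_right)
  qed
  then show ?thesis
    unfolding multilinear_def \<alpha> by (intro allI linear_compose_sum ballI)
qed

section \<open>Evaluation on vectors of pure type\<close>

text \<open>A pair \<open>(u, e)\<close> with \<open>e = 1\<close> or \<open>e = -1\<close> stands for the \<open>(1,0)\<close>- or \<open>(0,1)\<close>-part
  \<open>(u - e \<i> J u) / 2\<close> of \<open>u\<close> in the complexified tangent space, \<open>J\<close> being multiplication by \<open>\<i>\<close> on
  \<open>\<complex>\<^sup>m\<close>.\<close>

definition typed :: "(complex ^ 'm \<Rightarrow> complex) \<Rightarrow> (complex ^ 'm) \<times> complex \<Rightarrow> complex" where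
  "typed F p = (F (fst p) - snd p * \<i> * F (\<i> *s fst p)) / 2"

text \<open>The complex multilinear extension of \<open>F\<close>, evaluated on the typed parts of
  the listed vectors and expanded slot by slot.\<close>

fun tev :: "((complex ^ 'm) list \<Rightarrow> complex) \<Rightarrow> ((complex ^ 'm) \<times> complex) list \<Rightarrow> complex" where
  "tev F [] = F []"
| "tev F (p # l) = typed (\<lambda>u. tev (\<lambda>r. F (u # r)) l) p"

lemma typed_lin:
  "typed (\<lambda>u. F u + G u) p = typed F p + typed G p"
  "typed (\<lambda>u. F u - G u) p = typed F p - typed G p"
  "typed (\<lambda>u. c * F u) p = c * typed F p"
  "typed (\<lambda>u. - F u) p = - typed F p"
  "typed (\<lambda>u. 0) p = 0"
  by (simp_all add: typed_def field_simps)

lemma typed_mult_right: "typed (\<lambda>u. F u * c) p = typed F p * c"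
  by (simp add: typed_def field_simps)

lemma typed_sum: "typed (\<lambda>u. \<Sum>i\<in>I. F i u) p = (\<Sum>i\<in>I. typed (F i) p)"
  by (simp add: typed_def sum_divide_distrib[symmetric] sum_subtractf[symmetric] sum_distrib_left)

lemma typed_commute: "typed (\<lambda>u. typed (\<lambda>w. X u w) p) q = typed (\<lambda>w. typed (\<lambda>u. X u w) q) p"
  by (simp add: typed_def field_simps)

lemma tev_lin:
  "tev (\<lambda>r. F r + G r) l = tev F l + tev G l"
  "tev (\<lambda>r. F r - G r) l = tev F l - tev G l"
  "tev (\<lambda>r. c * F r) l = c * tev F l"
  "tev (\<lambda>r. - F r) l = - tev F l"
  "tev (\<lambda>r. 0) l = 0"
  by (induction l arbitrary: F G) (simp_all add: typed_lin)

text \<open>A vector keeps its type when it is moved to the front; \<open>typed_commute\<close> lets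
  the slots be expanded in either order.\<close>

lemma tev_alt: "tev (alt G) l = (\<Sum>i<length l. (-1) ^ i * typed (\<lambda>u. tev (G u) (remove_at i l)) (l ! i))"
proof (induction l arbitrary: G)
  case Nil
  then show ?case by (simp add: alt_def)
next
  case (Cons p l)
  have "tev (alt G) (p # l) = typed (\<lambda>u. tev (G u) l) p -
      (\<Sum>i<length l. (-1) ^ i * typed (\<lambda>w. tev (G w) (p # remove_at i l)) (l ! i))"
    by (simp add: alt_Cons tev_lin Cons.IH typed_lin typed_sum typed_commute[of _ _ p])
  then show ?case by (simp add: sum.lessThan_Suc_shift sum_negf del: tev.simps(2) sum.lessThan_Suc)
qed

lemma tev_wedge_Cons:
  "tev (wedge (\<phi> # \<phi>s)) l =
    (\<Sum>i<length l. (-1) ^ i * (typed \<phi> (l ! i) * tev (wedge \<phi>s) (remove_at i l)))"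
  unfolding wedge_Cons tev_alt by (simp add: tev_lin typed_mult_right)

text \<open>In the expansion along the first covector, duality leaves only the first vector.\<close>

lemma tev_wedge_dual:
  assumes "length \<phi>s = length l"
    and "\<And>i j. i < length l \<Longrightarrow> j < length l \<Longrightarrow> typed (\<phi>s ! i) (l ! j) = (if i = j then 1 else 0)"
  shows "tev (wedge \<phi>s) l = 1"
  using assms
proof (induction \<phi>s arbitrary: l)
  case Nil
  then show ?case by (simp add: wedge_def)
next
  case (Cons \<phi> \<phi>s)
  then obtain p l' where l: "l = p # l'" by (cases l) auto
  have "tev (wedge \<phi>s) l' = 1"
    using Cons.prems(1) Cons.prems(2)[of "Suc _" "Suc _"] by (intro Cons.IH) (auto simp: l)
  moreover have "typed \<phi> p = 1" "\<And>i. i < length l' \<Longrightarrow> typed \<phi> (l' ! i) = 0"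
    using Cons.prems(2)[of 0 0] Cons.prems(2)[of 0 "Suc _"] by (auto simp: l)
  ultimately show ?case
    by (simp add: tev_wedge_Cons l sum.lessThan_Suc_shift del: sum.lessThan_Suc tev.simps)
qed

text \<open>Up to sign, the derivation that \<open>H\<close> induces on multilinear forms.\<close>

definition repl :: "('a \<Rightarrow> 'a) \<Rightarrow> ('a list \<Rightarrow> complex) \<Rightarrow> 'a list \<Rightarrow> complex" where
  "repl H F vs = (\<Sum>k<length vs. F (vs[k := H (vs ! k)]))"

lemma repl_Cons: "repl H F (u # r) = F (H u # r) + repl H (\<lambda>r. F (u # r)) r"
  by (simp add: repl_def sum.lessThan_Suc_shift del: sum.lessThan_Suc)

text \<open>A complex linear \<open>H\<close> commutes with taking the (1,0)- or (0,1)-part, so it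
  may act inside the pairs.\<close>

lemma tev_repl:
  assumes H: "\<And>u. H (\<i> *s u) = \<i> *s H u"
  shows "tev (repl H F) l = (\<Sum>k<length l. tev F (l[k := map_prod H id (l ! k)]))"
proof (induction l arbitrary: F)
  case Nil
  then show ?case by (simp add: repl_def)
next
  case (Cons p l)
  have "typed (\<lambda>u. X (H u)) p = typed X (map_prod H id p)" for X
    by (simp add: typed_def H)
  from this[of "\<lambda>u. tev (\<lambda>r. F (u # r)) l"] show ?case
    by (simp add: repl_Cons tev_lin Cons.IH typed_lin typed_sum sum.lessThan_Suc_shift id_def del: sum.lessThan_Suc)
qed

lemma tev_linear:
  assumes "\<And>r. linear (\<lambda>u. X u r)"
  shows "linear (\<lambda>u. tev (X u) l)"
  using assms
proof (induction l arbitrary: X)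
  case (Cons p l)
  have "linear (\<lambda>u. tev (\<lambda>r. X u (w # r)) l)" for w
    by (rule Cons.IH) (rule Cons.prems)
  from linear_add[OF this] linear_scale[OF this] show ?case
    by (intro linearI) (simp_all add: typed_def field_simps scaleR_conv_of_real)
qed simp

lemma tev_zero:
  assumes "multilinear F"
  shows "tev F (l @ (0, e) # l') = 0"
  using assms
proof (induction l arbitrary: F)
  case Nil
  have "linear (\<lambda>u. tev (\<lambda>r. F (u # r)) l')"
    by (rule tev_linear) (rule multilinear_linear[OF Nil])
  from linear_0[OF this] show ?case by (simp add: typed_def)
next
  case (Cons p l)
  from Cons.IH[OF multilinear_Cons[OF Cons.prems]] show ?case by (simp add: typed_lin)
qed

lemma tev_update_zero:
  assumes "multilinear F" "k < length l"
  shows "tev F (l[k := (0, e)]) = 0"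
  using tev_zero[OF assms(1)] by (simp add: upd_conv_take_nth_drop assms(2))

text \<open>Although \<open>F\<close> is only real multilinear, the (1,0)-part of a vector depends
  on it complex linearly and the (0,1)-part antilinearly.\<close>

lemma tev_cscale:
  assumes "multilinear F"
  shows "tev F ((c *s w, 1) # l) = c * tev F ((w, 1) # l)"
    and "tev F ((c *s w, -1) # l) = cnj c * tev F ((w, -1) # l)"
proof -
  let ?A = "\<lambda>u. tev (\<lambda>r. F (u # r)) l"
  have lin: "linear ?A" by (rule tev_linear) (rule multilinear_linear[OF assms])
  have split: "a *s w = Re a *\<^sub>R w + Im a *\<^sub>R (\<i> *s w)" for a
    by (simp add: vec_eq_iff complex_eq_iff)
  have A: "?A (a *s w) = of_real (Re a) * ?A w + of_real (Im a) * ?A (\<i> *s w)" for a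
    by (subst split)
      (simp only: linear_add[OF lin] linear_scale[OF lin] scaleR_conv_of_real[where 'a = complex])
  have Ai: "?A (\<i> *s (c *s w)) = - of_real (Im c) * ?A w + of_real (Re c) * ?A (\<i> *s w)"
    using A[of "\<i> * c"] by (simp add: vector_smult_assoc)
  show "tev F ((c *s w, 1) # l) = c * tev F ((w, 1) # l)"
    "tev F ((c *s w, -1) # l) = cnj c * tev F ((w, -1) # l)"
    unfolding tev.simps typed_def fst_conv snd_conv A[of c] Ai
    by (simp_all add: complex_eq_iff field_simps)
qed

lemma i_mult_i_mult: "\<i> * (\<i> * z) = - z"
  by (simp add: mult.assoc[symmetric])

text \<open>For \<open>e\<close> and \<open>\<epsilon>\<close> in {1, -1} the value is
  \<open>\<alpha>\<close> if both are 1, \<open>\<beta>\<close> if both are -1, and 0 otherwise: a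
  differential of one type only sees vectors of that type.\<close>

lemma typed_typed_axis:
  assumes "\<And>c. R (c *s axis a 1) = \<alpha> * c + \<beta> * cnj c"
  shows "typed (\<lambda>h. typed R (h, e)) (axis a 1, \<epsilon>) = ((1 + e) * (1 + \<epsilon>) * \<alpha> + (1 - e) * (1 - \<epsilon>) * \<beta>) / 4"
proof -
  have R: "R (axis a 1) = \<alpha> + \<beta>" "R (\<i> *s axis a 1) = \<alpha> * \<i> - \<beta> * \<i>" "R (\<i> *s (\<i> *s axis a 1)) = - \<alpha> - \<beta>"
    using assms[of 1] assms[of \<i>] assms[of "-1"] by (simp_all add: vector_smult_assoc)
  show ?thesis
    unfolding typed_def fst_conv snd_conv R by (simp add: field_simps i_mult_i_mult)
qed

section \<open>Continuously differentiable functions\<close>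

lemma C1I:
  assumes D: "\<And>v. (f has_derivative D v) (at v)" and cont: "\<And>h. continuous_on UNIV (\<lambda>v. D v h)"
  shows "C1 f"
  unfolding C1_def
proof (intro exI conjI allI)
  have eq: "blinfun_apply (Blinfun (D v)) = D v" for v
    by (rule bounded_linear_Blinfun_apply) (rule has_derivative_bounded_linear[OF D])
  show "(f has_derivative blinfun_apply (Blinfun (D v))) (at v)" for v
    unfolding eq by (rule D)
  show "continuous_on UNIV (\<lambda>v. Blinfun (D v))"
    by (rule continuous_on_blinfun_componentwise) (simp add: eq cont)
qed

lemma C1_has_derivative: "C1 f \<Longrightarrow> (f has_derivative frechet_derivative f (at v)) (at v)"
  unfolding C1_def using differentiableI frechet_derivative_works by blast

lemma C1_continuous_frechet: "C1 f \<Longrightarrow> continuous_on UNIV (\<lambda>v. frechet_derivative f (at v) h)"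
proof -
  assume "C1 f"
  then obtain f' where f': "\<And>v. (f has_derivative blinfun_apply (f' v)) (at v)" "continuous_on UNIV f'"
    by (auto simp: C1_def)
  have "continuous_on UNIV (\<lambda>v. f' v h)"
    by (intro blinfun.continuous_on f'(2) continuous_on_const)
  then show ?thesis by (simp add: frechet_derivative_at[OF f'(1), symmetric])
qed

lemma C1_add: assumes "C1 f" "C1 g" shows "C1 (\<lambda>v. f v + g v)"
  by (rule C1I[OF has_derivative_add[OF assms[THEN C1_has_derivative]]])
     (intro continuous_intros assms[THEN C1_continuous_frechet])

lemma C1_mult: assumes "C1 f" "C1 g" shows "C1 (\<lambda>v. f v * g v)"
  by (rule C1I[OF has_derivative_mult[OF assms[THEN C1_has_derivative]]])
     (intro continuous_intros assms[THEN C1_continuous_frechet] assms[THEN C1_continuous])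

lemma C1_affine: assumes "bounded_linear L" shows "C1 (\<lambda>v. a + L v)"
proof (rule C1I)
  show "((\<lambda>v. a + L v) has_derivative L) (at v)" for v
    using has_derivative_add[OF has_derivative_const bounded_linear_imp_has_derivative[OF assms]]
    by simp
qed simp

lemma C1_const: "C1 (\<lambda>v. c)"
  using C1_affine[OF bounded_linear_zero, of c] by simp

lemma C1_sum: "finite I \<Longrightarrow> (\<And>i. i \<in> I \<Longrightarrow> C1 (F i)) \<Longrightarrow> C1 (\<lambda>v. \<Sum>i\<in>I. F i v)"
  by (induction rule: finite_induct) (simp_all add: C1_const C1_add)

lemma frechet_derivative_cong_open:
  assumes "open U" "x \<in> U" "\<And>y. y \<in> U \<Longrightarrow> f y = g y"
  shows "frechet_derivative f (at x) = frechet_derivative g (at x)"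
proof -
  have "(f has_derivative D) (at x) \<longleftrightarrow> (g has_derivative D) (at x)" for D
    using has_derivative_transform_within_open[OF _ assms(1,2), of f D UNIV g]
      has_derivative_transform_within_open[OF _ assms(1,2), of g D UNIV f] assms(3) by auto
  then show ?thesis by (simp add: frechet_derivative_def)
qed

text \<open>Transfers the smoothness of a form in its charts to its globally defined
  pull-back.\<close>

lemma C1_local:
  fixes f :: "'a::euclidean_space \<Rightarrow> complex"
  assumes loc: "\<And>v. \<exists>U g. open U \<and> v \<in> U \<and> Ck_on (Suc 0) U g \<and> (\<forall>y\<in>U. f y = g y)"
  shows "C1 f"
proof (rule C1I)
  fix v
  show "(f has_derivative frechet_derivative f (at v)) (at v)"
  proof -
    obtain U g where U: "open U" "v \<in> U" "Ck_on (Suc 0) U g" "\<forall>y\<in>U. f y = g y"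
      using loc[of v] by blast
    then have "(g has_derivative frechet_derivative g (at v)) (at v)"
      by (simp add: frechet_derivative_works)
    then have "(f has_derivative frechet_derivative g (at v)) (at v)"
      by (rule has_derivative_transform_within_open[OF _ U(1,2)]) (use U(4) in auto)
    then show ?thesis using differentiableI frechet_derivative_works by blast
  qed
next
  fix h
  have "continuous (at v) (\<lambda>v. frechet_derivative f (at v) h)" for v
  proof -
    obtain U g where U: "open U" "v \<in> U" "Ck_on (Suc 0) U g" "\<forall>y\<in>U. f y = g y"
      using loc[of v] by blast
    then have "continuous_on U (\<lambda>v. frechet_derivative g (at v) h)" by simp
    moreover have "frechet_derivative g (at y) h = frechet_derivative f (at y) h" if "y \<in> U" for y
      using frechet_derivative_cong_open[OF U(1) that, of g f] U(4) by simp
    ultimately have "continuous_on U (\<lambda>v. frechet_derivative f (at v) h)"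
      by (metis (no_types, lifting) continuous_on_cong)
    then show ?thesis using U(1,2) continuous_on_eq_continuous_at by blast
  qed
  then show "continuous_on UNIV (\<lambda>v. frechet_derivative f (at v) h)"
    by (simp add: continuous_on_eq_continuous_within)
qed

lemma Ck_on_cong:
  assumes "Ck_on k S f" "open S" "\<And>x. x \<in> S \<Longrightarrow> f x = g x"
  shows "Ck_on k S g"
  using assms
proof (induction k arbitrary: f g)
  case 0
  then show ?case by (simp cong: continuous_on_cong)
next
  case (Suc k)
  have "g differentiable (at x)" if x: "x \<in> S" for x
  proof -
    have "(f has_derivative frechet_derivative f (at x)) (at x)"
      using Suc.prems(1) x by (simp add: frechet_derivative_works)
    then have "(g has_derivative frechet_derivative f (at x)) (at x)"
      by (rule has_derivative_transform_within_open[OF _ Suc.prems(2) x]) (rule Suc.prems(3))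
    then show ?thesis by (rule differentiableI)
  qed
  moreover have "Ck_on k S (\<lambda>x. frechet_derivative g (at x) v)" for v
  proof (rule Suc.IH)
    show "Ck_on k S (\<lambda>x. frechet_derivative f (at x) v)" using Suc.prems(1) by simp
    show "frechet_derivative f (at x) v = frechet_derivative g (at x) v" if "x \<in> S" for x
      using frechet_derivative_cong_open[OF Suc.prems(2) that Suc.prems(3)] by simp
  qed (rule Suc.prems(2))
  ultimately show ?case by simp
qed

lemma Ck_on_const: "Ck_on k S (\<lambda>x. c)"
  by (induction k arbitrary: c) (simp_all add: frechet_derivative_const)

lemma smooth_on_affine:
  assumes "bounded_linear L"
  shows "smooth_on S (\<lambda>x. a + L x)"
  unfolding smooth_on_def
proof
  fix k
  have d: "((\<lambda>x. a + L x) has_derivative L) (at x)" for x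
    using has_derivative_add[OF has_derivative_const bounded_linear_imp_has_derivative[OF assms]]
    by simp
  show "Ck_on k S (\<lambda>x. a + L x)"
  proof (cases k)
    case 0
    then show ?thesis using assms by (simp add: continuous_on_add linear_continuous_on)
  next
    case (Suc k')
    have "frechet_derivative (\<lambda>x. a + L x) (at x) = L" for x
      using frechet_derivative_at[OF d] by simp
    then show ?thesis using d by (auto simp: Suc Ck_on_const intro: differentiableI)
  qed
qed

text \<open>A common form of \<open>deriv10\<close> (\<open>e = 1\<close>) and
  \<open>deriv01\<close> (\<open>e = -1\<close>), so that the same lemmas cover both.\<close>

definition derivE :: "complex \<Rightarrow> (complex ^ 'm::finite \<Rightarrow> complex) \<Rightarrow> complex ^ 'm \<Rightarrow> complex ^ 'm \<Rightarrow> complex"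
  where "derivE e f x v =
    (frechet_derivative f (at x) v - e * \<i> * frechet_derivative f (at x) (\<i> *s v)) / 2"

lemma deriv10_derivE: "deriv10 = derivE 1" and deriv01_derivE: "deriv01 = derivE (-1)"
  by (simp_all add: fun_eq_iff deriv10_def deriv01_def derivE_def)

lemma del_derivE: "del = alt_deriv (derivE 1)" and delbar_derivE: "delbar = alt_deriv (derivE (-1))"
  by (simp_all add: del_def delbar_def deriv10_derivE deriv01_derivE)

lemma derivE_const [simp]: "derivE e (\<lambda>y. c) x v = 0"
  by (simp add: derivE_def frechet_derivative_const)

lemma alt_deriv_derivE_0 [simp]: "alt_deriv (derivE e) 0 = 0"
  by (simp add: fun_eq_iff alt_deriv_def)

lemma alt_deriv_eq:
  "alt_deriv \<delta> \<omega> c x vs = (if x \<in> chart_image c then alt (\<lambda>h r. \<delta> (\<lambda>y. \<omega> c y r) x h) vs else 0)"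
  by (simp add: alt_deriv_def alt_def remove_at_def)

lemma alt_map: "alt G (map f vs) = alt (\<lambda>u r. G (f u) (map f r)) vs"
  by (simp add: alt_def map_remove_at)

context two_step
begin

section \<open>Forms on the nilmanifold\<close>

text \<open>The pull-back along \<open>orb\<close>: at \<open>v\<close> it is read off in the chart
  \<open>chart_at v\<close>, where the coordinate of \<open>orb v\<close> is \<open>v\<close>
  itself.\<close>

definition pullback :: "((complex ^ 'm) set, 'm) form \<Rightarrow> complex ^ 'm \<Rightarrow> 'm covector" where
  "pullback \<omega> v = \<omega> (chart_at v) v"

lemma pq_forms_act:
  assumes \<omega>: "\<omega> \<in> pq_forms atlas p q" and g: "g \<in> gauss_lattice" and x: "x \<in> nbh a" "act g x \<in> nbh b"
  shows "\<omega> (chart_at a) x vs = \<omega> (chart_at b) (act g x) (map (dact g) vs)"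
proof -
  have "orb x \<in> fst (chart_at a) \<inter> fst (chart_at b)"
    using x orb_act[OF g, of x] by (auto simp: chart_at_def)
  then have "x \<in> transition_domain (chart_at a) (chart_at b)"
    unfolding transition_domain_def using snd_chart_at[OF x(1)] by (metis image_eqI)
  then have "\<omega> (chart_at a) x vs = \<omega> (chart_at b) (transition (chart_at a) (chart_at b) x)
     (map (frechet_derivative (transition (chart_at a) (chart_at b)) (at x)) vs)"
    using \<omega> unfolding pq_forms_def by simp
  then show ?thesis
    by (simp add: transition_eq[OF x g]
        frechet_derivative_at[OF transition_has_derivative[OF x g], symmetric])
qed

text \<open>By the transition rule with \<open>g = 0\<close>, the choice of the chart does not
  matter, so the pull-back can be differentiated within one chart.\<close>

lemma pullback_eq:
  assumes \<omega>: "\<omega> \<in> pq_forms atlas p q" and x: "x \<in> nbh a"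
  shows "\<omega> (chart_at a) x = pullback \<omega> x"
proof
  fix vs
  have "dact 0 = (\<lambda>v. v)" by (simp add: dact_def fun_eq_iff B.zero_left)
  then show "\<omega> (chart_at a) x vs = pullback \<omega> x vs"
    using pq_forms_act[OF \<omega> gauss_lattice_zero x, of x vs] nbh(2)
    by (simp add: pullback_def)
qed

lemma pullback_pq: "\<omega> \<in> pq_forms atlas p q \<Longrightarrow> pullback \<omega> v \<in> pq_covectors p q"
  unfolding pq_forms_def pullback_def using nbh(2) by simp

lemma pullback_act:
  assumes "\<omega> \<in> pq_forms atlas p q" "g \<in> gauss_lattice"
  shows "pullback \<omega> (act g v) (map (dact g) vs) = pullback \<omega> v vs"
  using pq_forms_act[OF assms nbh(2) nbh(2)] by (simp add: pullback_def)

lemma C1_pullback: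
  assumes \<omega>: "\<omega> \<in> pq_forms atlas p q"
  shows "C1 (\<lambda>v. pullback \<omega> v vs)"
proof (rule C1_local)
  fix v
  have "smooth_on (chart_image (chart_at v)) (\<lambda>x. \<omega> (chart_at v) x vs)"
    using \<omega> chart_at_atlas unfolding pq_forms_def by blast
  then have "Ck_on (Suc 0) (nbh v) (\<lambda>x. \<omega> (chart_at v) x vs)"
    unfolding smooth_on_def chart_image_chart_at by blast
  moreover have "\<forall>y\<in>nbh v. pullback \<omega> y vs = \<omega> (chart_at v) y vs"
    using pullback_eq[OF \<omega>] by simp
  ultimately show "\<exists>U g. open U \<and> v \<in> U \<and> Ck_on (Suc 0) U g \<and> (\<forall>y\<in>U. pullback \<omega> y vs = g y)"
    using nbh(1,2) by blast
qed

lemma pullback_alt_deriv: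
  assumes \<omega>: "\<omega> \<in> pq_forms atlas p q"
  shows "pullback (alt_deriv (derivE e) \<omega>) v = alt (\<lambda>h r. derivE e (\<lambda>y. pullback \<omega> y r) v h)"
proof -
  have "frechet_derivative (\<lambda>y. \<omega> (chart_at v) y r) (at v) =
      frechet_derivative (\<lambda>y. pullback \<omega> y r) (at v)" for r
    by (rule frechet_derivative_cong_open[OF nbh(1,2)]) (simp add: pullback_eq[OF \<omega>])
  then show ?thesis
    by (simp add: fun_eq_iff pullback_def[of "alt_deriv _ _"] alt_deriv_eq nbh(2) derivE_def)
qed

section \<open>Coefficients with respect to the left-invariant frame\<close>

lemma frame_act: "frame (act g v) u = dact g (frame v u)"
  by (simp add: frame_def act_def dact_def B.add_left B.add_right)

lemma frame_clinear: "frame v (c *s u) = c *s frame v u"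
  by (simp add: frame_def B_clinear vector_add_ldistrib)

lemma has_derivative_frame: "((\<lambda>v. frame v u) has_derivative (\<lambda>h. B h u)) (at v)"
proof -
  have "((\<lambda>v. u + B v u) has_derivative (\<lambda>h. 0 + B h u)) (at v)"
    by (intro has_derivative_add has_derivative_const
        bounded_linear_imp_has_derivative B.bounded_linear_left)
  then show ?thesis by (simp add: frame_def)
qed

lemma multilinear_expand:
  assumes "multilinear F"
  shows "F (w # r) = (\<Sum>b\<in>Basis. of_real (w \<bullet> b) * F (b # r))"
proof -
  note lin = multilinear_linear[OF assms]
  have "F (w # r) = F ((\<Sum>b\<in>Basis. (w \<bullet> b) *\<^sub>R b) # r)" by (simp add: euclidean_representation)
  also have "\<dots> = (\<Sum>b\<in>Basis. F (((w \<bullet> b) *\<^sub>R b) # r))" by (rule linear_sum[OF lin])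
  also have "\<dots> = (\<Sum>b\<in>Basis. of_real (w \<bullet> b) * F (b # r))"
    by (simp add: linear_scale[OF lin] scaleR_conv_of_real)
  finally show ?thesis .
qed

text \<open>The product rule for a form evaluated on moving frame vectors: one term with the vectors
  frozen and one for each slot. In the induction the first vector is expanded in the real basis, so
  that it enters through scalar coefficients.\<close>

lemma frame_eval:
  assumes F: "\<And>v. multilinear (F v)" "\<And>us. C1 (\<lambda>v. F v us)"
  shows "C1 (\<lambda>v. F v (map (frame v) us)) \<and>
    (\<forall>v. ((\<lambda>v. F v (map (frame v) us)) has_derivative
      (\<lambda>h. frechet_derivative (\<lambda>x. F x (map (frame v) us)) (at v) h +
        (\<Sum>k<length us. F v ((map (frame v) us)[k := B h (us ! k)])))) (at v))"
  using assms
proof (induction us arbitrary: F)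
  case Nil
  then show ?case by (simp add: C1_has_derivative)
next
  case (Cons u us)
  define G where "G b v = F v (b # map (frame v) us)" for b v
  have exp: "F v (frame v u # map (frame v) us) = (\<Sum>b\<in>Basis. of_real (frame v u \<bullet> b) * G b v)" for v
    unfolding G_def by (rule multilinear_expand[OF Cons.prems(1)])
  have IH: "C1 (G b)" "(G b has_derivative
      (\<lambda>h. frechet_derivative (\<lambda>x. F x (b # map (frame v) us)) (at v) h +
        (\<Sum>k<length us. F v (b # (map (frame v) us)[k := B h (us ! k)])))) (at v)" for b v
    using Cons.IH[of "\<lambda>v r. F v (b # r)", OF multilinear_Cons[OF Cons.prems(1)] Cons.prems(2)]
    unfolding G_def[abs_def] by auto
  have coeff: "((\<lambda>v. complex_of_real (frame v u \<bullet> b)) has_derivative (\<lambda>h. of_real (B h u \<bullet> b))) (at v)" for b v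
    by (intro has_derivative_of_real has_derivative_inner_left has_derivative_frame)
  have coeffC1: "C1 (\<lambda>v. complex_of_real (frame v u \<bullet> b))" for b
    by (rule C1I[OF coeff]) (intro continuous_intros B.continuous_on)
  show ?case
  proof (intro conjI allI)
    show "C1 (\<lambda>v. F v (map (frame v) (u # us)))"
      by (simp add: exp) (intro C1_sum C1_mult coeffC1 IH finite_Basis)
    fix v
    let ?w = "frame v u"
    let ?r = "map (frame v) us"
    have fixed: "frechet_derivative (\<lambda>x. F x (?w # ?r)) (at v) h =
        (\<Sum>b\<in>Basis. of_real (?w \<bullet> b) * frechet_derivative (\<lambda>x. F x (b # ?r)) (at v) h)" for h
    proof -
      have "((\<lambda>x. F x (?w # ?r)) has_derivative
          (\<lambda>h. \<Sum>b\<in>Basis. of_real (?w \<bullet> b) * frechet_derivative (\<lambda>x. F x (b # ?r)) (at v) h)) (at v)"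
        unfolding multilinear_expand[OF Cons.prems(1), of _ ?w]
        by (intro has_derivative_sum has_derivative_mult_right C1_has_derivative Cons.prems(2))
      from fun_cong[OF frechet_derivative_at[OF this], of h] show ?thesis by (rule sym)
    qed
    have "((\<lambda>v. \<Sum>b\<in>Basis. of_real (frame v u \<bullet> b) * G b v) has_derivative
      (\<lambda>h. \<Sum>b\<in>Basis. of_real (?w \<bullet> b) * (frechet_derivative (\<lambda>x. F x (b # ?r)) (at v) h +
        (\<Sum>k<length us. F v (b # ?r[k := B h (us ! k)]))) + of_real (B h u \<bullet> b) * G b v)) (at v)"
      by (intro has_derivative_sum has_derivative_mult coeff IH)
    moreover have "(\<Sum>b\<in>Basis. of_real (?w \<bullet> b) * (frechet_derivative (\<lambda>x. F x (b # ?r)) (at v) h +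
        (\<Sum>k<length us. F v (b # ?r[k := B h (us ! k)]))) + of_real (B h u \<bullet> b) * G b v) =
      frechet_derivative (\<lambda>x. F x (?w # ?r)) (at v) h +
        ((\<Sum>k<length us. F v (?w # ?r[k := B h (us ! k)])) + F v (B h u # ?r))" for h
    proof -
      have "(\<Sum>k<length us. F v (?w # ?r[k := B h (us ! k)])) =
          (\<Sum>b\<in>Basis. of_real (?w \<bullet> b) * (\<Sum>k<length us. F v (b # ?r[k := B h (us ! k)])))"
        by (simp only: multilinear_expand[OF Cons.prems(1), of _ ?w] sum_distrib_left)
           (rule sum.swap)
      then show ?thesis
        unfolding fixed
        by (simp add: multilinear_expand[OF Cons.prems(1), of v "B h u"] G_def distrib_left sum.distrib)
    qed
    ultimately have "((\<lambda>v. \<Sum>b\<in>Basis. of_real (frame v u \<bullet> b) * G b v) has_derivative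
      (\<lambda>h. frechet_derivative (\<lambda>x. F x (?w # ?r)) (at v) h +
        ((\<Sum>k<length us. F v (?w # ?r[k := B h (us ! k)])) + F v (B h u # ?r)))) (at v)"
      by simp
    then show "((\<lambda>v. F v (map (frame v) (u # us))) has_derivative
      (\<lambda>h. frechet_derivative (\<lambda>x. F x (map (frame v) (u # us))) (at v) h +
        (\<Sum>k<length (u # us). F v ((map (frame v) (u # us))[k := B h ((u # us) ! k)])))) (at v)"
      by (simp add: exp sum.lessThan_Suc_shift add.commute add.left_commute del: sum.lessThan_Suc)
  qed
qed

definition coef :: "((complex ^ 'm) set, 'm) form \<Rightarrow> (complex ^ 'm) list \<Rightarrow> complex ^ 'm \<Rightarrow> complex" where
  "coef \<omega> us v = pullback \<omega> v (map (frame v) us)"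

lemma pullback_frame_eval:
  assumes "\<omega> \<in> pq_forms atlas p q"
  shows "C1 (coef \<omega> us)" "(coef \<omega> us has_derivative
      (\<lambda>h. frechet_derivative (\<lambda>x. pullback \<omega> x (map (frame v) us)) (at v) h +
        (\<Sum>k<length us. pullback \<omega> v ((map (frame v) us)[k := B h (us ! k)])))) (at v)"
  using frame_eval[of "pullback \<omega>", OF multilinear_pq[OF pullback_pq[OF assms]] C1_pullback[OF assms], of us]
  unfolding coef_def[abs_def] by blast+

lemmas C1_coef = pullback_frame_eval(1)

text \<open>\<open>dact g\<close> carries the frame at \<open>v\<close> to the frame at
  \<open>act g v\<close>.\<close>

lemma linvariant_coef: "\<omega> \<in> pq_forms atlas p q \<Longrightarrow> linvariant (coef \<omega> us)"
  unfolding linvariant_def coef_def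
proof (intro ballI allI)
  fix g v :: "complex ^ 'm" assume \<omega>: "\<omega> \<in> pq_forms atlas p q" and g: "g \<in> gauss_lattice"
  have *: "map (frame (act g v)) us = map (dact g) (map (frame v) us)" by (simp add: frame_act)
  show "pullback \<omega> (act g v) (map (frame (act g v)) us) = pullback \<omega> v (map (frame v) us)"
    unfolding * by (rule pullback_act[OF \<omega> g])
qed

text \<open>Since \<open>B (frame v h) u\<close> equals \<open>frame v (B h u)\<close>, the slot
  terms of the product rule are again coefficients.\<close>

lemma lderiv_coef:
  assumes \<omega>: "\<omega> \<in> pq_forms atlas p q"
  shows "lderiv h (coef \<omega> us) v =
    frechet_derivative (\<lambda>x. pullback \<omega> x (map (frame v) us)) (at v) (frame v h) +
    repl (B h) (\<lambda>us. coef \<omega> us v) us"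
proof -
  note frechet_derivative_at[OF pullback_frame_eval(2)[OF \<omega>], symmetric]
  then have "lderiv h (coef \<omega> us) v =
    frechet_derivative (\<lambda>x. pullback \<omega> x (map (frame v) us)) (at v) (frame v h) +
        (\<Sum>k<length us. pullback \<omega> v ((map (frame v) us)[k := B (frame v h) (us ! k)]))"
    by (simp add: lderiv_def)
  moreover have "B (frame v h) u = frame v (B h u)" for u
    by (simp add: frame_def B.add_left)
  ultimately show ?thesis
    by (simp add: repl_def coef_def map_update)
qed

text \<open>The derivative of a form expressed through \<open>lderiv\<close> of its coefficients;
  the \<open>repl\<close> terms remove the motion of the frame.\<close>

definition coefd :: "complex \<Rightarrow> ((complex ^ 'm) set, 'm) form \<Rightarrow> (complex ^ 'm) list \<Rightarrow> complex ^ 'm \<Rightarrow> complex" where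
  "coefd e \<omega> us v = alt (\<lambda>h r. (lderiv h (coef \<omega> r) v - e * \<i> * lderiv (\<i> *s h) (coef \<omega> r) v) / 2 -
     (repl (B h) (\<lambda>us. coef \<omega> us v) r - e * \<i> * repl (B (\<i> *s h)) (\<lambda>us. coef \<omega> us v) r) / 2) us"

lemma coef_alt_deriv:
  assumes \<omega>: "\<omega> \<in> pq_forms atlas p q"
  shows "coef (alt_deriv (derivE e) \<omega>) us v = coefd e \<omega> us v"
  unfolding coef_def[of "alt_deriv _ _"] pullback_alt_deriv[OF \<omega>] alt_map coefd_def lderiv_coef[OF \<omega>] derivE_def
  by (simp add: frame_clinear diff_divide_distrib add_divide_distrib algebra_simps)

text \<open>The \<open>(1,0)\<close>-part (\<open>e = 1\<close>) and the \<open>(0,1)\<close>-part (\<open>e = -1\<close>) of the Chevalley-Eilenberg differential,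
  i.e. of the exterior derivative on left-invariant forms.\<close>

definition covd :: "complex \<Rightarrow> ((complex ^ 'm) list \<Rightarrow> complex) \<Rightarrow> (complex ^ 'm) list \<Rightarrow> complex" where
  "covd e F = alt (\<lambda>h r. - (repl (B h) F r - e * \<i> * repl (B (\<i> *s h)) F r) / 2)"

lemma continuous_lderiv: "C1 f \<Longrightarrow> continuous_on UNIV (lderiv h f)"
  unfolding lderiv_def[abs_def]
proof -
  assume "C1 f"
  then obtain f' where f': "\<And>v. (f has_derivative blinfun_apply (f' v)) (at v)" "continuous_on UNIV f'"
    by (auto simp: C1_def)
  have "continuous_on UNIV (\<lambda>v. f' v (frame v h))"
    unfolding frame_def by (intro blinfun.continuous_on f' continuous_intros B.continuous_on)
  then show "continuous_on UNIV (\<lambda>v. frechet_derivative f (at v) (frame v h))"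
    by (simp add: frechet_derivative_at[OF f'(1), symmetric])
qed

section \<open>Averaging forms over the manifold\<close>

definition mean :: "((complex ^ 'm \<Rightarrow> complex) \<Rightarrow> complex) \<Rightarrow> bool" where
  "mean \<mu> \<longleftrightarrow>
    (\<forall>f g. continuous_on UNIV f \<longrightarrow> continuous_on UNIV g \<longrightarrow> \<mu> (\<lambda>v. f v + g v) = \<mu> f + \<mu> g) \<and>
    (\<forall>c f. \<mu> (\<lambda>v. c * f v) = c * \<mu> f) \<and> (\<forall>c. \<mu> (\<lambda>v. c) = c) \<and>
    (\<forall>f h. C1 f \<longrightarrow> linvariant f \<longrightarrow> \<mu> (lderiv h f) = 0)"

lemma mean_ex: "\<exists>\<mu>. mean \<mu>"
  unfolding mean_def by (rule lderiv_mean_zero) blast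

context
  fixes \<mu> assumes \<mu>: "mean \<mu>"
begin

lemma mean_add: "continuous_on UNIV f \<Longrightarrow> continuous_on UNIV g \<Longrightarrow> \<mu> (\<lambda>v. f v + g v) = \<mu> f + \<mu> g"
  and mean_cmult: "\<mu> (\<lambda>v. c * f v) = c * \<mu> f"
  and mean_const: "\<mu> (\<lambda>v. c) = c"
  and mean_lderiv: "C1 f \<Longrightarrow> linvariant f \<Longrightarrow> \<mu> (lderiv h f) = 0"
  using \<mu> unfolding mean_def by blast+

lemma mean_divide: "\<mu> (\<lambda>v. f v / c) = \<mu> f / c"
  using mean_cmult[of "1 / c" f] by simp

lemma mean_diff:
  assumes "continuous_on UNIV f" "continuous_on UNIV g"
  shows "\<mu> (\<lambda>v. f v - g v) = \<mu> f - \<mu> g"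
proof -
  have "continuous_on UNIV (\<lambda>v. (-1) * g v)" by (intro continuous_intros assms)
  from mean_add[OF assms(1) this] show ?thesis using mean_cmult[of "-1" g] by simp
qed

lemma mean_combination:
  assumes cont: "continuous_on UNIV f" "continuous_on UNIV f'" "continuous_on UNIV g" "continuous_on UNIV g'"
  shows "\<mu> (\<lambda>v. s * ((f v - c * f' v) / 2 - (g v - c * g' v) / 2)) =
    s * ((\<mu> f - c * \<mu> f') / 2 - (\<mu> g - c * \<mu> g') / 2)"
proof -
  have "\<mu> (\<lambda>v. (f v - c * f' v) / 2 - (g v - c * g' v) / 2) =
      \<mu> (\<lambda>v. (f v - c * f' v) / 2) - \<mu> (\<lambda>v. (g v - c * g' v) / 2)"
    by (rule mean_diff) (intro continuous_intros cont, simp)+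
  moreover have "\<mu> (\<lambda>v. f v - c * f' v) = \<mu> f - c * \<mu> f'" "\<mu> (\<lambda>v. g v - c * g' v) = \<mu> g - c * \<mu> g'"
    by (subst mean_diff; (intro continuous_intros cont)?; simp add: mean_cmult)+
  ultimately show ?thesis by (simp add: mean_cmult mean_divide)
qed

lemma mean_sum:
  "finite I \<Longrightarrow> (\<And>i. i \<in> I \<Longrightarrow> continuous_on UNIV (F i)) \<Longrightarrow>
    \<mu> (\<lambda>v. \<Sum>i\<in>I. F i v) = (\<Sum>i\<in>I. \<mu> (F i))"
proof (induction rule: finite_induct)
  case empty
  then show ?case by (simp add: mean_const)
next
  case (insert i I)
  then show ?case by (simp add: mean_add continuous_on_sum)
qed

text \<open>The left-invariant form obtained by averaging, given by its values on frame
  vectors.\<close>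

definition mcoef :: "((complex ^ 'm) set, 'm) form \<Rightarrow> (complex ^ 'm) list \<Rightarrow> complex" where
  "mcoef \<omega> us = \<mu> (coef \<omega> us)"

lemma multilinear_mcoef:
  assumes \<omega>: "\<omega> \<in> pq_forms atlas p q"
  shows "multilinear (mcoef \<omega>)"
  unfolding multilinear_def
proof (intro allI linearI)
  fix as bs :: "(complex ^ 'm) list" and u w :: "complex ^ 'm" and c :: real
  have lin: "linear (\<lambda>u. pullback \<omega> v (map (frame v) as @ u # map (frame v) bs))" for v
    using multilinear_pq[OF pullback_pq[OF \<omega>]] by (simp add: multilinear_def)
  have "coef \<omega> (as @ (u + w) # bs) = (\<lambda>v. coef \<omega> (as @ u # bs) v + coef \<omega> (as @ w # bs) v)"
    using linear_add[OF lin]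
    by (simp add: fun_eq_iff coef_def frame_def[of _ "u + w"] B.add_right
        frame_def[of _ u] frame_def[of _ w] add.assoc add.left_commute)
  then show "mcoef \<omega> (as @ (u + w) # bs) = mcoef \<omega> (as @ u # bs) + mcoef \<omega> (as @ w # bs)"
    by (simp add: mcoef_def mean_add C1_continuous[OF C1_coef[OF \<omega>]])
  have "frame v (c *\<^sub>R u) = c *\<^sub>R frame v u" for v
    by (simp add: frame_def B.scaleR_right scaleR_add_right)
  then have "coef \<omega> (as @ (c *\<^sub>R u) # bs) = (\<lambda>v. of_real c * coef \<omega> (as @ u # bs) v)"
    using linear_scale[OF lin] by (simp add: fun_eq_iff coef_def scaleR_conv_of_real[where 'a = complex])
  then show "mcoef \<omega> (as @ (c *\<^sub>R u) # bs) = c *\<^sub>R mcoef \<omega> (as @ u # bs)"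
    by (simp add: mcoef_def mean_cmult scaleR_conv_of_real)
qed

lemma
  assumes \<omega>: "\<omega> \<in> pq_forms atlas p q"
  shows continuous_coefd: "continuous_on UNIV (coefd e \<omega> us)"
    and mean_coefd: "\<mu> (coefd e \<omega> us) = covd e (mcoef \<omega>) us"
proof -
  have cont: "continuous_on UNIV (coef \<omega> r)" "continuous_on UNIV (\<lambda>v. coef \<omega> r v)"
    "continuous_on UNIV (lderiv h (coef \<omega> r))" "continuous_on UNIV (\<lambda>v. lderiv h (coef \<omega> r) v)" for r h
    using C1_continuous[OF C1_coef[OF \<omega>]] continuous_lderiv[OF C1_coef[OF \<omega>]] by simp_all
  have repl: "continuous_on UNIV (\<lambda>v. repl (B h) (\<lambda>us. coef \<omega> us v) r)" for h r
    unfolding repl_def by (intro continuous_intros cont)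
  have mrepl: "\<mu> (\<lambda>v. repl (B h) (\<lambda>us. coef \<omega> us v) r) = repl (B h) (mcoef \<omega>) r" for h r
    unfolding repl_def mcoef_def by (subst mean_sum) (simp_all add: cont)
  \<comment> \<open>The \<open>lderiv\<close> terms have mean zero; only the frame corrections,
    which make up \<open>covd\<close>, survive.\<close>
  have step: "\<mu> (\<lambda>v. s * ((lderiv h (coef \<omega> r) v - e * \<i> * lderiv (\<i> *s h) (coef \<omega> r) v) / 2 -
      (repl (B h) (\<lambda>us. coef \<omega> us v) r - e * \<i> * repl (B (\<i> *s h)) (\<lambda>us. coef \<omega> us v) r) / 2)) =
    s * (- (repl (B h) (mcoef \<omega>) r - e * \<i> * repl (B (\<i> *s h)) (mcoef \<omega>) r) / 2)" for s h r
    unfolding mean_combination[OF cont(3) cont(3) repl repl] mrepl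
      mean_lderiv[OF C1_coef[OF \<omega>] linvariant_coef[OF \<omega>]] by (simp, simp add: algebra_simps)
  show "continuous_on UNIV (coefd e \<omega> us)"
    unfolding coefd_def[abs_def] alt_def by (intro continuous_intros cont repl) auto
  show "\<mu> (coefd e \<omega> us) = covd e (mcoef \<omega>) us"
    unfolding coefd_def[abs_def] alt_def covd_def
    by (subst mean_sum; (simp only: step)?; (intro continuous_intros cont repl)?; simp)
qed

text \<open>Averaging turns an equation between forms on the manifold into one between multilinear
  maps, the right-hand side having constant coefficients.\<close>

lemma covd_mcoef_add:
  assumes \<omega>: "\<omega> \<in> pq_forms atlas p q" and \<eta>: "\<eta> \<in> pq_forms atlas p' q'"
    and eq: "alt_deriv (derivE e) \<omega> + alt_deriv (derivE e') \<eta> = \<beta>"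
    and const: "\<And>us v. coef \<beta> us v = c us"
  shows "covd e (mcoef \<omega>) us + covd e' (mcoef \<eta>) us = c us"
proof -
  have "(\<lambda>v. coefd e \<omega> us v + coefd e' \<eta> us v) = (\<lambda>v. c us)"
  proof
    fix v
    have "coef \<beta> us v = coef (alt_deriv (derivE e) \<omega>) us v + coef (alt_deriv (derivE e') \<eta>) us v"
      by (simp add: coef_def pullback_def eq[symmetric])
    then show "coefd e \<omega> us v + coefd e' \<eta> us v = c us"
      by (simp add: coef_alt_deriv[OF \<omega>] coef_alt_deriv[OF \<eta>] const)
  qed
  moreover have "\<mu> (\<lambda>v. coefd e \<omega> us v + coefd e' \<eta> us v) = \<mu> (coefd e \<omega> us) + \<mu> (coefd e' \<eta> us)"
    by (intro mean_add continuous_coefd[OF \<omega>] continuous_coefd[OF \<eta>])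
  ultimately show ?thesis by (simp add: mean_const mean_coefd[OF \<omega>] mean_coefd[OF \<eta>])
qed

end

end

section \<open>Construction of left-invariant forms\<close>

lemma wedge_map: "wedge \<phi>s (map f vs) = wedge (map (\<lambda>\<phi>. \<phi> \<circ> f) \<phi>s) vs"
proof (cases "length vs = length \<phi>s")
  case True
  have "(\<Prod>i<length \<phi>s. (\<phi>s ! i) (map f vs ! \<sigma> i)) =
      (\<Prod>i<length \<phi>s. (map (\<lambda>\<phi>. \<phi> \<circ> f) \<phi>s ! i) (vs ! \<sigma> i))"
    if "\<sigma> permutes {..<length \<phi>s}" for \<sigma>
    using permutes_in_image[OF that] True by (intro prod.cong) auto
  then show ?thesis by (simp add: wedge_def True)
qed (simp add: wedge_def)

lemma finite_lists_length: "finite {I :: 'm::finite list. length I = p}"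
  using finite_lists_length_eq[of "UNIV :: 'm set" p] by simp

lemma wedge_pq:
  fixes I J :: "'m::finite list"
  assumes "length I = p" "length J = q"
  shows "wedge (map dz I @ map dzbar J) \<in> pq_covectors p q"
  unfolding pq_covectors_def
proof (intro CollectI exI ext)
  fix vs
  have "(\<Sum>J' | length J' = q. (if I' = I \<and> J' = J then 1 else 0) * wedge (map dz I' @ map dzbar J') vs) =
      (if I' = I then wedge (map dz I' @ map dzbar J) vs else 0)" for I'
    using assms(2) by (simp add: if_distrib[of "\<lambda>c. c * _"] sum.delta finite_lists_length cong: if_cong)
  then show "wedge (map dz I @ map dzbar J) vs = (\<Sum>I' | length I' = p. \<Sum>J' | length J' = q.
      (if I' = I \<and> J' = J then 1 else 0) * wedge (map dz I' @ map dzbar J') vs)"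
    using assms(1) by (simp add: sum.delta finite_lists_length)
qed

lemma pq_add:
  assumes "\<alpha> \<in> pq_covectors p q" "\<beta> \<in> pq_covectors p q"
  shows "(\<lambda>vs. \<alpha> vs + \<beta> vs) \<in> pq_covectors p q"
proof -
  obtain a b where "\<alpha> = (\<lambda>vs. \<Sum>I | length I = p. \<Sum>J | length J = q. a I J * wedge (map dz I @ map dzbar J) vs)"
    "\<beta> = (\<lambda>vs. \<Sum>I | length I = p. \<Sum>J | length J = q. b I J * wedge (map dz I @ map dzbar J) vs)"
    using assms unfolding pq_covectors_def by blast
  then have "(\<lambda>vs. \<alpha> vs + \<beta> vs) = (\<lambda>vs. \<Sum>I | length I = p. \<Sum>J | length J = q.
      (a I J + b I J) * wedge (map dz I @ map dzbar J) vs)"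
    by (simp add: fun_eq_iff sum.distrib distrib_right)
  then show ?thesis unfolding pq_covectors_def by (intro CollectI exI)
qed

lemma pq_scale:
  assumes "\<alpha> \<in> pq_covectors p q"
  shows "(\<lambda>vs. c * \<alpha> vs) \<in> pq_covectors p q"
proof -
  obtain a where "\<alpha> = (\<lambda>vs. \<Sum>I | length I = p. \<Sum>J | length J = q. a I J * wedge (map dz I @ map dzbar J) vs)"
    using assms unfolding pq_covectors_def by blast
  then have "(\<lambda>vs. c * \<alpha> vs) = (\<lambda>vs. \<Sum>I | length I = p. \<Sum>J | length J = q.
      (c * a I J) * wedge (map dz I @ map dzbar J) vs)"
    by (simp add: fun_eq_iff sum_distrib_left mult.assoc)
  then show ?thesis unfolding pq_covectors_def by (intro CollectI exI)
qed

lemma pq_zero: "(\<lambda>vs. 0) \<in> pq_covectors p q"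
  unfolding pq_covectors_def by (rule CollectI, rule exI[of _ "\<lambda>I J. 0"]) simp

lemma pq_sum:
  "finite K \<Longrightarrow> (\<And>k. k \<in> K \<Longrightarrow> \<alpha> k \<in> pq_covectors p q) \<Longrightarrow> (\<lambda>vs. \<Sum>k\<in>K. \<alpha> k vs) \<in> pq_covectors p q"
  by (induction rule: finite_induct) (simp_all add: pq_zero pq_add)

lemma clinear_expand:
  fixes \<psi> :: "complex ^ 'm::finite \<Rightarrow> complex"
  assumes "linear \<psi>" "\<And>c u. \<psi> (c *s u) = c * \<psi> u"
  shows "\<psi> u = (\<Sum>i\<in>UNIV. \<psi> (axis i 1) * dz i u)"
proof -
  have "\<psi> u = \<psi> (\<Sum>i\<in>UNIV. (u $ i) *s axis i 1)" by (simp add: basis_expansion)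
  then show ?thesis by (simp add: linear_sum[OF assms(1)] assms(2) dz_def mult.commute)
qed

lemma wedge_Cons_lincomb:
  "wedge ((\<lambda>u. \<Sum>k\<in>K. c k * \<psi> k u) # \<phi>s) vs = (\<Sum>k\<in>K. c k * wedge (\<psi> k # \<phi>s) vs)"
  unfolding wedge_Cons alt_def
  by (simp add: sum_distrib_left sum_distrib_right algebra_simps) (rule sum.swap)

lemma wedge_clinear_pq:
  fixes I J :: "'m::finite list" and c :: "'m \<Rightarrow> complex"
  assumes "\<And>u. \<psi> u = (\<Sum>i\<in>UNIV. c i * dz i u)"
  shows "wedge (\<psi> # map dz I @ map dzbar J) \<in> pq_covectors (Suc (length I)) (length J)"
proof -
  have \<psi>: "\<psi> = (\<lambda>u. \<Sum>i\<in>UNIV. c i * dz i u)" using assms by blast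
  have "wedge (\<psi> # map dz I @ map dzbar J) =
      (\<lambda>vs. \<Sum>i\<in>UNIV. c i * wedge (map dz (i # I) @ map dzbar J) vs)"
    unfolding \<psi> by (intro ext) (simp add: wedge_Cons_lincomb)
  then show ?thesis by (simp del: list.map) (intro pq_sum pq_scale wedge_pq; simp)
qed

lemma wedge_cantilinear_pq:
  fixes J :: "'m::finite list" and c :: "'m \<Rightarrow> complex"
  assumes "\<And>u. \<psi> u = (\<Sum>i\<in>UNIV. c i * dzbar i u)"
  shows "wedge (\<psi> # map dzbar J) \<in> pq_covectors 0 (Suc (length J))"
proof -
  have \<psi>: "\<psi> = (\<lambda>u. \<Sum>i\<in>UNIV. c i * dzbar i u)" using assms by blast
  have "wedge (\<psi> # map dzbar J) =
      (\<lambda>vs. \<Sum>i\<in>UNIV. c i * wedge (map dz [] @ map dzbar (i # J)) vs)"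
    unfolding \<psi> by (intro ext) (simp add: wedge_Cons_lincomb)
  then show ?thesis by (simp del: list.map) (intro pq_sum pq_scale wedge_pq; simp)
qed

context two_step
begin

text \<open>One expression on \<open>complex ^ 'm\<close> serves in every chart; invariance under
  translations makes the local forms compatible.\<close>

definition glob :: "(complex ^ 'm \<Rightarrow> 'm covector) \<Rightarrow> ((complex ^ 'm) set, 'm) form" where
  "glob \<alpha> c x = (if c \<in> atlas \<and> x \<in> chart_image c then \<alpha> x else (\<lambda>vs. 0))"

lemma glob_pq_forms:
  assumes pq: "\<And>x. \<alpha> x \<in> pq_covectors p q"
    and smooth: "\<And>S vs. smooth_on S (\<lambda>x. \<alpha> x vs)"
    and inv: "\<And>g x vs. \<alpha> (act g x) (map (dact g) vs) = \<alpha> x vs"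
  shows "glob \<alpha> \<in> pq_forms atlas p q"
  unfolding pq_forms_def
proof (intro CollectI conjI ballI allI impI)
  fix c :: "((complex ^ 'm) set, 'm) chart" and vs assume c: "c \<in> atlas"
  have Ck: "Ck_on k (chart_image c) (\<lambda>x. glob \<alpha> c x vs)" for k
  proof -
    have "open (chart_image c)" using c nbh(1) by (auto simp: atlas_def)
    show ?thesis
      by (rule Ck_on_cong[OF _ \<open>open _\<close>, of _ "\<lambda>x. \<alpha> x vs"])
         (use smooth c in \<open>auto simp: smooth_on_def glob_def\<close>)
  qed
  then show "smooth_on (chart_image c) (\<lambda>x. glob \<alpha> c x vs)" by (simp add: smooth_on_def)
  fix c' x assume c': "c' \<in> atlas" and x: "x \<in> transition_domain c c'"
  obtain a b where ab: "c = chart_at a" "c' = chart_at b" using c c' by (auto simp: atlas_def)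
  obtain g where g: "g \<in> gauss_lattice" "x \<in> nbh a" "act g x \<in> nbh b"
    using transition_at x unfolding ab by blast
  show "glob \<alpha> c x vs = glob \<alpha> c' (transition c c' x)
      (map (frechet_derivative (transition c c') (at x)) vs)"
    unfolding ab
    by (simp add: transition_eq[OF g(2,3,1)] glob_def g inv
        frechet_derivative_at[OF transition_has_derivative[OF g(2,3,1)], symmetric])
qed (use pq in \<open>auto simp: glob_def\<close>)

lemma alt_deriv_glob:
  "alt_deriv (derivE e) (glob \<alpha>) = glob (\<lambda>x. alt (\<lambda>h r. derivE e (\<lambda>y. \<alpha> y r) x h))"
proof (intro ext)
  fix c :: "((complex ^ 'm) set, 'm) chart" and x vs
  show "alt_deriv (derivE e) (glob \<alpha>) c x vs = glob (\<lambda>x. alt (\<lambda>h r. derivE e (\<lambda>y. \<alpha> y r) x h)) c x vs"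
  proof (cases "c \<in> atlas \<and> x \<in> chart_image c")
    case True
    then have "open (chart_image c)" using nbh(1) by (auto simp: atlas_def)
    then have "frechet_derivative (\<lambda>y. glob \<alpha> c y r) (at x) = frechet_derivative (\<lambda>y. \<alpha> y r) (at x)" for r
      by (rule frechet_derivative_cong_open) (use True in \<open>auto simp: glob_def\<close>)
    then show ?thesis using True by (simp add: alt_deriv_eq glob_def[of _ c x] derivE_def)
  next
    case False
    then have "c \<notin> atlas \<or> x \<notin> chart_image c" by blast
    then show ?thesis
    proof
      assume c: "c \<notin> atlas"
      then have "(\<lambda>y. glob \<alpha> c y r) = (\<lambda>y. 0)" for r by (simp add: glob_def fun_eq_iff)
      then show ?thesis using c by (simp add: alt_deriv_eq glob_def[of _ c x] alt_def)
    qed (simp add: alt_deriv_eq glob_def)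
  qed
qed

lemma pullback_glob: "pullback (glob \<alpha>) v = \<alpha> v"
  by (simp add: pullback_def glob_def nbh(2))

text \<open>The inverse of \<open>frame v\<close>; thus \<open>\<psi> \<circ> coframe v\<close> is
  the left-invariant covector field with value \<open>\<psi>\<close> at the origin.\<close>

definition coframe :: "complex ^ 'm \<Rightarrow> complex ^ 'm \<Rightarrow> complex ^ 'm" where
  "coframe v u = u - B v u"

lemma coframe_act: "coframe (act g v) (dact g u) = coframe v u"
  by (simp add: coframe_def act_def dact_def B.add_left B.add_right)

definition lform :: "(complex ^ 'm \<Rightarrow> complex) \<Rightarrow> (complex ^ 'm \<Rightarrow> complex) list \<Rightarrow> complex ^ 'm \<Rightarrow> 'm covector" where
  "lform \<psi> \<phi>s v = wedge ((\<psi> \<circ> coframe v) # \<phi>s)"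

text \<open>Such covectors, taken with constant coefficients, are left-invariant.\<close>

definition basic :: "(complex ^ 'm \<Rightarrow> complex) \<Rightarrow> bool" where
  "basic \<phi> \<longleftrightarrow> linear \<phi> \<and> (\<forall>u v. \<phi> (B u v) = 0)"

lemma basic_dact: "basic \<phi> \<Longrightarrow> \<phi> \<circ> dact g = \<phi>"
  and basic_frame: "basic \<phi> \<Longrightarrow> \<phi> \<circ> frame g = \<phi>"
  by (auto simp: basic_def fun_eq_iff dact_def frame_def linear_add)

lemma map_basic:
  assumes "\<And>\<phi>. \<phi> \<in> set \<phi>s \<Longrightarrow> basic \<phi>"
  shows "map (\<lambda>\<phi>. \<phi> \<circ> dact g) \<phi>s = \<phi>s" "map (\<lambda>\<phi>. \<phi> \<circ> frame g) \<phi>s = \<phi>s"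
  using assms by (auto intro!: map_idI simp: basic_dact basic_frame)

lemma lform_act:
  assumes "\<And>\<phi>. \<phi> \<in> set \<phi>s \<Longrightarrow> basic \<phi>"
  shows "lform \<psi> \<phi>s (act g v) (map (dact g) vs) = lform \<psi> \<phi>s v vs"
proof -
  have "(\<psi> \<circ> coframe (act g v)) \<circ> dact g = \<psi> \<circ> coframe v"
    by (simp add: fun_eq_iff coframe_act)
  then show ?thesis by (simp add: lform_def wedge_map map_basic[OF assms] del: o_apply)
qed

text \<open>Only the first factor depends on \<open>v\<close>, and affinely; this yields both
  smoothness and the derivative.\<close>

lemma lform_expand:
  assumes "linear \<psi>"
  shows "lform \<psi> \<phi>s v vs = wedge (\<psi> # \<phi>s) vs +
    (\<Sum>i<length vs. (-1) ^ i * (- \<psi> (B v (vs ! i)) * wedge \<phi>s (remove_at i vs)))"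
  unfolding lform_def wedge_Cons alt_def
  by (simp add: coframe_def linear_diff[OF assms] algebra_simps sum_subtractf sum_negf)

lemma bounded_linear_lform:
  assumes "linear \<psi>"
  shows "bounded_linear (\<lambda>v. \<Sum>i<length vs. (-1) ^ i * (- \<psi> (B v (vs ! i)) * wedge \<phi>s (remove_at i vs)))"
proof (intro bounded_linear_sum)
  fix i
  have "bounded_linear (\<lambda>v. \<psi> (B v (vs ! i)))"
    using bounded_linear_compose[OF _ B.bounded_linear_left, of \<psi>] assms
    by (simp add: linear_conv_bounded_linear)
  from bounded_linear_compose[OF bounded_linear_mult_right[of "(-1) ^ i"]
      bounded_linear_compose[OF bounded_linear_mult_left[of "wedge \<phi>s (remove_at i vs)"] bounded_linear_minus[OF this]]]
  show "bounded_linear (\<lambda>v. (-1) ^ i * (- \<psi> (B v (vs ! i)) * wedge \<phi>s (remove_at i vs)))" .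
qed

lemma smooth_lform: "linear \<psi> \<Longrightarrow> smooth_on S (\<lambda>v. lform \<psi> \<phi>s v vs)"
  unfolding lform_expand by (rule smooth_on_affine[OF bounded_linear_lform])

text \<open>Assumption \<open>S\<close> splits the \<open>e\<close>-part of the derivative of the
  first factor into a product of covectors; the two alternations then combine into one
  wedge.\<close>

lemma alt_derivE_lform:
  assumes \<psi>: "linear \<psi>"
    and S: "\<And>h u. - (\<psi> (B h u) - e * \<i> * \<psi> (B (\<i> *s h) u)) / 2 = c * \<sigma> h * \<tau> u"
  shows "alt (\<lambda>h r. derivE e (\<lambda>y. lform \<psi> \<phi>s y r) x h) vs = c * wedge (\<sigma> # \<tau> # \<phi>s) vs"
proof -
  have "derivE e (\<lambda>y. lform \<psi> \<phi>s y r) x h = c * (\<sigma> h * wedge (\<tau> # \<phi>s) r)" for r h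
  proof -
    have "((\<lambda>y. lform \<psi> \<phi>s y r) has_derivative
      (\<lambda>h. 0 + (\<Sum>i<length r. (-1) ^ i * (- \<psi> (B h (r ! i)) * wedge \<phi>s (remove_at i r))))) (at x)"
      unfolding lform_expand[OF \<psi>]
      by (intro has_derivative_add has_derivative_const bounded_linear_imp_has_derivative
          bounded_linear_lform[OF \<psi>])
    then have "frechet_derivative (\<lambda>y. lform \<psi> \<phi>s y r) (at x) =
      (\<lambda>h. \<Sum>i<length r. (-1) ^ i * (- \<psi> (B h (r ! i)) * wedge \<phi>s (remove_at i r)))"
      by (simp add: frechet_derivative_at[symmetric])
    then have "derivE e (\<lambda>y. lform \<psi> \<phi>s y r) x h =
      (\<Sum>i<length r. (-1) ^ i * ((- (\<psi> (B h (r ! i)) - e * \<i> * \<psi> (B (\<i> *s h) (r ! i))) / 2) *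
        wedge \<phi>s (remove_at i r)))"
      by (simp add: derivE_def sum_distrib_left sum_subtractf[symmetric] sum_divide_distrib sum_negf[symmetric]
          field_simps)
    also have "\<dots> = c * (\<sigma> h * wedge (\<tau> # \<phi>s) r)"
      unfolding S wedge_Cons alt_def by (simp add: sum_distrib_left algebra_simps)
    finally show ?thesis .
  qed
  then show ?thesis
    unfolding wedge_Cons[of \<sigma>] by (simp add: alt_def sum_distrib_left algebra_simps)
qed

lemma coef_glob_basic:
  assumes "\<And>\<phi>. \<phi> \<in> set \<phi>s \<Longrightarrow> basic \<phi>"
  shows "coef (glob (\<lambda>x vs. c * wedge \<phi>s vs)) us v = c * wedge \<phi>s us"
  by (simp add: coef_def pullback_glob wedge_map map_basic[OF assms])

lemma glob_basic_pq:
  fixes I J :: "'m list"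
  assumes "\<And>\<phi>. \<phi> \<in> set (map dz I @ map dzbar J) \<Longrightarrow> basic \<phi>" "length I = p" "length J = q"
  shows "glob (\<lambda>x vs. c * wedge (map dz I @ map dzbar J) vs) \<in> pq_forms atlas p q"
proof (rule glob_pq_forms)
  show "(\<lambda>vs. c * wedge (map dz I @ map dzbar J) vs) \<in> pq_covectors p q"
    by (intro pq_scale wedge_pq assms)
  show "smooth_on S (\<lambda>x. c * wedge (map dz I @ map dzbar J) vs)" for S vs
    by (simp add: smooth_on_def Ck_on_const)
  have "wedge (map dz I @ map dzbar J) (map (dact g) vs) = wedge (map dz I @ map dzbar J) vs" for g vs
    unfolding wedge_map by (subst map_basic(1)) (use assms(1) in auto)
  then show "c * wedge (map dz I @ map dzbar J) (map (dact g) vs) = c * wedge (map dz I @ map dzbar J) vs" for g vs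
    by simp
qed

lemma coframe_clinear: "coframe v (c *s u) = c *s coframe v u"
  by (simp add: coframe_def B_clinear vector_ssub_ldistrib)

lemma linear_coframe: "linear (coframe v)"
  by (intro linearI) (simp_all add: coframe_def B.add_right B.scaleR_right scaleR_diff_right)

lemma alt_deriv_glob_lform:
  assumes "linear \<psi>"
    and "\<And>h u. - (\<psi> (B h u) - e * \<i> * \<psi> (B (\<i> *s h) u)) / 2 = c * \<sigma> h * \<tau> u"
  shows "alt_deriv (derivE e) (glob (lform \<psi> \<phi>s)) = glob (\<lambda>x vs. c * wedge (\<sigma> # \<tau> # \<phi>s) vs)"
proof -
  have "(\<lambda>x. alt (\<lambda>h r. derivE e (\<lambda>y. lform \<psi> \<phi>s y r) x h)) = (\<lambda>x vs. c * wedge (\<sigma> # \<tau> # \<phi>s) vs)"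
    by (intro ext) (rule alt_derivE_lform[OF assms])
  then show ?thesis by (simp add: alt_deriv_glob)
qed

lemma glob_0: "glob (\<lambda>x vs. 0) = 0"
  by (simp add: fun_eq_iff glob_def)

lemma glob_lform_pq_forms:
  assumes "linear \<psi>" "\<And>\<phi>. \<phi> \<in> set \<phi>s \<Longrightarrow> basic \<phi>" "\<And>x. lform \<psi> \<phi>s x \<in> pq_covectors p q"
  shows "glob (lform \<psi> \<phi>s) \<in> pq_forms atlas p q"
  by (rule glob_pq_forms) (use assms in \<open>simp_all add: lform_act smooth_lform\<close>)

section \<open>The Chevalley-Eilenberg differential on typed vectors\<close>

definition subst_sum ::
  "((complex ^ 'm) list \<Rightarrow> complex) \<Rightarrow> ((complex ^ 'm) \<times> complex) list \<Rightarrow> complex ^ 'm \<Rightarrow> complex" where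
  "subst_sum F l h = (\<Sum>k<length l. tev F (l[k := map_prod (B h) id (l ! k)]))"

lemma tev_covd:
  "tev (covd e F) l =
    - (\<Sum>i<length l. (-1) ^ i * typed (\<lambda>h. typed (subst_sum F (remove_at i l)) (h, e)) (l ! i))"
proof -
  have inner: "tev (\<lambda>r. - (repl (B h) F r - e * \<i> * repl (B (\<i> *s h)) F r) / 2) l' =
      - typed (subst_sum F l') (h, e)" for h l'
  proof -
    have "tev (\<lambda>r. - (repl (B h) F r - e * \<i> * repl (B (\<i> *s h)) F r) / 2) l' =
        tev (\<lambda>r. (- 1 / 2) * (repl (B h) F r - e * \<i> * repl (B (\<i> *s h)) F r)) l'"
      by (rule arg_cong[of _ _ "\<lambda>F. tev F l'"]) (auto simp: fun_eq_iff field_simps)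
    also have "\<dots> = (- 1 / 2) * (subst_sum F l' h - e * \<i> * subst_sum F l' (\<i> *s h))"
      unfolding tev_lin subst_sum_def by (simp add: tev_repl B_clinear)
    finally show ?thesis by (simp add: typed_def)
  qed
  show ?thesis
    unfolding covd_def tev_alt inner by (simp add: typed_lin sum_negf)
qed

lemma subst_sum_zero:
  assumes "multilinear F" "\<And>p. p \<in> set l \<Longrightarrow> B h (fst p) = 0"
  shows "subst_sum F l h = 0"
  unfolding subst_sum_def
proof (intro sum.neutral ballI)
  fix k assume k: "k \<in> {..<length l}"
  then have "map_prod (B h) id (l ! k) = (0, snd (l ! k))"
    using assms(2)[of "l ! k"] by (simp add: map_prod_def split_beta)
  then show "tev F (l[k := map_prod (B h) id (l ! k)]) = 0"
    using k by (simp add: tev_update_zero[OF assms(1)])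
qed

text \<open>Isolates the single value of \<open>B\<close> that survives in the evaluations of the
  example.\<close>

lemma subst_sum_Cons:
  assumes "multilinear F" "\<And>p. p \<in> set l \<Longrightarrow> B h (fst p) = 0"
  shows "subst_sum F ((u, e) # l) h = tev F ((B h u, e) # l)"
proof -
  have "(\<Sum>k<length l. tev F ((u, e) # l[k := map_prod (B h) id (l ! k)])) = 0"
  proof (intro sum.neutral ballI)
    fix k assume k: "k \<in> {..<length l}"
    then have "map_prod (B h) id (l ! k) = (0, snd (l ! k))"
      using assms(2)[of "l ! k"] by (simp add: map_prod_def split_beta)
    then show "tev F ((u, e) # l[k := map_prod (B h) id (l ! k)]) = 0"
      using tev_update_zero[OF assms(1), of "Suc k" "(u, e) # l"] k by (simp del: tev.simps)
  qed
  then show ?thesis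
    unfolding subst_sum_def by (simp add: sum.lessThan_Suc_shift del: tev.simps sum.lessThan_Suc)
qed

section \<open>The double complex of forms\<close>

lemma zero_pq_forms: "0 \<in> pq_forms atlas p q"
  by (auto simp: pq_forms_def zero_fun_def pq_zero smooth_on_def Ck_on_const)

lemma del_0 [simp]: "del 0 = 0" and delbar_0 [simp]: "delbar 0 = 0"
  by (simp_all add: del_derivE delbar_derivE)

lemma zero_forms: "0 \<in> forms atlas p q"
  by (simp add: forms_def zero_pq_forms)

lemma Tot_diff_0: "Tot_diff del delbar 0 = 0"
  by (simp add: fun_eq_iff Tot_diff_def)

lemma zero_Tot_filt: "0 \<in> Tot_filt (forms atlas) p k"
  by (simp add: Tot_filt_def Tot_def zero_forms)

lemma zero_ss_B: "0 \<in> ss_B (forms atlas) del delbar r p q"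
proof -
  have "0 \<in> ss_Z (forms atlas) del delbar r p q" for r p q
    by (simp add: ss_Z_def zero_Tot_filt Tot_diff_0)
  then show ?thesis
    unfolding ss_B_def by (intro CollectI exI[of _ 0]) (simp add: Tot_diff_0)
qed

text \<open>In the target bidegree \<open>(m + 1, 0)\<close> the filtration step \<open>F\<^sup>m\<^sup>+\<^sup>2\<close> is zero, so only boundaries of
  elements of \<open>F\<^sup>1\<close> have to be excluded.\<close>

lemma froelicher_d_nonzeroI:
  assumes z: "z \<in> Tot_filt (forms atlas) 0 (int m)"
    and Dz: "Tot_diff del delbar z \<in> Tot_filt (forms atlas) (int m + 1) (int m + 1)"
    and notB: "\<And>y. y \<in> Tot_filt (forms atlas) 1 (int m) \<Longrightarrow> Tot_diff del delbar y \<noteq> Tot_diff del delbar z"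
  shows "froelicher_d_nonzero atlas (int m + 1)"
proof -
  let ?r = "int m + 1"
  let ?B = "ss_B (forms atlas) del delbar ?r"
  let ?\<xi> = "(\<lambda>b. z + b) ` ?B 0 (int m)"
  have "?\<xi> \<in> froelicher_E atlas ?r 0 (int m)"
    unfolding froelicher_E_def ss_E_def using z Dz
    by (intro CollectI exI[of _ z] conjI) (simp_all add: ss_Z_def add.commute)
  moreover have "froelicher_d atlas ?r 0 (int m) ?\<xi> \<noteq> froelicher_zero atlas ?r (0 + ?r) (int m - ?r + 1)"
  proof
    assume eq: "froelicher_d atlas ?r 0 (int m) ?\<xi> = froelicher_zero atlas ?r (0 + ?r) (int m - ?r + 1)"
    have "z \<in> ?\<xi>" using zero_ss_B by (intro image_eqI[of _ _ 0]) simp_all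
    then have "Tot_diff del delbar z + 0 \<in> froelicher_d atlas ?r 0 (int m) ?\<xi>"
      unfolding froelicher_d_def ss_diff_def using zero_ss_B by blast
    then have "Tot_diff del delbar z \<in> ?B (0 + ?r) (int m - ?r + 1)"
      using eq by (simp add: froelicher_zero_def)
    then obtain x y where xy: "Tot_diff del delbar z = x + Tot_diff del delbar y"
      "x \<in> Tot_filt (forms atlas) (int m + 2) (int m + 1)" "y \<in> Tot_filt (forms atlas) 1 (int m)"
      by (auto simp: ss_B_def ss_Z_def algebra_simps)
    \<comment> \<open>For \<open>i \<ge> m + 2\<close> the second degree \<open>m + 1 - i\<close> is
      negative, where the space of forms is zero.\<close>
    have "x i = 0" for i
    proof (cases "i < int m + 2")
      case False
      have "x i \<in> forms atlas i (int m + 1 - i)" using xy(2) by (simp add: Tot_filt_def Tot_def)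
      then show ?thesis using False by (simp add: forms_def)
    qed (use xy(2) in \<open>simp add: Tot_filt_def\<close>)
    then have "x = 0" by (simp add: fun_eq_iff)
    then show False using xy(1) notB[OF xy(3)] by simp
  qed
  ultimately show ?thesis unfolding froelicher_d_nonzero_def by blast
qed

end

section \<open>The example\<close>

locale coordinates =
  fixes g :: "nat \<Rightarrow> 'm::finite" and m :: nat
  assumes m: "m \<ge> 1" and inj: "inj_on g {..<4 * m + 2}"
begin

lemma m_pos [simp]: "0 < m" using m by simp

text \<open>With \<open>m = n - 1\<close>, the \<open>4 * m + 2\<close> indices are split into
  blocks of sizes \<open>m\<close>, \<open>m\<close>, \<open>m + 1\<close>,
  \<open>m + 1\<close>.\<close>

definition "X k = g k"
definition "Z k = g (m + k)"
definition "Y k = g (2 * m + k)"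
definition "W k = g (3 * m + 1 + k)"

lemma coords_eq [simp]:
  "k < m \<Longrightarrow> l < m \<Longrightarrow> X k = X l \<longleftrightarrow> k = l"
  "k < m \<Longrightarrow> l < m \<Longrightarrow> Z k = Z l \<longleftrightarrow> k = l"
  "k \<le> m \<Longrightarrow> l \<le> m \<Longrightarrow> Y k = Y l \<longleftrightarrow> k = l"
  "k \<le> m \<Longrightarrow> l \<le> m \<Longrightarrow> W k = W l \<longleftrightarrow> k = l"
  "k < m \<Longrightarrow> l < m \<Longrightarrow> X k \<noteq> Z l" "k < m \<Longrightarrow> l < m \<Longrightarrow> Z l \<noteq> X k"
  "k < m \<Longrightarrow> l \<le> m \<Longrightarrow> X k \<noteq> Y l" "k < m \<Longrightarrow> l \<le> m \<Longrightarrow> Y l \<noteq> X k"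
  "k < m \<Longrightarrow> l \<le> m \<Longrightarrow> X k \<noteq> W l" "k < m \<Longrightarrow> l \<le> m \<Longrightarrow> W l \<noteq> X k"
  "k < m \<Longrightarrow> l \<le> m \<Longrightarrow> Z k \<noteq> Y l" "k < m \<Longrightarrow> l \<le> m \<Longrightarrow> Y l \<noteq> Z k"
  "k < m \<Longrightarrow> l \<le> m \<Longrightarrow> Z k \<noteq> W l" "k < m \<Longrightarrow> l \<le> m \<Longrightarrow> W l \<noteq> Z k"
  "k \<le> m \<Longrightarrow> l \<le> m \<Longrightarrow> Y k \<noteq> W l" "k \<le> m \<Longrightarrow> l \<le> m \<Longrightarrow> W l \<noteq> Y k"
  unfolding X_def Y_def Z_def W_def by (subst inj_on_eq_iff[OF inj]; simp)+

definition C :: "'m set" where "C = W ` {..m}"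

lemma notin_C [simp]: "k < m \<Longrightarrow> X k \<notin> C" "k < m \<Longrightarrow> Z k \<notin> C" "k \<le> m \<Longrightarrow> Y k \<notin> C"
  by (auto simp: C_def)

text \<open>With \<open>\<omega>\<^sub>k = dw\<^sub>k - (B v)\<^sub>k\<close> at the point \<open>v\<close>, this encodes
  \<open>\<omega>\<^sub>0 = dw\<^sub>0 + \<bar>y\<^sub>0 dz\<^sub>0\<close> and \<open>\<omega>\<^sub>k\<^sub>+\<^sub>1 = dw\<^sub>k\<^sub>+\<^sub>1 - \<bar>z\<^sub>k dy\<^sub>k + x\<^sub>k dy\<^sub>k\<^sub>+\<^sub>1\<close>.\<close>

definition B :: "complex ^ 'm \<Rightarrow> complex ^ 'm \<Rightarrow> complex ^ 'm" where
  "B v u = axis (W 0) (- cnj (v $ Y 0) * u $ Z 0) +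
    (\<Sum>k<m. axis (W (Suc k)) (cnj (v $ Z k) * u $ Y k - v $ X k * u $ Y (Suc k)))"

lemma B_other: "i \<notin> C \<Longrightarrow> B v u $ i = 0"
  by (auto simp: B_def axis_def C_def intro!: sum.neutral)

lemma B_W0: "B v u $ W 0 = - cnj (v $ Y 0) * u $ Z 0"
  by (simp add: B_def axis_def)

lemma B_WSuc:
  assumes "k < m"
  shows "B v u $ W (Suc k) = cnj (v $ Z k) * u $ Y k - v $ X k * u $ Y (Suc k)"
proof -
  have "B v u $ W (Suc k) =
      (\<Sum>l<m. if k = l then cnj (v $ Z l) * u $ Y l - v $ X l * u $ Y (Suc l) else 0)"
    using assms by (simp add: B_def axis_def)
  then show ?thesis using assms by simp
qed

lemma vec_eqI:
  assumes "v $ W 0 = u $ W 0" "\<And>k. k < m \<Longrightarrow> v $ W (Suc k) = u $ W (Suc k)"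
    "\<And>i. i \<notin> C \<Longrightarrow> v $ i = (u $ i :: complex)"
  shows "v = u"
proof -
  have "v $ i = u $ i" for i
  proof (cases "i \<in> C")
    case True
    then obtain k where "i = W k" "k \<le> m" by (auto simp: C_def)
    then show ?thesis using assms(1,2) by (cases k) auto
  qed (rule assms(3))
  then show ?thesis by (simp add: vec_eq_iff)
qed

lemma B_bilinear: "bounded_bilinear B"
proof -
  have "linear (B v)" for v
    by (intro linearI; rule vec_eqI)
       (simp_all add: B_W0 B_WSuc B_other algebra_simps scaleR_conv_of_real[where 'a = complex])
  moreover have "linear (\<lambda>v. B v u)" for u
    by (intro linearI; rule vec_eqI)
       (simp_all add: B_W0 B_WSuc B_other algebra_simps scaleR_conv_of_real[where 'a = complex])
  ultimately show ?thesis
    by (simp add: bilinear_conv_bounded_bilinear[symmetric] bilinear_def)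
qed

lemma B_gauss:
  assumes "v \<in> gauss_lattice" "u \<in> gauss_lattice"
  shows "B v u \<in> gauss_lattice"
proof -
  have int: "Re (v $ i) \<in> \<int>" "Im (v $ i) \<in> \<int>" "Re (u $ i) \<in> \<int>" "Im (u $ i) \<in> \<int>" for i
    using assms by (simp_all add: gauss_lattice_def)
  have "Re (B v u $ i) \<in> \<int> \<and> Im (B v u $ i) \<in> \<int>" for i
  proof (cases "i \<in> C")
    case True
    then obtain k where k: "i = W k" "k \<le> m" by (auto simp: C_def)
    show ?thesis
    proof (cases k)
      case 0
      then show ?thesis using k int by (simp add: B_W0)
    next
      case (Suc l)
      then show ?thesis using k int by (simp add: B_WSuc)
    qed
  qed (simp add: B_other)
  then show ?thesis by (simp add: gauss_lattice_def)
qed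

text \<open>\<open>B\<close> takes values in the \<open>W\<close> coordinates and reads none of
  them, which gives the centrality conditions.\<close>

sublocale two_step B C
proof
  show "\<exists>K. \<forall>a b. norm (B a b) \<le> norm a * norm b * K"
    using bounded_bilinear.bounded[OF B_bilinear] by blast
qed (auto simp: bounded_bilinear.add_left[OF B_bilinear] bounded_bilinear.add_right[OF B_bilinear]
    bounded_bilinear.scaleR_left[OF B_bilinear] bounded_bilinear.scaleR_right[OF B_bilinear]
    B_gauss B_other m intro!: vec_eqI simp: B_W0 B_WSuc algebra_simps)

lemma basic_coords:
  "k < m \<Longrightarrow> basic (dz (X k))" "k < m \<Longrightarrow> basic (dzbar (Z k))" "k \<le> m \<Longrightarrow> basic (dz (Y k))"
  by (simp_all add: basic_def linear_dz linear_dzbar) (simp_all add: dz_def dzbar_def B_other)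

section \<open>The zigzag of left-invariant forms\<close>

definition Xs :: "nat \<Rightarrow> 'm list" where "Xs j = map X [0..<j]"
definition Zs :: "nat \<Rightarrow> 'm list" where "Zs j = map Z [j..<m]"

lemma Zs_Cons: "k < m \<Longrightarrow> Zs k = Z k # Zs (Suc k)"
  by (simp add: Zs_def upt_conv_Cons)

text \<open>The forms through which the zigzag passes: \<open>del (beta j)\<close> for
  \<open>c = 1\<close> and \<open>delbar (beta (Suc j))\<close> for \<open>c = -1\<close>.\<close>

definition NN :: "complex \<Rightarrow> nat \<Rightarrow> ((complex ^ 'm) set, 'm) form" where
  "NN c j = glob (\<lambda>x vs. c * wedge (map dz (Y j # Xs j) @ map dzbar (Zs j)) vs)"

text \<open>The sign \<open>(-1) ^ Suc k\<close> absorbs the signs from reordering wedges, so that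
  consecutive contributions cancel.\<close>

fun beta :: "nat \<Rightarrow> ((complex ^ 'm) set, 'm) form" where
  "beta 0 = glob (lform (dzbar (W 0)) (map dzbar (Zs 1)))"
| "beta (Suc k) = glob (lform (\<lambda>u. (-1) ^ Suc k * dz (W (Suc k)) u) (map dz (Xs k) @ map dzbar (Zs (Suc k))))"

lemma linear_scaled_dz: "linear (\<lambda>u. c * dz i u)"
  by (intro linearI) (simp_all add: dz_def algebra_simps)

lemma basic_NN:
  assumes "j \<le> m" "\<phi> \<in> set (map dz (Y j # Xs j) @ map dzbar (Zs j))"
  shows "basic \<phi>"
  using assms basic_coords by (auto simp: Xs_def Zs_def)

lemma del_beta: "k \<le> m \<Longrightarrow> del (beta k) = NN 1 k"
proof (cases k)
  case 0
  have "alt_deriv (derivE 1) (beta 0) = glob (\<lambda>x vs. 1 * wedge (dz (Y 0) # dzbar (Z 0) # map dzbar (Zs 1)) vs)"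
    unfolding beta.simps
    by (rule alt_deriv_glob_lform[OF linear_dzbar]) (simp add: dz_def dzbar_def B_W0 i_mult_i_mult mult.assoc)
  then show ?thesis using Zs_Cons[of 0] by (simp add: 0 del_derivE NN_def Xs_def)
next
  case (Suc k')
  assume "k \<le> m"
  then have k': "k' < m" using Suc by simp
  have "alt_deriv (derivE 1) (beta k) = glob (\<lambda>x vs. (-1) ^ k *
      wedge (dz (X k') # dz (Y k) # (map dz (Xs k') @ map dzbar (Zs k))) vs)"
    unfolding beta.simps Suc
    by (rule alt_deriv_glob_lform[OF linear_scaled_dz]) (simp add: dz_def B_WSuc[OF k'] algebra_simps i_mult_i_mult)
  moreover have "(-1) ^ k * wedge (dz (X k') # dz (Y k) # (map dz (Xs k') @ map dzbar (Zs k))) vs =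
      1 * wedge (map dz (Y k # Xs k) @ map dzbar (Zs k)) vs" for vs
  proof -
    \<comment> \<open>The new factor is moved past \<open>dz (Y k)\<close> and the \<open>k'\<close>
      earlier ones; the resulting sign cancels the one in \<open>beta k\<close>.\<close>
    have "wedge ([] @ dz (X k') # (dz (Y k) # map dz (Xs k')) @ map dzbar (Zs k)) vs =
        (-1) ^ k * wedge (map dz (Y k # Xs k) @ map dzbar (Zs k)) vs"
      by (subst wedge_move) (simp add: Suc Xs_def)
    then show ?thesis by (simp add: mult.assoc[symmetric] power_mult_distrib[symmetric])
  qed
  ultimately show ?thesis by (simp add: del_derivE NN_def)
qed

text \<open>The conjugate of \<open>B v u $ W 0\<close> is complex linear in \<open>v\<close>, so it
  has no (0,1)-derivative.\<close>

lemma delbar_beta_0: "delbar (beta 0) = 0"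
proof -
  have "alt_deriv (derivE (-1)) (beta 0) =
      glob (\<lambda>x vs. 0 * wedge (dz (Y 0) # dzbar (Z 0) # map dzbar (Zs 1)) vs)"
    unfolding beta.simps
    by (rule alt_deriv_glob_lform[OF linear_dzbar]) (simp add: dz_def dzbar_def B_W0 i_mult_i_mult mult.assoc)
  then show ?thesis by (simp add: delbar_derivE glob_0)
qed

lemma delbar_beta_Suc:
  assumes k: "k < m"
  shows "delbar (beta (Suc k)) = NN (-1) k"
proof -
  have "alt_deriv (derivE (-1)) (beta (Suc k)) = glob (\<lambda>x vs. (-1) ^ k *
      wedge (dzbar (Z k) # dz (Y k) # (map dz (Xs k) @ map dzbar (Zs (Suc k)))) vs)"
    unfolding beta.simps
    by (rule alt_deriv_glob_lform[OF linear_scaled_dz]) (simp add: dz_def dzbar_def B_WSuc[OF k] algebra_simps i_mult_i_mult)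
  moreover have "(-1) ^ k * wedge (dzbar (Z k) # dz (Y k) # (map dz (Xs k) @ map dzbar (Zs (Suc k)))) vs =
      - 1 * wedge (map dz (Y k # Xs k) @ map dzbar (Zs k)) vs" for vs
  proof -
    \<comment> \<open>Here \<open>k + 1\<close> covectors are passed, which together with
      \<open>(-1) ^ k\<close> leaves the factor \<open>-1\<close>.\<close>
    have "wedge ([] @ dzbar (Z k) # (dz (Y k) # map dz (Xs k)) @ map dzbar (Zs (Suc k))) vs =
        (-1) ^ Suc k * wedge (map dz (Y k # Xs k) @ map dzbar (Zs k)) vs"
      by (subst wedge_move) (simp add: Zs_Cons[OF k] Xs_def)
    then show ?thesis by (simp add: mult.assoc[symmetric] power_mult_distrib[symmetric])
  qed
  ultimately show ?thesis by (simp add: delbar_derivE NN_def)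
qed

lemma NN_pq: "j \<le> m \<Longrightarrow> NN c j \<in> pq_forms atlas (Suc j) (m - j)"
  unfolding NN_def by (rule glob_basic_pq) (auto intro: basic_NN simp: Xs_def Zs_def simp del: map_append)

text \<open>As \<open>coframe v\<close> is complex linear, the first factor is antilinear for
  \<open>k = 0\<close> and complex linear otherwise.\<close>

lemma beta_pq: "k \<le> m \<Longrightarrow> beta k \<in> pq_forms atlas k (m - k)"
proof (cases k)
  case 0
  have "lform (dzbar (W 0)) (map dzbar (Zs 1)) v \<in> pq_covectors 0 (Suc (length (Zs 1)))" for v
    unfolding lform_def
  proof (rule wedge_cantilinear_pq)
    fix u
    have "dz (W 0) (coframe v u) = (\<Sum>i\<in>UNIV. dz (W 0) (coframe v (axis i 1)) * dz i u)"
      by (rule clinear_expand[of "dz (W 0) \<circ> coframe v", unfolded o_def])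
         (auto simp: coframe_clinear dz_def intro!: linear_compose[OF linear_coframe linear_dz, unfolded o_def dz_def])
    from arg_cong[OF this, of cnj]
    show "(dzbar (W 0) \<circ> coframe v) u = (\<Sum>i\<in>UNIV. cnj (dz (W 0) (coframe v (axis i 1))) * dzbar i u)"
      by (simp add: dz_def dzbar_def)
  qed
  then show ?thesis
    using 0 m by (auto intro!: glob_lform_pq_forms linear_dzbar basic_coords simp: Zs_def)
next
  case (Suc k')
  assume "k \<le> m"
  then have k': "k' < m" using Suc by simp
  let ?\<psi> = "\<lambda>u. (-1) ^ k * dz (W k) u"
  have "lform ?\<psi> (map dz (Xs k') @ map dzbar (Zs k)) v \<in> pq_covectors (Suc (length (Xs k'))) (length (Zs k))" for v
    unfolding lform_def
  proof (rule wedge_clinear_pq)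
    fix u
    show "(?\<psi> \<circ> coframe v) u = (\<Sum>i\<in>UNIV. (?\<psi> \<circ> coframe v) (axis i 1) * dz i u)"
    proof (rule clinear_expand)
      show "linear (?\<psi> \<circ> coframe v)" by (rule linear_compose[OF linear_coframe linear_scaled_dz])
    qed (simp add: coframe_clinear dz_def)
  qed
  then have "glob (lform ?\<psi> (map dz (Xs k') @ map dzbar (Zs k)))
      \<in> pq_forms atlas (Suc (length (Xs k'))) (length (Zs k))"
    by (rule glob_lform_pq_forms[OF linear_scaled_dz, rotated])
       (use k' in \<open>auto intro!: basic_coords simp: Zs_def Xs_def\<close>)
  then show ?thesis by (simp only: Suc beta.simps) (simp add: Xs_def Zs_def)
qed

section \<open>The dual zigzag of frame vectors\<close>

definition XV :: "nat \<Rightarrow> ((complex ^ 'm) \<times> complex) list" where "XV j = map (\<lambda>k. (axis (X k) 1, 1)) [0..<j]"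
definition ZV :: "nat \<Rightarrow> ((complex ^ 'm) \<times> complex) list" where "ZV j = map (\<lambda>k. (axis (Z k) 1, -1)) [j..<m]"
definition YV :: "nat \<Rightarrow> (complex ^ 'm) \<times> complex" where "YV j = (axis (Y j) 1, 1)"

text \<open>Evaluation on the frame vectors dual, up to sign, to the factors of
  \<open>beta (Suc k)\<close>.\<close>

definition Psi :: "nat \<Rightarrow> ((complex ^ 'm) list \<Rightarrow> complex) \<Rightarrow> complex" where
  "Psi k F = tev F ((axis (W (Suc k)) 1, 1) # XV k @ ZV (Suc k))"

lemma tev_NN: "j \<le> m \<Longrightarrow> tev (wedge (map dz (Y j # Xs j) @ map dzbar (Zs j))) (YV j # XV j @ ZV j) = 1"
proof (rule tev_wedge_dual)
  assume j: "j \<le> m"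
  show "length (map dz (Y j # Xs j) @ map dzbar (Zs j)) = length (YV j # XV j @ ZV j)"
    by (simp add: Xs_def Zs_def XV_def ZV_def)
  fix i k assume ik: "i < length (YV j # XV j @ ZV j)" "k < length (YV j # XV j @ ZV j)"
  have len: "length (YV j # XV j @ ZV j) = Suc m" using j by (simp add: XV_def ZV_def)
  \<comment> \<open>The entries by position; the leading \<open>Y j\<close> shifts the indices of
    \<open>X\<close> and \<open>Z\<close> by one.\<close>
  define \<phi> where "\<phi> i = (if i = 0 then dz (Y j) else if i \<le> j then dz (X (i - 1)) else dzbar (Z (i - 1)))" for i
  define p :: "nat \<Rightarrow> (complex ^ 'm) \<times> complex" where "p i = (if i = 0 then (axis (Y j) 1, 1) else if i \<le> j then (axis (X (i - 1)) 1, 1)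
     else (axis (Z (i - 1)) 1, -1))" for i
  have "(map dz (Y j # Xs j) @ map dzbar (Zs j)) ! i = \<phi> i" if "i < Suc m" for i
    using that j by (cases i) (auto simp: \<phi>_def Xs_def Zs_def nth_append)
  moreover have "(YV j # XV j @ ZV j) ! i = p i" if "i < Suc m" for i
    using that j by (cases i) (auto simp: p_def YV_def XV_def ZV_def nth_append)
  moreover have "typed (\<phi> i) (p k) = (if i = k then 1 else 0)"
    using ik[unfolded len] j
    by (auto simp: \<phi>_def p_def typed_def dz_def dzbar_def axis_def)
  ultimately show "typed ((map dz (Y j # Xs j) @ map dzbar (Zs j)) ! i) ((YV j # XV j @ ZV j) ! k) = (if i = k then 1 else 0)"
    using ik[unfolded len] by simp
qed

lemma B_axis:
  "k < m \<Longrightarrow> l \<le> m \<Longrightarrow> B (c *s axis (X k) 1) (axis (Y l) 1) = (if l = Suc k then (- c) *s axis (W (Suc k)) 1 else 0)"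
  "k < m \<Longrightarrow> l \<le> m \<Longrightarrow> B (c *s axis (Z k) 1) (axis (Y l) 1) = (if l = k then cnj c *s axis (W (Suc k)) 1 else 0)"
  "k < m \<Longrightarrow> B h (axis (X k) 1) = 0"
  "k < m \<Longrightarrow> l < m \<Longrightarrow> B (c *s axis (X k) 1) (axis (Z l) 1) = 0"
  "k < m \<Longrightarrow> l < m \<Longrightarrow> B (c *s axis (Z k) 1) (axis (Z l) 1) = 0"
  "k \<le> m \<Longrightarrow> l < m \<Longrightarrow> B (c *s axis (Y k) 1) (axis (Z l) 1) = (if k = 0 \<and> l = 0 then (- cnj c) *s axis (W 0) 1 else 0)"
  by (rule vec_eqI; auto simp: B_W0 B_WSuc B_other axis_def C_def)+

lemma length_XV_ZV: "j \<le> m \<Longrightarrow> length (XV j @ ZV j) = m"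
  by (simp add: XV_def ZV_def)

lemma nth_XV_ZV:
  "j \<le> m \<Longrightarrow> i < m \<Longrightarrow> (XV j @ ZV j) ! i = (if i < j then (axis (X i) 1, 1) else (axis (Z i) 1, -1))"
  by (cases "i < j") (simp_all add: XV_def ZV_def nth_append)

lemma set_XV_ZV:
  assumes "j \<le> m" "p \<in> set (XV j @ ZV j)"
  shows "(\<exists>k<m. fst p = axis (X k) 1) \<or> (\<exists>k<m. k \<ge> j \<and> fst p = axis (Z k) 1)"
proof -
  consider k where "k < j" "p = (axis (X k) 1, 1)" | k where "j \<le> k" "k < m" "p = (axis (Z k) 1, -1)"
    using assms(2) by (auto simp: XV_def ZV_def)
  then show ?thesis
  proof cases
    case (1 k)
    then have "k < m" using assms(1) by simp
    then show ?thesis using 1(2) by auto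
  qed auto
qed

lemma remove_at_XV_ZV:
  "i < m \<Longrightarrow> remove_at i (XV (Suc i) @ ZV (Suc i)) = XV i @ ZV (Suc i)"
  "i < m \<Longrightarrow> remove_at i (XV i @ ZV i) = XV i @ ZV (Suc i)"
proof -
  have *: "remove_at (length as) (as @ b # bs) = as @ bs" for as bs and b :: 'b
    by (simp add: remove_at_def)
  show "remove_at i (XV (Suc i) @ ZV (Suc i)) = XV i @ ZV (Suc i)"
    using *[of "XV i" "(axis (X i) 1, 1)" "ZV (Suc i)"] by (simp add: XV_def)
  show "remove_at i (XV i @ ZV i) = XV i @ ZV (Suc i)" if "i < m"
    using *[of "XV i" "(axis (Z i) 1, -1)" "ZV (Suc i)"] that
    by (simp add: XV_def ZV_def upt_conv_Cons)
qed

text \<open>On the listed vectors, \<open>B\<close> is non-zero only for \<open>X (j - 1)\<close> or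
  \<open>Z j\<close> paired with \<open>Y j\<close>, apart from \<open>Y 0\<close> paired with
  \<open>Z 0\<close>. The latter occurs for \<open>j = 0\<close> and only in the (1,0)-part, whence
  the condition on \<open>e\<close>.\<close>

lemma tev_covd_frame:
  assumes F: "multilinear F" and j: "j \<le> m" and e: "e = -1 \<or> (e = 1 \<and> j \<noteq> 0)"
  shows "tev (covd e F) (YV j # XV j @ ZV j) =
    (\<Sum>i<m. (-1) ^ i * ((if j = Suc i then - (1 + e) / 2 * Psi i F else 0) +
      (if j = i then (1 - e) / 2 * Psi i F else 0)))"
proof -
  let ?P = "XV j @ ZV j"
  let ?T = "\<lambda>i. typed (\<lambda>h. typed (subst_sum F (YV j # remove_at i ?P)) (h, e)) (?P ! i)"
  \<comment> \<open>Taking \<open>Y j\<close> as the direction \<open>h\<close> gives nothing: for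
    \<open>j = 0\<close> the only term is of type (1,0), whereas \<open>e = -1\<close>.\<close>
  have 0: "typed (\<lambda>h. typed (subst_sum F ?P) (h, e)) (YV j) = 0"
  proof (cases "j = 0")
    case False
    have "subst_sum F ?P (c *s axis (Y j) 1) = 0 * c + 0 * cnj c" for c
    proof -
      have "subst_sum F ?P (c *s axis (Y j) 1) = 0"
      proof (rule subst_sum_zero[OF F])
        fix p assume "p \<in> set ?P"
        from set_XV_ZV[OF j this] False j show "B (c *s axis (Y j) 1) (fst p) = 0"
          by (auto simp: B_axis)
      qed
      then show ?thesis by simp
    qed
    from typed_typed_axis[OF this, of e 1] show ?thesis by (simp add: YV_def)
  next
    case True
    have P: "?P = (axis (Z 0) 1, -1) # ZV 1"
      by (simp add: True XV_def ZV_def upt_conv_Cons)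
    have "subst_sum F ?P (c *s axis (Y j) 1) = (- tev F ((axis (W 0) 1, -1) # ZV 1)) * c + 0 * cnj c" for c
    proof -
      have "subst_sum F ?P (c *s axis (Y j) 1) = tev F ((B (c *s axis (Y j) 1) (axis (Z 0) 1), -1) # ZV 1)"
        unfolding P
      proof (rule subst_sum_Cons[OF F])
        fix p assume "p \<in> set (ZV 1)"
        then show "B (c *s axis (Y j) 1) (fst p) = 0" using j by (auto simp: ZV_def B_axis)
      qed
      also have "\<dots> = tev F (((- cnj c) *s axis (W 0) 1, -1) # ZV 1)"
        by (simp add: True B_axis del: tev.simps)
      also have "\<dots> = - c * tev F ((axis (W 0) 1, -1) # ZV 1)"
        unfolding tev_cscale(2)[OF F] by simp
      finally show ?thesis by simp
    qed
    from typed_typed_axis[OF this, of e 1] show ?thesis using e True by (simp add: YV_def)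
  qed
  have T: "?T i = (if j = Suc i then - (1 + e) / 2 * Psi i F else 0) + (if j = i then (1 - e) / 2 * Psi i F else 0)"
    if i: "i < m" for i
  proof -
    have red: "subst_sum F (YV j # remove_at i ?P) (c *s axis a 1) =
        tev F ((B (c *s axis a 1) (axis (Y j) 1), 1) # remove_at i ?P)" if a: "a = X i \<or> a = Z i" for c a
      unfolding YV_def
    proof (rule subst_sum_Cons[OF F])
      fix p assume "p \<in> set (remove_at i ?P)"
      then have "p \<in> set ?P" by (rule subsetD[OF set_remove_at])
      from set_XV_ZV[OF j this] obtain k where "k < m" "fst p = axis (X k) 1 \<or> fst p = axis (Z k) 1"
        by blast
      then show "B (c *s axis a 1) (fst p) = 0"
        using a i B_axis(3)[of k] B_axis(4)[of i k c] B_axis(5)[of i k c] by metis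
    qed
    have zero: "tev F ((0, e') # l) = 0" for e' l
      using tev_zero[OF F, of "[]"] by simp
    show ?thesis
    proof (cases "i < j")
      case True
      have "subst_sum F (YV j # remove_at i ?P) (c *s axis (X i) 1) =
          (if j = Suc i then - Psi i F else 0) * c + 0 * cnj c" for c
      proof (cases "j = Suc i")
        case True
        have "subst_sum F (YV j # remove_at i ?P) (c *s axis (X i) 1) =
            tev F (((- c) *s axis (W (Suc i)) 1, 1) # XV i @ ZV (Suc i))"
          unfolding red[OF disjI1[OF refl]] B_axis(1)[OF i j]
          by (simp only: True remove_at_XV_ZV(1)[OF i] refl if_True)
        also have "\<dots> = - c * Psi i F" unfolding tev_cscale(1)[OF F] Psi_def ..
        finally show ?thesis using True by simp
      qed (use i j in \<open>simp add: red B_axis zero del: tev.simps\<close>)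
      from typed_typed_axis[OF this, of e 1]
      have *: "?T i = ((1 + e) * 2 * (if j = Suc i then - Psi i F else 0)) / 4"
        unfolding nth_XV_ZV[OF j i] using True by simp
      show ?thesis unfolding * using True by (simp add: field_simps)
    next
      case False
      have "subst_sum F (YV j # remove_at i ?P) (c *s axis (Z i) 1) =
          0 * c + (if j = i then Psi i F else 0) * cnj c" for c
      proof (cases "j = i")
        case True
        then show ?thesis
          using i j unfolding red[OF disjI2[OF refl]]
          by (simp add: B_axis True remove_at_XV_ZV Psi_def tev_cscale(1)[OF F] del: tev.simps)
      qed (use i j in \<open>simp add: red B_axis zero del: tev.simps\<close>)
      from typed_typed_axis[OF this, of e "-1"]
      have *: "?T i = ((1 - e) * 2 * (if j = i then Psi i F else 0)) / 4"
        unfolding nth_XV_ZV[OF j i] using False by simp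
      show ?thesis unfolding * using False by (simp add: field_simps)
    qed
  qed
  have "tev (covd e F) (YV j # ?P) = (\<Sum>i<m. (-1) ^ i * ?T i)"
    unfolding tev_covd length_Cons length_XV_ZV[OF j] using 0
    by (simp add: sum.lessThan_Suc_shift sum_negf del: sum.lessThan_Suc)
  also have "\<dots> = (\<Sum>i<m. (-1) ^ i * ((if j = Suc i then - (1 + e) / 2 * Psi i F else 0) +
      (if j = i then (1 - e) / 2 * Psi i F else 0)))"
    by (intro sum.cong refl) (simp only: T lessThan_iff)
  finally show ?thesis .
qed

lemma tev_covd_10:
  assumes "multilinear F" "k < m"
  shows "tev (covd 1 F) (YV (Suc k) # XV (Suc k) @ ZV (Suc k)) = - ((-1) ^ k * Psi k F)"
  using assms by (subst tev_covd_frame) (auto simp: if_distrib[of "\<lambda>x. _ * x"] cong: if_cong)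

lemma tev_covd_01:
  assumes "multilinear F" "j \<le> m"
  shows "tev (covd (-1) F) (YV j # XV j @ ZV j) = (if j < m then (-1) ^ j * Psi j F else 0)"
  using assms by (subst tev_covd_frame) (auto simp: if_distrib[of "\<lambda>x. _ * x"] cong: if_cong)

text \<open>The component of the equation in first degree \<open>j + 1\<close>, averaged and
  evaluated on \<open>YV j # XV j @ ZV j\<close>, links \<open>Psi (j - 1)\<close> of
  \<open>\<eta> j\<close> to \<open>Psi j\<close> of \<open>\<eta> (Suc j)\<close>. The chain starts
  at 0 because \<open>y\<close> has no component in first degree 0.\<close>

lemma not_boundary:
  assumes y: "y \<in> Tot_filt (forms atlas) 1 (int m)"
    and Dy: "Tot_diff del delbar y = (\<lambda>i. if i = int m + 1 then NN 1 m else 0)"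
  shows False
proof -
  obtain \<mu> where \<mu>: "mean \<mu>" using mean_ex by blast
  define \<eta> where "\<eta> j = mcoef \<mu> (y (int j))" for j
  have forms: "y i \<in> forms atlas i (int m - i)" and low: "i < 1 \<Longrightarrow> y i = 0" for i
    using y by (simp_all add: Tot_filt_def Tot_def)
  \<comment> \<open>For \<open>j > m\<close> the second degree is negative and
    \<open>y (int j)\<close> is 0, which lies in \<open>pq_forms\<close> for any
    \<open>q\<close>.\<close>
  have pq: "\<exists>q. y (int j) \<in> pq_forms atlas j q" for j
    using forms[of "int j"] zero_pq_forms by (auto simp: forms_def split: if_splits)
  have ml: "multilinear (\<eta> j)" for j
    unfolding \<eta>_def using multilinear_mcoef[OF \<mu>] pq by blast
  have mcoef0: "mcoef \<mu> 0 = (\<lambda>us. 0)"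
    using mean_const[OF \<mu>, of 0]
    by (simp add: mcoef_def[OF \<mu>] fun_eq_iff coef_def[abs_def] pullback_def)
  have covd0: "covd e (\<lambda>us. 0) = (\<lambda>us. 0)" for e
    by (simp add: covd_def fun_eq_iff alt_def repl_def)
  have eq: "covd 1 (\<eta> j) us + covd (-1) (\<eta> (Suc j)) us =
      (if j = m then wedge (map dz (Y j # Xs j) @ map dzbar (Zs j)) us else 0)" for j us
  proof -
    obtain q q' where q: "y (int j) \<in> pq_forms atlas j q" "y (int (Suc j)) \<in> pq_forms atlas (Suc j) q'"
      using pq by blast
    have "Tot_diff del delbar y (int (Suc j)) = (if j = m then NN 1 m else 0)"
      using Dy by (simp add: fun_eq_iff)
    then have "alt_deriv (derivE 1) (y (int j)) + alt_deriv (derivE (-1)) (y (int (Suc j))) =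
        (if j = m then NN 1 m else 0)"
      by (simp add: Tot_diff_def del_derivE delbar_derivE)
    moreover have "coef (if j = m then NN 1 m else 0) us v =
        (if j = m then wedge (map dz (Y j # Xs j) @ map dzbar (Zs j)) us else 0)" for us v
      using coef_glob_basic[of "map dz (Y m # Xs m) @ map dzbar (Zs m)" 1 us v] basic_NN[of m]
      by (auto simp: NN_def coef_def[of 0] pullback_def)
    ultimately show ?thesis
      unfolding \<eta>_def by (rule covd_mcoef_add[OF \<mu> q])
  qed
  have tev_eq: "tev (covd 1 (\<eta> j)) (YV j # XV j @ ZV j) + tev (covd (-1) (\<eta> (Suc j))) (YV j # XV j @ ZV j) =
      (if j = m then 1 else 0)" if "j \<le> m" for j
  proof -
    have "tev (covd 1 (\<eta> j)) (YV j # XV j @ ZV j) + tev (covd (-1) (\<eta> (Suc j))) (YV j # XV j @ ZV j) =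
        tev (\<lambda>us. if j = m then wedge (map dz (Y j # Xs j) @ map dzbar (Zs j)) us else 0) (YV j # XV j @ ZV j)"
      unfolding tev_lin[symmetric] by (simp only: eq)
    then show ?thesis using tev_NN[OF that] tev_lin(5) by (cases "j = m") (simp_all del: tev.simps)
  qed
  have "Psi k (\<eta> (Suc k)) = 0" if "k < m" for k
    using that
  proof (induction k)
    case 0
    have "\<eta> 0 = (\<lambda>us. 0)" using low[of 0] mcoef0 by (simp add: \<eta>_def)
    then have "tev (covd 1 (\<eta> 0)) l = 0" for l by (simp add: covd0 tev_lin)
    then show ?case using tev_eq[of 0] tev_covd_01[OF ml, of 0 1] 0 by (simp del: tev.simps)
  next
    case (Suc k)
    then show ?case
      using tev_eq[of "Suc k"] tev_covd_10[OF ml, of k "Suc k"] tev_covd_01[OF ml, of "Suc k" "Suc (Suc k)"]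
      by (simp del: tev.simps)
  qed
  moreover obtain k where k: "m = Suc k" using m by (cases m) auto
  ultimately have "Psi k (\<eta> m) = 0" by simp
  \<comment> \<open>For \<open>j = m\<close> the (0,1)-term is absent, and the equation reads
    \<open>0 = 1\<close>.\<close>
  then show False
    using tev_eq[of m] tev_covd_10[OF ml, of k m] tev_covd_01[OF ml, of m "Suc m"] k
    by (simp del: tev.simps)
qed

theorem froelicher_d_nonzero_atlas: "froelicher_d_nonzero atlas (int m + 1)"
proof -
  \<comment> \<open>The total form with components \<open>beta 0\<close>, ...,
    \<open>beta m\<close>; neighbouring contributions to its differential cancel and only
    \<open>del (beta m)\<close> remains.\<close>
  define z where "z i = (if 0 \<le> i \<and> i \<le> int m then beta (nat i) else 0)" for i
  have "z \<in> Tot (forms atlas) (int m)"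
    unfolding Tot_def
  proof (intro CollectI conjI allI)
    show "z i \<in> forms atlas i (int m - i)" for i
      using beta_pq[of "nat i"] by (auto simp: z_def zero_forms forms_def nat_diff_distrib)
    show "finite {i. z i \<noteq> 0}"
      by (rule finite_subset[of _ "{0..int m}"]) (auto simp: z_def)
  qed
  then have z: "z \<in> Tot_filt (forms atlas) 0 (int m)"
    by (simp add: Tot_filt_def z_def)
  have NN0: "NN 1 k + NN (-1) k = 0" for k
    by (simp add: NN_def fun_eq_iff glob_def)
  have Dz: "Tot_diff del delbar z = (\<lambda>i. if i = int m + 1 then NN 1 m else 0)"
  proof
    fix i
    consider "i < 0" | "i = 0" | k where "i = int (Suc k)" "k < m" | "i = int m + 1" | "i > int m + 1"
    proof -
      have "\<exists>k. i = int (Suc k) \<and> k < m" if "\<not> i < 0" "i \<noteq> 0" "i \<noteq> int m + 1" "\<not> i > int m + 1"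
        using that by (intro exI[of _ "nat (i - 1)"]) auto
      then show ?thesis using that by blast
    qed
    then show "Tot_diff del delbar z i = (if i = int m + 1 then NN 1 m else 0)"
    proof cases
      case 2
      then show ?thesis by (simp add: Tot_diff_def z_def delbar_beta_0 del: beta.simps)
    next
      case (3 k)
      have "Tot_diff del delbar z i = del (beta k) + delbar (beta (Suc k))"
        using 3 by (simp add: Tot_diff_def z_def nat_add_distrib del: beta.simps)
      then show ?thesis using 3 by (simp add: del_beta delbar_beta_Suc NN0 del: beta.simps)
    qed (auto simp: Tot_diff_def z_def del_beta simp del: beta.simps)
  qed
  have "Tot_diff del delbar z \<in> Tot (forms atlas) (int m + 1)"
    unfolding Tot_def
  proof (intro CollectI conjI allI)
    show "Tot_diff del delbar z i \<in> forms atlas i (int m + 1 - i)" for i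
      using NN_pq[of m 1] by (auto simp: Dz zero_forms zero_pq_forms forms_def nat_add_distrib)
    show "finite {i. Tot_diff del delbar z i \<noteq> 0}"
      by (rule finite_subset[of _ "{int m + 1}"]) (auto simp: Dz)
  qed
  then have "Tot_diff del delbar z \<in> Tot_filt (forms atlas) (int m + 1) (int m + 1)"
    by (simp add: Tot_filt_def Dz)
  with z show ?thesis
    by (rule froelicher_d_nonzeroI) (use not_boundary Dz in auto)
qed

end

theorem mainTheorem1:
  fixes n :: nat
  assumes "n \<ge> 2" and "CARD('m::finite) = 4 * n - 2"
  shows "\<exists>(X :: (complex ^ 'm) set topology) (\<A> :: ((complex ^ 'm) set, 'm) chart set).
           compact_complex_manifold X \<A> \<and> froelicher_d_nonzero \<A> (int n)"
proof -
  obtain g :: "nat \<Rightarrow> 'm" where g: "bij_betw g {..<4 * n - 2} UNIV"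
    using ex_bij_betw_nat_finite[of "UNIV :: 'm set"] assms(2) by (auto simp: atLeast0LessThan)
  \<comment> \<open>With \<open>m = n - 1\<close>, the number \<open>4 * m + 2\<close> of
    coordinates is the dimension \<open>4 * n - 2\<close>.\<close>
  interpret coordinates g "n - 1"
  proof
    have "4 * (n - 1) + 2 = 4 * n - 2" using assms(1) by simp
    then show "inj_on g {..<4 * (n - 1) + 2}" using g by (simp add: bij_betw_def)
  qed (use assms(1) in simp)
  have "int (n - 1) + 1 = int n" using assms(1) by simp
  then have "compact_complex_manifold quot_top atlas \<and> froelicher_d_nonzero atlas (int n)"
    using compact_complex_manifold_atlas froelicher_d_nonzero_atlas by simp
  then show ?thesis by blast
qed

end
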